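(* Let $0<p,q\le\infty$, $p\ne q$, $0<u\le\min(1,p,q)$, and $t>0$. Then there exist an increasing sequence $\{w(k)\}_{k=0}^\infty$ in $[1,\infty)$ and $m\in L^\infty(\mathbb{R}^d)$ such that $\sum_{k=0}^\infty w(k)^{-s}<\infty$ for all $s>\frac{1}{|1/p-1/q|}$ and $\mathcal{K}_u^{0,t}(w)[m]<\infty$, but $T_m$ is not bounded on $\dot F_p^{0,q}$.
   Context: Convention: $1/\infty=0$. Fourier transform: $\widehat f(\xi)=\int_{\mathbb{R}^d} f(x)e^{-2\pi i\langle x,\xi\rangle}dx$; $f^\vee$ is the inverse Fourier transform. Cutoff: $\varphi$ is a fixed smooth function on $\mathbb{R}^d$ with $0\le\varphi\le1$, $\varphi=1$ on $\{1/2\le|\xi|\le2\}$, $\mathrm{supp}\,\varphi\subset\{1/4\le|\xi|\le4\}$. Weighted Herz spaces: let $B_0=\{x:|x|\le2\}$ and $B_l=\{x\in\mathbb{R}^d:2^l<|x|\le2^{l+1}\}$ for $l\ge1$. For $0<u\le\infty$ and $t>0$, $\|f\|_{K_u^{0,t}(w)}:=\big(\sum_{l=0}^\infty\|f\|_{L^u(B_l)}^t\,w(l)^t\big)^{1/t}$ (supremum if $t=\infty$), and $\mathcal{K}_u^{0,t}(w)[m]:=\sup_{k\in\mathbb{Z}}\big\|(m(2^k\cdot)\varphi)^\vee\big\|_{K_u^{0,t}(w)}$. Littlewood–Paley pieces: $\phi$ is a fixed smooth function with $\widehat\phi$ supported in $\{1/2\le|\xi|\le2\}$ and $\sum_{k\in\mathbb{Z}}\widehat{\phi_k}(\xi)=1$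 for $\xi\ne0$, where $\phi_k=2^{kd}\phi(2^k\cdot)$; $\Pi_kf:=\phi_k*f$. Triebel–Lizorkin space: $\dot F_p^{0,q}$ is the space of $f\in S'/\mathcal{P}$ (tempered distributions modulo polynomials) with finite (quasi-)norm $\|f\|_{\dot F_p^{0,q}}:=\big\|\big(\sum_{k\in\mathbb{Z}}|\Pi_kf|^q\big)^{1/q}\big\|_{L^p}$ if $p<\infty$ or $p=q=\infty$ (supremum over $k$ if $q=\infty$), and $\|f\|_{\dot F_\infty^{0,q}}:=\sup_{P}\big(\frac1{|P|}\int_P\sum_{k=-\log_2 l(P)}^\infty|\Pi_kf(x)|^q\,dx\big)^{1/q}$ if $p=\infty$, $q<\infty$, the supremum being over all dyadic cubes $P\subset\mathbb{R}^d$ with side length $l(P)$. Multiplier operator: $T_mf=(m\widehat f)^\vee$ for $f\in S_\infty$, the space of Schwartz functions all of whose moments vanish. "$T_m$ is not bounded on $\dot F_p^{0,q}$" means that there is no constant $C<\infty$ with $\|T_mf\|_{\dot F_p^{0,q}}\le C\|f\|_{\dot F_p^{0,q}}$ for all $f\in S_\infty$ (the left side being $\infty$ if $T_mf\notin\dot F_p^{0,q}$). *)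

theory Defs
  imports "HOL-Probability.Essential_Supremum"
begin

text \<open>
  The underlying space is a Euclidean space \<open>'a\<close> with its orthonormal \<open>Basis\<close>; functions are
  complex-valued unless stated otherwise. Exponents in \<open>(0, \<infinity>]\<close> are positive elements of \<^typ>\<open>ennreal\<close>,
  and (quasi-)norms take values in \<^typ>\<open>ennreal\<close>, the value \<open>\<infinity>\<close> meaning that the function is
  not in the space.
\<close>

section \<open>Schwartz functions\<close>

primrec iter_partial ::
  "'a::euclidean_space list \<Rightarrow> ('a \<Rightarrow> 'b::real_normed_vector) \<Rightarrow> 'a \<Rightarrow> 'b" where
  "iter_partial [] f = f"
| "iter_partial (b # bs) f = (\<lambda>x. frechet_derivative (iter_partial bs f) (at x) b)"

text \<open>
  Requiring every iterated partial derivative to be (Frechet) differentiable makes all of them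
  continuous, so this is the class of infinitely differentiable functions.
\<close>

definition smooth :: "('a::euclidean_space \<Rightarrow> 'b::real_normed_vector) \<Rightarrow> bool" where
  "smooth f \<longleftrightarrow> (\<forall>bs \<in> lists Basis. \<forall>x. iter_partial bs f differentiable (at x))"

definition schwartz :: "('a::euclidean_space \<Rightarrow> complex) set" where
  "schwartz = {f. smooth f \<and>
     (\<forall>bs \<in> lists Basis. \<forall>n::nat. bounded (range (\<lambda>x. (1 + norm x) ^ n *\<^sub>R iter_partial bs f x)))}"

definition monomial :: "('a::euclidean_space \<Rightarrow> nat) \<Rightarrow> 'a \<Rightarrow> real" where
  "monomial \<alpha> x = (\<Prod>b\<in>Basis. (x \<bullet> b) ^ \<alpha> b)"

definition schwartz_infty :: "('a::euclidean_space \<Rightarrow> complex) set" where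
  "schwartz_infty = {f \<in> schwartz. \<forall>\<alpha>. (LINT x|lborel. monomial \<alpha> x *\<^sub>R f x) = 0}"

section \<open>Fourier transform and convolution\<close>

definition fourier :: "('a::euclidean_space \<Rightarrow> complex) \<Rightarrow> 'a \<Rightarrow> complex" where
  "fourier f \<xi> = (LINT x|lborel. f x * cis (- 2 * pi * (x \<bullet> \<xi>)))"

definition inv_fourier :: "('a::euclidean_space \<Rightarrow> complex) \<Rightarrow> 'a \<Rightarrow> complex" where
  "inv_fourier g x = (LINT \<xi>|lborel. g \<xi> * cis (2 * pi * (x \<bullet> \<xi>)))"

definition convol ::
  "('a::euclidean_space \<Rightarrow> complex) \<Rightarrow> ('a \<Rightarrow> complex) \<Rightarrow> 'a \<Rightarrow> complex" where
  "convol g f x = (LINT y|lborel. g (x - y) * f y)"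

definition fsupp :: "('a::topological_space \<Rightarrow> 'b::zero) \<Rightarrow> 'a set" where
  "fsupp f = closure {x. f x \<noteq> 0}"

section \<open>Lebesgue and sequence (quasi-)norms with exponents in \<open>(0, \<infinity>]\<close>\<close>

text \<open>Real powers on \<open>[0, \<infinity>]\<close>; only meant for positive exponents.\<close>

definition epow :: "ennreal \<Rightarrow> real \<Rightarrow> ennreal" where
  "epow x r = (if x = \<infinity> then \<infinity> else ennreal (enn2real x powr r))"

definition Lnorm :: "ennreal \<Rightarrow> 'a measure \<Rightarrow> ('a \<Rightarrow> ennreal) \<Rightarrow> ennreal" where
  "Lnorm p M g =
     (if p = \<infinity> then esssup M g
      else epow (\<integral>\<^sup>+ x. epow (g x) (enn2real p) \<partial>M) (1 / enn2real p))"

definition lnorm :: "ennreal \<Rightarrow> ('i \<Rightarrow> ennreal) \<Rightarrow> ennreal" where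
  "lnorm q a =
     (if q = \<infinity> then (SUP i. a i)
      else epow (\<Sum>\<^sub>\<infinity>i. epow (a i) (enn2real q)) (1 / enn2real q))"

definition L_infty :: "('a::euclidean_space \<Rightarrow> complex) set" where
  "L_infty = {m \<in> borel_measurable lborel. Lnorm \<infinity> lborel (\<lambda>x. ennreal (norm (m x))) < \<infinity>}"

section \<open>Weighted Herz spaces\<close>

definition is_cutoff :: "('a::euclidean_space \<Rightarrow> real) \<Rightarrow> bool" where
  "is_cutoff \<phi> \<longleftrightarrow> smooth \<phi> \<and> (\<forall>\<xi>. 0 \<le> \<phi> \<xi> \<and> \<phi> \<xi> \<le> 1) \<and>
     (\<forall>\<xi>. 1/2 \<le> norm \<xi> \<and> norm \<xi> \<le> 2 \<longrightarrow> \<phi> \<xi> = 1) \<and>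
     fsupp \<phi> \<subseteq> {\<xi>. 1/4 \<le> norm \<xi> \<and> norm \<xi> \<le> 4}"

definition annulus :: "nat \<Rightarrow> 'a::euclidean_space set" where
  "annulus l = (if l = 0 then {x. norm x \<le> 2} else {x. 2 ^ l < norm x \<and> norm x \<le> 2 ^ (l + 1)})"

definition herz_norm ::
  "ennreal \<Rightarrow> ennreal \<Rightarrow> (nat \<Rightarrow> real) \<Rightarrow> ('a::euclidean_space \<Rightarrow> complex) \<Rightarrow> ennreal" where
  "herz_norm u t w f =
     lnorm t (\<lambda>l. Lnorm u (restrict_space lborel (annulus l)) (\<lambda>x. ennreal (norm (f x))) * ennreal (w l))"

definition herz_mult ::
  "('a::euclidean_space \<Rightarrow> real) \<Rightarrow> ennreal \<Rightarrow> ennreal \<Rightarrow> (nat \<Rightarrow> real) \<Rightarrow> ('a \<Rightarrow> complex) \<Rightarrow> ennreal" where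
  "herz_mult \<phi> u t w m =
     (SUP k::int. herz_norm u t w (inv_fourier (\<lambda>\<xi>. m ((2 powi k) *\<^sub>R \<xi>) * of_real (\<phi> \<xi>))))"

section \<open>Triebel--Lizorkin spaces\<close>

definition dilate :: "('a::euclidean_space \<Rightarrow> complex) \<Rightarrow> int \<Rightarrow> 'a \<Rightarrow> complex" where
  "dilate \<psi> k x = of_real (2 powi (k * int DIM('a))) * \<psi> ((2 powi k) *\<^sub>R x)"

definition is_littlewood_paley :: "('a::euclidean_space \<Rightarrow> complex) \<Rightarrow> bool" where
  "is_littlewood_paley \<psi> \<longleftrightarrow> \<psi> \<in> schwartz \<and>
     fsupp (fourier \<psi>) \<subseteq> {\<xi>. 1/2 \<le> norm \<xi> \<and> norm \<xi> \<le> 2} \<and>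
     (\<forall>\<xi>. \<xi> \<noteq> 0 \<longrightarrow> ((\<lambda>k::int. fourier (dilate \<psi> k) \<xi>) has_sum 1) UNIV)"

definition LP_piece ::
  "('a::euclidean_space \<Rightarrow> complex) \<Rightarrow> int \<Rightarrow> ('a \<Rightarrow> complex) \<Rightarrow> 'a \<Rightarrow> complex" where
  "LP_piece \<psi> k f = convol (dilate \<psi> k) f"

text \<open>The dyadic cube of side length \<open>2 powi (- \<nu>)\<close> with lower corner \<open>2 powi (- \<nu>) * n\<close>.\<close>

definition dyadic_cube :: "int \<Rightarrow> ('a::euclidean_space \<Rightarrow> int) \<Rightarrow> 'a set" where
  "dyadic_cube \<nu> n =
     {x. \<forall>b\<in>Basis. 2 powi (- \<nu>) * of_int (n b) \<le> x \<bullet> b \<and> x \<bullet> b < 2 powi (- \<nu>) * (of_int (n b) + 1)}"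

text \<open>
  The homogeneous Triebel--Lizorkin (quasi-)norm of smoothness 0. It is defined here on functions
  instead of general classes of tempered distributions modulo polynomials. On a function of at most
  polynomial growth, regarded as a tempered distribution, convolution with the Schwartz function
  \<^term>\<open>dilate \<psi> k\<close> is given by the integral \<^const>\<open>convol\<close>, so membership of such a function in
  the space is finiteness of \<open>TL_norm\<close>. This covers all functions to which the norm is applied
  below: Schwartz functions, and functions \<open>multiplier m f\<close>, which are bounded and continuous
  because \<open>m\<close> is bounded and \<open>fourier f\<close> is integrable.
  In the case \<open>p = \<infinity> > q\<close>, a cube \<open>P = dyadic_cube \<nu> n\<close> has side length \<open>l(P) = 2 powi (- \<nu>)\<close>, so that
  the inner sum starts at \<open>- log 2 l(P) = \<nu>\<close>.
\<close>

definition TL_norm ::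
  "('a::euclidean_space \<Rightarrow> complex) \<Rightarrow> ennreal \<Rightarrow> ennreal \<Rightarrow> ('a \<Rightarrow> complex) \<Rightarrow> ennreal" where
  "TL_norm \<psi> p q f =
     (if p < \<infinity> \<or> q = \<infinity>
      then Lnorm p lborel (\<lambda>x. lnorm q (\<lambda>k::int. ennreal (norm (LP_piece \<psi> k f x))))
      else (SUP (\<nu>, n) \<in> UNIV. epow
             ((\<integral>\<^sup>+ x \<in> dyadic_cube \<nu> n.
                 (\<Sum>\<^sub>\<infinity>k\<in>{\<nu>..}. epow (ennreal (norm (LP_piece \<psi> k f x))) (enn2real q)) \<partial>lborel)
               / emeasure lborel (dyadic_cube \<nu> n :: 'a set))
             (1 / enn2real q)))"

definition multiplier ::
  "('a::euclidean_space \<Rightarrow> complex) \<Rightarrow> ('a \<Rightarrow> complex) \<Rightarrow> 'a \<Rightarrow> complex" where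
  "multiplier m f = inv_fourier (\<lambda>\<xi>. m \<xi> * fourier f \<xi>)"

definition TL_bounded ::
  "('a::euclidean_space \<Rightarrow> complex) \<Rightarrow> ennreal \<Rightarrow> ennreal \<Rightarrow> (('a \<Rightarrow> complex) \<Rightarrow> 'a \<Rightarrow> complex) \<Rightarrow> bool" where
  "TL_bounded \<psi> p q T \<longleftrightarrow>
     (\<exists>C::real. \<forall>f \<in> schwartz_infty. TL_norm \<psi> p q (T f) \<le> ennreal C * TL_norm \<psi> p q f)"

end

theory Submission
  imports
    Defs
    "HOL-Probability.Characteristic_Functions"
    "HOL-Probability.Sinc_Integral"
    "HOL-Real_Asymp.Real_Asymp"
begin

text \<open>
  Let \<open>\<sigma> = \<bar>1/p - 1/q\<bar>\<close> and \<open>w k = (k / ln k) powr \<sigma>\<close>, up to a shift of \<open>k\<close>. Near the frequency \<open>2 ^ k\<close>,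
  with \<open>k = 10 n + 10\<close>, the multiplier translates by \<open>2 ^ n\<close> in a fixed direction and multiplies by a
  number \<open>a n\<close>. After rescaling to unit frequency the translation is by \<open>2 ^ (k + n)\<close>, so the Herz norms are
  bounded uniformly when \<open>a n\<close> is about \<open>1 / w (k + n)\<close>. The operator is tested on sums of \<open>N\<close> packets,
  one at each of \<open>N\<close> successive frequencies, all of unit spatial scale: for \<open>p < q\<close> the packets sit on
  top of each other (norm about \<open>N powr (1/q)\<close>) and the operator moves them to disjoint places (norm
  about \<open>a N * N powr (1/p)\<close>); for \<open>q < p\<close> it moves disjoint packets on top of each other. The
  norm grows by a factor \<open>a N * N powr \<sigma>\<close>, which the logarithm makes unbounded. The packets are modulated
  translates of the Littlewood--Paley function itself, so no further bump function is needed, and the cutoff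
  is used to localize the multiplier.
\<close>

section \<open>Integration over Euclidean spaces\<close>

text \<open>The Herz norm charges a kernel translated by \<open>2 ^ l\<close> only the weight
  \<open>w l\<close>, so distance is paid for on a logarithmic scale. Lacunary shifts
  \<open>2 ^ n\<close> therefore separate N packets while the weight at the largest shift is only of
  order \<open>(N / ln N) powr \<sigma>\<close>. The summability condition does not see the
  logarithm, because \<open>(ln k / k) powr (\<sigma> * s)\<close> is summable as soon as
  \<open>\<sigma> * s > 1\<close>; the norm growth does see it, as a factor
  \<open>(ln N) powr \<sigma>\<close>. The exponents p, q and t may lie below 1, where the triangle
  inequality fails. Hence the generous frequency gaps: every scale sees at most one packet, and all
  quasi-norms are estimated from pointwise bounds. The support of the cutoff is 4 octaves wide, so
  two pieces meeting the same dilated cutoff would have frequencies at most 8 octaves apart, and the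
  gap 10 excludes this. A dilate k meets piece n only if k is within 4 of
  \<open>10 * n + 10\<close>; then \<open>k + n\<close> is at most \<open>11 * n + 14\<close>, the
  index at which the weight is evaluated.\<close>

lemma nn_integral_lborel_affine:
  fixes f :: "'a::euclidean_space \<Rightarrow> ennreal"
  assumes "c \<noteq> 0" and [measurable]: "f \<in> borel_measurable borel"
  shows "(\<integral>\<^sup>+x. f x \<partial>lborel) = ennreal (\<bar>c\<bar> ^ DIM('a)) * (\<integral>\<^sup>+x. f (t + c *\<^sub>R x) \<partial>lborel)"
  by (subst lborel_affine[OF assms(1), of t])
    (simp add: nn_integral_density nn_integral_distr nn_integral_cmult)

lemma lborel_integrable_affine:
  fixes f :: "'a::euclidean_space \<Rightarrow> 'b::{banach,second_countable_topology}"
  assumes "c \<noteq> 0" and f: "integrable lborel f"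
  shows "integrable lborel (\<lambda>x. f (t + c *\<^sub>R x))"
proof -
  have [measurable]: "f \<in> borel_measurable borel" using f by auto
  have "(\<integral>\<^sup>+x. norm (f x) \<partial>lborel) = ennreal (\<bar>c\<bar> ^ DIM('a)) * (\<integral>\<^sup>+x. norm (f (t + c *\<^sub>R x)) \<partial>lborel)"
    by (intro nn_integral_lborel_affine assms) auto
  moreover have "(\<integral>\<^sup>+x. norm (f x) \<partial>lborel) < \<infinity>"
    using f by (simp add: integrable_iff_bounded)
  moreover have "ennreal (\<bar>c\<bar> ^ DIM('a)) > 0" using assms(1) by simp
  ultimately have "(\<integral>\<^sup>+x. norm (f (t + c *\<^sub>R x)) \<partial>lborel) < \<infinity>"
    by (metis ennreal_mult_eq_top_iff infinity_ennreal_def less_top not_gr_zero)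
  then show ?thesis by (simp add: integrable_iff_bounded)
qed

lemma lborel_integral_affine:
  fixes f :: "'a::euclidean_space \<Rightarrow> 'b::{banach,second_countable_topology}"
  assumes "c \<noteq> 0" and [measurable]: "f \<in> borel_measurable borel"
  shows "(LINT x|lborel. f x) = \<bar>c\<bar> ^ DIM('a) *\<^sub>R (LINT x|lborel. f (t + c *\<^sub>R x))"
  by (subst lborel_affine[OF assms(1), of t])
    (simp add: integral_density integral_distr)

lemma lborel_integral_translate:
  fixes f :: "'a::euclidean_space \<Rightarrow> 'b::{banach,second_countable_topology}"
  assumes "f \<in> borel_measurable borel"
  shows "(LINT x|lborel. f (t + x)) = (LINT x|lborel. f x)"
  using lborel_integral_affine[of 1 f t] assms by simp

lemma integral_lborel_prod:
  fixes f :: "'a::euclidean_space \<Rightarrow> real \<Rightarrow> 'b::{real_normed_field,banach,second_countable_topology}"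
  assumes int: "\<And>b. b \<in> Basis \<Longrightarrow> integrable lborel (f b)"
  shows "(LINT x|lborel. (\<Prod>b\<in>Basis. f b (x \<bullet> b))) = (\<Prod>b\<in>Basis. LINT x|lborel. f b x)"
    and "integrable lborel (\<lambda>x::'a. \<Prod>b\<in>Basis. f b (x \<bullet> b))"
proof -
  \<comment> \<open>\<open>lborel\<close> on a Euclidean space is defined as the image of the
    product of these measures over \<open>Basis\<close>, and \<open>lborel_eq_real\<close>
    identifies each factor with the one-dimensional \<open>lborel\<close>.\<close>
  interpret product_sigma_finite "\<lambda>b::'a. interval_measure (\<lambda>x. x)"
    by (unfold product_sigma_finite_def) (auto simp flip: lborel_eq_real intro: sigma_finite_lborel)
  have int': "\<And>b. b \<in> Basis \<Longrightarrow> integrable (interval_measure (\<lambda>x. x)) (f b)"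
    using int by (simp add: lborel_eq_real)
  have [measurable]: "f b \<in> borel_measurable borel" if "b \<in> Basis" for b
    using int[OF that] by auto
  have m: "(\<lambda>x::'a. \<Prod>b\<in>Basis. f b (x \<bullet> b)) \<in> borel_measurable borel" by measurable
  have eq: "(\<Prod>b\<in>Basis. f b ((\<Sum>c\<in>Basis. x c *\<^sub>R c) \<bullet> b)) = (\<Prod>b\<in>Basis. f b (x b))" for x
    by (intro prod.cong) auto
  show "(LINT x|lborel. (\<Prod>b\<in>Basis. f b (x \<bullet> b))) = (\<Prod>b\<in>Basis. LINT x|lborel. f b x)"
    using product_integral_prod[OF finite_Basis int'] m
    by (subst lborel_def) (simp add: integral_distr eq lborel_eq_real)
  show "integrable lborel (\<lambda>x::'a. \<Prod>b\<in>Basis. f b (x \<bullet> b))"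
    using product_integrable_prod[OF finite_Basis int'] m
    by (subst lborel_def) (simp add: integrable_distr_eq eq)
qed

lemma integrable_inverse_1_plus_square_lborel: "integrable lborel (\<lambda>x::real. inverse (1 + x\<^sup>2))"
  using integrable_inverse_1_plus_square by (simp add: set_integrable_def einterval_def)

text \<open>A product of one-dimensional Cauchy densities is an integrable majorant, since each
  \<open>1 + (x \<bullet> b)^2\<close> is at most \<open>(1 + norm x)^2\<close>. The price is the
  exponent \<open>2 * DIM('a)\<close>, which is harmless because decay of every order is available
  later.\<close>

lemma integrable_bracket:
  assumes "s \<ge> 2 * real DIM('a)"
  shows "integrable lborel (\<lambda>x::'a::euclidean_space. (1 + norm x) powr (- s))"
proof (rule Bochner_Integration.integrable_bound)
  show "integrable lborel (\<lambda>x::'a. \<Prod>b\<in>Basis. inverse (1 + (x \<bullet> b)\<^sup>2))"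
    using integral_lborel_prod(2)[of "\<lambda>b x. inverse (1 + x\<^sup>2)"] integrable_inverse_1_plus_square_lborel by auto
  show "(\<lambda>x::'a. (1 + norm x) powr - s) \<in> borel_measurable lborel" by measurable
  have "(1 + norm x) powr - s \<le> (\<Prod>b\<in>Basis. inverse (1 + (x \<bullet> b)\<^sup>2))" for x :: 'a
  proof -
    have "(1 + norm x) powr - s \<le> (1 + norm x) powr - (2 * real DIM('a))"
      using assms by (intro powr_mono) auto
    also have "\<dots> = inverse ((1 + norm x) ^ (2 * DIM('a)))"
      by (simp add: powr_minus powr_realpow[symmetric] add_pos_nonneg)
    also have "\<dots> = (\<Prod>b\<in>(Basis::'a set). inverse ((1 + norm x)\<^sup>2))"
      by (simp add: power_mult power_inverse)
    also have "\<dots> \<le> (\<Prod>b\<in>Basis. inverse (1 + (x \<bullet> b)\<^sup>2))"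
    proof (intro prod_mono conjI le_imp_inverse_le)
      fix b :: 'a assume "b \<in> Basis"
      then have "(x \<bullet> b)\<^sup>2 \<le> (norm x)\<^sup>2" using Basis_le_norm[of b x] by (metis abs_ge_zero power2_abs power_mono)
      then show "1 + (x \<bullet> b)\<^sup>2 \<le> (1 + norm x)\<^sup>2" by (simp add: power2_eq_square algebra_simps) (smt (verit) norm_ge_zero)
    qed (auto simp: add_pos_nonneg)
    finally show ?thesis .
  qed
  then show "AE x::'a in lborel. norm ((1 + norm x) powr - s) \<le> norm (\<Prod>b\<in>Basis. inverse (1 + (x \<bullet> b)\<^sup>2))"
    by (auto intro!: AE_I2 order_trans[OF _ abs_ge_self])
qed

lemma bracket_power: "(1 + norm x) powr - real n = 1 / (1 + norm x) ^ n"
  by (simp add: powr_minus powr_realpow[symmetric] add_pos_nonneg divide_simps)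

lemma integrable_bracket_nat:
  assumes "n \<ge> 2 * DIM('a)"
  shows "integrable lborel (\<lambda>x::'a::euclidean_space. 1 / (1 + norm x) ^ n)"
  using integrable_bracket[where 'a='a, of "real n"] assms by (simp add: bracket_power)

text \<open>Peetre's inequality; it carries polynomial weights across translations and
  convolutions.\<close>

lemma bracket_shift: "1 + norm x \<le> (1 + norm (x - y)) * (1 + norm y)"
  for x y :: "'a::real_normed_vector"
proof -
  have "norm x \<le> norm (x - y) + norm y" using norm_triangle_ineq[of "x - y" y] by simp
  moreover have "0 \<le> norm (x - y) * norm y" by simp
  ultimately show ?thesis unfolding distrib_left distrib_right by linarith
qed

text \<open>Supplies the hypothesis of Fubini's theorem for the interchanges below, whose
  oscillating factor has modulus one.\<close>

lemma integrable_product_bound: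
  fixes h :: "'a::euclidean_space \<times> 'b::euclidean_space \<Rightarrow> 'c::{banach,second_countable_topology}"
  assumes f: "integrable lborel f" and g: "integrable lborel g"
    and [measurable]: "h \<in> borel_measurable (lborel \<Otimes>\<^sub>M lborel)"
    and le: "\<And>x y. norm (h (x, y)) \<le> norm (f x :: complex) * norm (g y :: complex)"
  shows "integrable (lborel \<Otimes>\<^sub>M lborel) h"
proof -
  have [measurable]: "f \<in> borel_measurable borel" "g \<in> borel_measurable borel" using f g by auto
  have 2: "integrable (lborel \<Otimes>\<^sub>M lborel) (\<lambda>(x, y). f x * g y)"
    by (rule lborel_pair.Fubini_integrable) (auto simp: norm_mult intro!: integrable_mult_left integrable_norm f g)
  show ?thesis
    by (rule Bochner_Integration.integrable_bound[OF 2]) (auto simp: le norm_mult)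
qed

section \<open>Smooth functions and Schwartz functions\<close>

definition wave :: "'a::euclidean_space \<Rightarrow> 'a \<Rightarrow> complex" where
  "wave \<xi> x = cis (2 * pi * (x \<bullet> \<xi>))"

lemma norm_wave [simp]: "norm (wave \<xi> x) = 1"
  by (simp add: wave_def)

lemma wave_sym: "wave \<xi> x = wave x \<xi>"
  by (simp add: wave_def inner_commute)

lemma wave_minus: "wave (- \<xi>) x = wave \<xi> (- x)"
  by (simp add: wave_def)

lemma wave_add: "wave (\<xi> + \<eta>) x = wave \<xi> x * wave \<eta> x"
  by (simp add: wave_def cis_mult inner_add_right distrib_left)

lemma wave_diff: "wave (\<xi> - \<eta>) x = wave \<xi> x * wave (- \<eta>) x"
  using wave_add[of \<xi> "- \<eta>" x] by simp

lemma wave_add_right: "wave \<xi> (x + y) = wave \<xi> x * wave \<xi> y"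
  by (simp add: wave_def cis_mult inner_add_left distrib_left)

lemma wave_diff_right: "wave \<xi> (x - y) = wave \<xi> x * wave \<xi> (- y)"
  using wave_add_right[of \<xi> x "- y"] by simp

lemma wave_scaleR: "wave (c *\<^sub>R \<xi>) x = wave \<xi> (c *\<^sub>R x)"
  by (simp add: wave_def)

lemma wave_zero [simp]: "wave 0 x = 1" "wave \<xi> 0 = 1"
  by (simp_all add: wave_def)

lemma wave_has_derivative:
  "(wave \<xi> has_derivative (\<lambda>h. 2 * pi * \<i> * (h \<bullet> \<xi>) * wave \<xi> x)) (at x)"
proof -
  have 1: "((\<lambda>x. \<i> * of_real (2 * pi * (x \<bullet> \<xi>))) has_derivative (\<lambda>h. \<i> * of_real (2 * pi * (h \<bullet> \<xi>)))) (at x)"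
    by (intro derivative_intros)
  have 2: "(exp has_derivative (*) (exp z)) (at z)" for z :: complex
    using DERIV_exp[of z] by (simp add: has_field_derivative_def)
  have "((\<lambda>x. exp (\<i> * of_real (2 * pi * (x \<bullet> \<xi>)))) has_derivative
      (\<lambda>h. exp (\<i> * of_real (2 * pi * (x \<bullet> \<xi>))) * (\<i> * of_real (2 * pi * (h \<bullet> \<xi>))))) (at x)"
    by (rule has_derivative_compose[OF 1 2])
  then show ?thesis by (simp add: wave_def[abs_def] cis_conv_exp mult_ac)
qed

lemma continuous_on_wave [continuous_intros]:
  "continuous_on A f \<Longrightarrow> continuous_on A g \<Longrightarrow> continuous_on A (\<lambda>x. wave (f x) (g x))"
  unfolding wave_def by (intro continuous_intros)

lemma borel_measurable_wave [measurable]: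
  fixes f g :: "'b \<Rightarrow> 'a::euclidean_space"
  assumes [measurable]: "f \<in> borel_measurable M" "g \<in> borel_measurable M"
  shows "(\<lambda>x. wave (f x) (g x)) \<in> borel_measurable M"
  unfolding wave_def cis.ctr Complex_eq by measurable

text \<open>The chord from 1 to a point of the unit circle is twice the sine of half the angle, and
  the sine is at most its argument.\<close>

lemma norm_wave_minus_one: "norm (wave \<xi> x - 1) \<le> 2 * pi * \<bar>x \<bullet> \<xi>\<bar>"
  using dist_exp_i_1[of "2 * pi * (x \<bullet> \<xi>)"] abs_sin_x_le_abs_x[of "pi * (x \<bullet> \<xi>)"]
  by (simp add: wave_def cis_conv_exp dist_norm abs_mult)

section \<open>Partial derivatives, smoothness and Schwartz functions\<close>

abbreviation partial :: "'a::euclidean_space \<Rightarrow> ('a \<Rightarrow> 'b::real_normed_vector) \<Rightarrow> 'a \<Rightarrow> 'b" where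
  "partial b f \<equiv> (\<lambda>x. frechet_derivative f (at x) b)"

lemma partial_eqI: "(f has_derivative f') (at x) \<Longrightarrow> partial b f x = f' b"
  using frechet_derivative_at by metis

text \<open>Stated along a sequence of steps so that dominated convergence can use it directly. The
  direction 0 is split off because the Frechet quotient divides by the norm of the
  increment.\<close>

lemma difference_quotient_tendsto:
  assumes f: "(f has_derivative f') (at x)" and t: "t \<longlonglongrightarrow> 0" "\<And>n. t n > 0"
  shows "(\<lambda>n. (f (x + t n *\<^sub>R b) - f x) /\<^sub>R t n) \<longlonglongrightarrow> f' b"
proof (cases "b = 0")
  case True
  then show ?thesis using linear_0[OF has_derivative_linear[OF f]] by simp
next
  case False
  have "(\<lambda>n. t n *\<^sub>R b) \<longlonglongrightarrow> 0 *\<^sub>R b" by (intro tendsto_intros t)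
  then have "filterlim (\<lambda>n. t n *\<^sub>R b) (at 0) sequentially"
    using t(2) False by (simp add: filterlim_at less_imp_neq[symmetric])
  moreover have "((\<lambda>h. norm (f (x + h) - f x - f' h) / norm h) \<longlongrightarrow> 0) (at 0)"
    using f by (simp add: has_derivative_at)
  ultimately have "(\<lambda>n. norm (f (x + t n *\<^sub>R b) - f x - f' (t n *\<^sub>R b)) / norm (t n *\<^sub>R b)) \<longlonglongrightarrow> 0"
    by (rule filterlim_compose[rotated])
  then have "(\<lambda>n. norm b * (norm (f (x + t n *\<^sub>R b) - f x - f' (t n *\<^sub>R b)) / norm (t n *\<^sub>R b))) \<longlonglongrightarrow> norm b * 0"
    by (rule tendsto_mult_left)
  moreover have "norm b * (norm (f (x + t n *\<^sub>R b) - f x - f' (t n *\<^sub>R b)) / norm (t n *\<^sub>R b))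
      = norm ((f (x + t n *\<^sub>R b) - f x) /\<^sub>R t n - f' b)" for n
  proof -
    have "(f (x + t n *\<^sub>R b) - f x) /\<^sub>R t n - f' b = (f (x + t n *\<^sub>R b) - f x - f' (t n *\<^sub>R b)) /\<^sub>R t n"
      using t(2)[of n] linear_cmul[OF has_derivative_linear[OF f], of "t n" b] by (simp add: scaleR_diff_right)
    then show ?thesis using t(2)[of n] False by (simp add: divide_inverse mult_ac)
  qed
  ultimately show ?thesis by (simp add: tendsto_norm_zero_iff LIM_zero_iff)
qed

lemma iter_partial_append: "iter_partial (as @ bs) f = iter_partial as (iter_partial bs f)"
  by (induction as) auto

lemma iter_partial_closed:
  assumes "f \<in> A" and "\<And>g b. g \<in> A \<Longrightarrow> b \<in> Basis \<Longrightarrow> partial b g \<in> A" and "bs \<in> lists Basis"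
  shows "iter_partial bs f \<in> A"
  using assms(3) by (induction bs) (auto intro: assms)

text \<open>A family closed under one partial derivative absorbs every list of them. A smoothness
  proof thus reduces to the choice of an invariant family, which has to be rich enough for the terms
  produced by the differentiation rules.\<close>

lemma smooth_coinduct:
  assumes "f \<in> A" and "\<And>g x. g \<in> A \<Longrightarrow> g differentiable (at x)"
    and "\<And>g b. g \<in> A \<Longrightarrow> b \<in> Basis \<Longrightarrow> partial b g \<in> A"
  shows "smooth f"
  using iter_partial_closed[of f A] assms unfolding smooth_def by blast

lemma smooth_differentiable: "smooth f \<Longrightarrow> f differentiable (at x)"
  unfolding smooth_def by (metis iter_partial.simps(1) lists.Nil)

lemma smooth_partial: "smooth f \<Longrightarrow> b \<in> Basis \<Longrightarrow> smooth (partial b f)"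
  unfolding smooth_def
proof (intro ballI allI)
  fix bs :: "'a list" and x assume f: "\<forall>bs\<in>lists Basis. \<forall>x. iter_partial bs f differentiable at x"
    and b: "b \<in> Basis" and bs: "bs \<in> lists Basis"
  \<comment> \<open>The head of the list is the outermost derivative, so a derivative taken first is
    appended at the end.\<close>
  have "iter_partial (bs @ [b]) f differentiable at x" using f b bs by auto
  then show "iter_partial bs (partial b f) differentiable at x"
    by (simp add: iter_partial_append)
qed

lemma smooth_has_derivative:
  "smooth f \<Longrightarrow> (f has_derivative frechet_derivative f (at x)) (at x)"
  using smooth_differentiable frechet_derivative_works by blast

lemma smooth_continuous_on: "smooth f \<Longrightarrow> continuous_on S f"
  by (meson continuous_at_imp_continuous_on differentiable_imp_continuous_within smooth_differentiable)

lemma smooth_of_real: "smooth f \<Longrightarrow> smooth (\<lambda>x. complex_of_real (f x))"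
proof (rule smooth_coinduct[where A="{\<lambda>x. of_real (g x) |g. smooth g}"])
  have d: "((\<lambda>x. complex_of_real (g x)) has_derivative (\<lambda>h. of_real (frechet_derivative g (at x) h))) (at x)"
    if "smooth g" for g :: "'a \<Rightarrow> real" and x
    by (intro has_derivative_of_real smooth_has_derivative that)
  fix g x assume "g \<in> {\<lambda>x::'a. complex_of_real (g x) |g. smooth g}"
  then show "g differentiable at x" using d differentiableI by blast
next
  fix g and b :: 'a assume "g \<in> {\<lambda>x::'a. complex_of_real (g x) |g. smooth g}" and b: "b \<in> Basis"
  then obtain g' where g: "g = (\<lambda>x. of_real (g' x))" "smooth g'" by blast
  have "partial b g = (\<lambda>x. of_real (partial b g' x))"
    unfolding g by (intro ext partial_eqI has_derivative_of_real smooth_has_derivative g)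
  then show "partial b g \<in> {\<lambda>x::'a. complex_of_real (g x) |g. smooth g}"
    using smooth_partial[OF g(2) b] by (intro CollectI exI[of _ "partial b g'"] conjI)
qed blast

text \<open>The family carries a scalar prefactor to absorb the factor \<open>c\<close> that the
  chain rule produces at each differentiation.\<close>

lemma smooth_scaleR:
  fixes f :: "'a::euclidean_space \<Rightarrow> 'b::real_normed_vector"
  assumes "smooth f"
  shows "smooth (\<lambda>x. f (c *\<^sub>R x))"
proof (rule smooth_coinduct[where A="{\<lambda>x. a *\<^sub>R g (c *\<^sub>R x) |a g. smooth g}"])
  have d: "((\<lambda>x. a *\<^sub>R g (c *\<^sub>R x)) has_derivative (\<lambda>h. a *\<^sub>R frechet_derivative g (at (c *\<^sub>R x)) (c *\<^sub>R h))) (at x)"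
    if "smooth g" for a and g :: "'a \<Rightarrow> 'b" and x
    using has_derivative_compose[OF has_derivative_scaleR_right[OF has_derivative_ident] smooth_has_derivative[OF that]]
    by (rule has_derivative_scaleR_right)
  fix g x assume "g \<in> {\<lambda>x. a *\<^sub>R g (c *\<^sub>R x) |a g. smooth (g :: 'a \<Rightarrow> 'b)}"
  then show "g differentiable at x" using d differentiableI by blast
next
  fix g and b :: 'a assume "g \<in> {\<lambda>x. a *\<^sub>R g (c *\<^sub>R x) |a g. smooth (g :: 'a \<Rightarrow> 'b)}" and b: "b \<in> Basis"
  then obtain a g' where g: "g = (\<lambda>x. a *\<^sub>R g' (c *\<^sub>R x))" "smooth g'" by blast
  have "partial b g = (\<lambda>x. (a * c) *\<^sub>R partial b g' (c *\<^sub>R x))"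
  proof
    fix x
    have "partial b g x = a *\<^sub>R frechet_derivative g' (at (c *\<^sub>R x)) (c *\<^sub>R b)"
      unfolding g
      using has_derivative_compose[OF has_derivative_scaleR_right[OF has_derivative_ident] smooth_has_derivative[OF g(2)]]
      by (intro partial_eqI has_derivative_scaleR_right)
    then show "partial b g x = (a * c) *\<^sub>R partial b g' (c *\<^sub>R x)"
      using linear_cmul[OF linear_frechet_derivative[OF smooth_differentiable[OF g(2)]]] by simp
  qed
  then show "partial b g \<in> {\<lambda>x. a *\<^sub>R g (c *\<^sub>R x) |a g. smooth (g :: 'a \<Rightarrow> 'b)}"
    using smooth_partial[OF g(2) b] by (intro CollectI exI[of _ "a * c"] exI[of _ "partial b g'"] conjI) auto
next
  show "(\<lambda>x. f (c *\<^sub>R x)) \<in> {\<lambda>x. a *\<^sub>R g (c *\<^sub>R x) |a g. smooth g}"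
    using assms by (intro CollectI exI[of _ 1] exI[of _ f]) auto
qed

text \<open>Unlike the set of products of smooth functions, its closure under sums is invariant under differentiation.\<close>

inductive_set product_sums :: "('a::euclidean_space \<Rightarrow> complex) set" where
  product: "smooth f \<Longrightarrow> smooth g \<Longrightarrow> (\<lambda>x. f x * g x) \<in> product_sums"
| sum: "f \<in> product_sums \<Longrightarrow> g \<in> product_sums \<Longrightarrow> (\<lambda>x. f x + g x) \<in> product_sums"

lemma product_sums_differentiable: "f \<in> product_sums \<Longrightarrow> f differentiable (at x)"
  by (induction rule: product_sums.induct) (auto intro: derivative_intros smooth_differentiable)

lemma product_sums_partial:
  "f \<in> product_sums \<Longrightarrow> b \<in> Basis \<Longrightarrow> partial b f \<in> product_sums"
proof (induction rule: product_sums.induct)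
  case (product f g)
  have "partial b (\<lambda>x. f x * g x) = (\<lambda>x. f x * partial b g x + partial b f x * g x)"
    by (intro ext partial_eqI has_derivative_mult smooth_has_derivative product)
  then show ?case
    using product by (simp add: product_sums.product product_sums.sum smooth_partial)
next
  case (sum f g)
  have "partial b (\<lambda>x. f x + g x) = (\<lambda>x. partial b f x + partial b g x)"
    using sum product_sums_differentiable frechet_derivative_works
    by (intro ext partial_eqI has_derivative_add) blast+
  then show ?case using sum by (simp add: product_sums.sum)
qed

lemma smooth_mult: "smooth f \<Longrightarrow> smooth g \<Longrightarrow> smooth (\<lambda>x. f x * g x :: complex)"
  by (rule smooth_coinduct[where A=product_sums])
    (auto intro: product_sums.product product_sums_differentiable product_sums_partial)

text \<open>Decay is asked of the members only; it reaches their derivatives because these are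
  members too.\<close>

lemma schwartz_coinduct:
  assumes "f \<in> A" and "\<And>g x. g \<in> A \<Longrightarrow> g differentiable (at x)"
    and "\<And>g b. g \<in> A \<Longrightarrow> b \<in> Basis \<Longrightarrow> partial b g \<in> A"
    and bounded: "\<And>g n. g \<in> A \<Longrightarrow> \<exists>C. \<forall>x. (1 + norm x) ^ n * norm (g x) \<le> C"
  shows "f \<in> schwartz"
proof -
  have "bounded (range (\<lambda>x. (1 + norm x) ^ n *\<^sub>R iter_partial bs f x))" if "bs \<in> lists Basis" for bs n
    using bounded[OF iter_partial_closed[OF assms(1) assms(3) that], of n]
    by (auto simp: bounded_iff abs_of_nonneg)
  then show ?thesis using smooth_coinduct[OF assms(1-3)] by (simp add: schwartz_def)
qed

lemma schwartz_smooth: "f \<in> schwartz \<Longrightarrow> smooth f"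
  by (simp add: schwartz_def)

lemma schwartz_iter_partial_bounded:
  assumes "f \<in> schwartz" and "bs \<in> lists Basis"
  shows "\<exists>C. \<forall>x. (1 + norm x) ^ n * norm (iter_partial bs f x) \<le> C"
proof -
  have "bounded (range (\<lambda>x. (1 + norm x) ^ n *\<^sub>R iter_partial bs f x))"
    using assms unfolding schwartz_def by blast
  then show ?thesis by (simp add: bounded_iff abs_of_nonneg)
qed

lemma schwartz_bounded: "f \<in> schwartz \<Longrightarrow> \<exists>C. \<forall>x. (1 + norm x) ^ n * norm (f x) \<le> C"
  using schwartz_iter_partial_bounded[of f "[]"] by simp

lemma schwartz_partial: "f \<in> schwartz \<Longrightarrow> b \<in> Basis \<Longrightarrow> partial b f \<in> schwartz"
proof (rule schwartz_coinduct[where A="{iter_partial bs f |bs. bs \<in> lists Basis}"])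
  assume f: "f \<in> schwartz" and b: "b \<in> Basis"
  show "partial b f \<in> {iter_partial bs f |bs. bs \<in> lists Basis}"
    using b by (intro CollectI exI[of _ "[b]"]) auto
  fix g assume "g \<in> {iter_partial bs f |bs. bs \<in> lists Basis}"
  then obtain bs where g: "g = iter_partial bs f" "bs \<in> lists Basis" by blast
  show "g differentiable at x" for x
    using f g by (auto simp: schwartz_def smooth_def)
  show "\<exists>C. \<forall>x. (1 + norm x) ^ n * norm (g x) \<le> C" for n
    using f g schwartz_iter_partial_bounded by blast
  show "partial b g \<in> {iter_partial bs f |bs. bs \<in> lists Basis}" if "b \<in> Basis" for b
    using that g by (intro CollectI exI[of _ "b # bs"]) auto
qed

lemma schwartz_add: "f \<in> schwartz \<Longrightarrow> g \<in> schwartz \<Longrightarrow> (\<lambda>x. f x + g x) \<in> schwartz"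
proof (rule schwartz_coinduct[where A="{\<lambda>x. f x + g x |f g. f \<in> schwartz \<and> g \<in> schwartz}"])
  fix h assume "h \<in> {\<lambda>x::'a. f x + g x |f g. f \<in> schwartz \<and> g \<in> schwartz}"
  then obtain f g where h: "h = (\<lambda>x. f x + g x)" "f \<in> schwartz" "g \<in> schwartz" by blast
  show "h differentiable at x" for x
    unfolding h by (intro derivative_intros smooth_differentiable schwartz_smooth h)
  have "partial b h = (\<lambda>x. partial b f x + partial b g x)" for b
    unfolding h by (intro ext partial_eqI has_derivative_add smooth_has_derivative schwartz_smooth h)
  then show "partial b h \<in> {\<lambda>x. f x + g x |f g. f \<in> schwartz \<and> g \<in> schwartz}" if "b \<in> Basis" for b
    using schwartz_partial[OF h(2) that] schwartz_partial[OF h(3) that]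
    by (intro CollectI exI[of _ "partial b f"] exI[of _ "partial b g"] conjI)
  show "\<exists>C. \<forall>x. (1 + norm x) ^ n * norm (h x) \<le> C" for n
  proof -
    obtain C where C: "\<forall>x. (1 + norm x) ^ n * norm (f x) \<le> C" using schwartz_bounded[OF h(2)] by blast
    obtain D where D: "\<forall>x. (1 + norm x) ^ n * norm (g x) \<le> D" using schwartz_bounded[OF h(3)] by blast
    have "(1 + norm x) ^ n * norm (h x) \<le> C + D" for x
    proof -
      have "(1 + norm x) ^ n * norm (h x) \<le> (1 + norm x) ^ n * (norm (f x) + norm (g x))"
        unfolding h by (intro mult_left_mono norm_triangle_ineq) auto
      then show ?thesis using C[rule_format, of x] D[rule_format, of x] by (simp add: distrib_left)
    qed
    then show ?thesis by blast
  qed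
qed blast

lemma schwartz_cmult: "f \<in> schwartz \<Longrightarrow> (\<lambda>x. c * f x) \<in> schwartz"
proof (rule schwartz_coinduct[where A="{\<lambda>x. c * f x |f. f \<in> schwartz}"])
  fix h assume "h \<in> {\<lambda>x::'a. c * f x |f. f \<in> schwartz}"
  then obtain f where h: "h = (\<lambda>x. c * f x)" "f \<in> schwartz" by blast
  show "h differentiable at x" for x
    unfolding h by (intro derivative_intros smooth_differentiable schwartz_smooth h)
  have "partial b h = (\<lambda>x. c * partial b f x)" for b
    unfolding h by (intro ext partial_eqI has_derivative_mult_right smooth_has_derivative schwartz_smooth h)
  then show "partial b h \<in> {\<lambda>x. c * f x |f. f \<in> schwartz}" if "b \<in> Basis" for b
    using schwartz_partial[OF h(2) that] by (intro CollectI exI[of _ "partial b f"] conjI)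
  show "\<exists>C. \<forall>x. (1 + norm x) ^ n * norm (h x) \<le> C" for n
  proof -
    obtain C where "\<forall>x. (1 + norm x) ^ n * norm (f x) \<le> C"
      using schwartz_bounded[OF h(2)] by blast
    then have "(1 + norm x) ^ n * norm (h x) \<le> norm c * C" for x
      unfolding h by (simp add: norm_mult mult.left_commute mult_left_mono)
    then show ?thesis by blast
  qed
qed blast

lemma schwartz_zero: "(\<lambda>x. 0) \<in> schwartz"
  by (rule schwartz_coinduct[where A="{\<lambda>x. 0}"])
    (auto simp: frechet_derivative_const)

lemma schwartz_sum:
  "(\<And>i. i \<in> I \<Longrightarrow> f i \<in> schwartz) \<Longrightarrow> (\<lambda>x. \<Sum>i\<in>I. f i x) \<in> schwartz"
  by (induction I rule: infinite_finite_induct) (auto intro: schwartz_add schwartz_zero)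

text \<open>The modulation and the translation stay fixed while the Schwartz function varies over
  the family: the derivative that falls on the character only adds a multiple of the function
  itself, so the result is again one modulated translate.\<close>

lemma schwartz_modulate_translate:
  assumes "f \<in> schwartz"
  shows "(\<lambda>x. wave \<xi> x * f (x - y)) \<in> schwartz"
proof (rule schwartz_coinduct[where A="{\<lambda>x. wave \<xi> x * f (x - y) |f. f \<in> schwartz}"])
  fix h assume "h \<in> {\<lambda>x. wave \<xi> x * f (x - y) |f. f \<in> schwartz}"
  then obtain f where h: "h = (\<lambda>x. wave \<xi> x * f (x - y))" "f \<in> schwartz" by blast
  have d: "(h has_derivative (\<lambda>h. wave \<xi> x * frechet_derivative f (at (x - y)) h
      + 2 * pi * \<i> * (h \<bullet> \<xi>) * wave \<xi> x * f (x - y))) (at x)" for x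
    unfolding h
  proof (rule has_derivative_mult[OF wave_has_derivative])
    have "((\<lambda>x. x - y) has_derivative (\<lambda>h. h)) (at x)" by (auto intro!: derivative_eq_intros)
    from has_derivative_compose[OF this smooth_has_derivative[OF schwartz_smooth[OF h(2)]]]
    show "((\<lambda>x. f (x - y)) has_derivative frechet_derivative f (at (x - y))) (at x)" .
  qed
  show "h differentiable at x" for x using d differentiableI by blast
  show "partial b h \<in> {\<lambda>x. wave \<xi> x * f (x - y) |f. f \<in> schwartz}" if "b \<in> Basis" for b
  proof -
    have "partial b h = (\<lambda>x. wave \<xi> x * (partial b f (x - y) + (2 * pi * \<i> * (b \<bullet> \<xi>)) * f (x - y)))"
      by (rule ext) (simp add: partial_eqI[OF d] algebra_simps)
    moreover have "(\<lambda>x. partial b f x + (2 * pi * \<i> * (b \<bullet> \<xi>)) * f x) \<in> schwartz"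
      by (intro schwartz_add schwartz_partial schwartz_cmult h that)
    ultimately show ?thesis
      by (intro CollectI exI[of _ "\<lambda>x. partial b f x + (2 * pi * \<i> * (b \<bullet> \<xi>)) * f x"]) auto
  qed
  show "\<exists>C. \<forall>x. (1 + norm x) ^ n * norm (h x) \<le> C" for n
  proof -
    obtain C where C: "\<forall>x. (1 + norm x) ^ n * norm (f x) \<le> C"
      using schwartz_bounded[OF h(2)] by blast
    have "(1 + norm x) ^ n * norm (h x) \<le> (1 + norm y) ^ n * C" for x
    proof -
      have "(1 + norm x) ^ n * norm (h x) \<le> ((1 + norm (x - y)) * (1 + norm y)) ^ n * norm (f (x - y))"
        unfolding h norm_mult norm_wave mult_1 by (intro mult_right_mono power_mono bracket_shift) auto
      also have "\<dots> = (1 + norm y) ^ n * ((1 + norm (x - y)) ^ n * norm (f (x - y)))"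
        by (simp add: power_mult_distrib)
      also have "\<dots> \<le> (1 + norm y) ^ n * C" using C by (intro mult_left_mono) auto
      finally show ?thesis .
    qed
    then show ?thesis by blast
  qed
qed (use assms in blast)

lemma schwartz_decay:
  assumes "f \<in> schwartz"
  obtains C where "C > 0" "\<And>x. norm (f x) \<le> C / (1 + norm x) ^ n"
proof -
  obtain C where C: "\<forall>x. (1 + norm x) ^ n * norm (f x) \<le> C" using schwartz_bounded[OF assms] by blast
  have "norm (f x) \<le> max C 1 / (1 + norm x) ^ n" for x
  proof -
    have "(1 + norm x) ^ n > 0" using norm_ge_zero[of x] by (intro zero_less_power) linarith
    moreover have "norm (f x) * (1 + norm x) ^ n \<le> max C 1"
      using C[rule_format, of x] by (simp add: mult.commute le_max_iff_disj)
    ultimately show ?thesis by (simp add: pos_le_divide_eq)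
  qed
  then show ?thesis using that[of "max C 1"] by auto
qed

lemma schwartz_measurable: "f \<in> schwartz \<Longrightarrow> f \<in> borel_measurable borel"
  using schwartz_smooth smooth_continuous_on borel_measurable_continuous_onI by blast

lemma integrable_schwartz_weighted:
  assumes "f \<in> schwartz"
  shows "integrable lborel (\<lambda>x. (1 + norm x) ^ n *\<^sub>R f x)"
proof -
  obtain C where C: "C > 0" "\<And>x. norm (f x) \<le> C / (1 + norm x) ^ (n + 2 * DIM('a))"
    using schwartz_decay[OF assms] by blast
  have [measurable]: "f \<in> borel_measurable borel" using assms by (rule schwartz_measurable)
  show ?thesis
  proof (rule Bochner_Integration.integrable_bound)
    show "integrable lborel (\<lambda>x::'a. C * (1 / (1 + norm x) ^ (2 * DIM('a))))"
      by (intro integrable_mult_right integrable_bracket_nat) auto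
    have "(1 + norm x) ^ n * norm (f x) \<le> C / (1 + norm x) ^ (2 * DIM('a))" for x
    proof -
      have "(1 + norm x) ^ n * norm (f x) \<le> (1 + norm x) ^ n * (C / (1 + norm x) ^ (n + 2 * DIM('a)))"
        by (intro mult_left_mono C) auto
      also have "\<dots> = C / (1 + norm x) ^ (2 * DIM('a))"
        using norm_ge_zero[of x] by (simp add: power_add)
      finally show ?thesis .
    qed
    then show "AE x in lborel. norm ((1 + norm x) ^ n *\<^sub>R f x) \<le> norm (C * (1 / (1 + norm x) ^ (2 * DIM('a))))"
      using C(1) by (intro AE_I2) (simp add: abs_of_pos)
  qed measurable
qed

lemma integrable_schwartz: "f \<in> schwartz \<Longrightarrow> integrable lborel f"
  using integrable_schwartz_weighted[of f 0] by simp

section \<open>The Fourier transform\<close>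

lemma fourier_wave: "fourier f \<xi> = (LINT x|lborel. f x * wave (- \<xi>) x)"
  by (simp add: fourier_def wave_def)

lemma inv_fourier_wave: "inv_fourier g x = (LINT \<xi>|lborel. g \<xi> * wave x \<xi>)"
  by (simp add: inv_fourier_def wave_def inner_commute)

lemma fourier_eq_inv_fourier: "fourier f \<xi> = inv_fourier f (- \<xi>)"
  by (simp add: fourier_wave inv_fourier_wave)

lemma integrable_mult_wave:
  assumes f: "integrable lborel f"
  shows "integrable lborel (\<lambda>x. f x * wave \<xi> x)"
proof -
  have [measurable]: "f \<in> borel_measurable borel" using f by auto
  show ?thesis
    by (rule Bochner_Integration.integrable_bound[OF f]) (auto simp: norm_mult)
qed

lemma norm_inv_fourier_le: "norm (inv_fourier g x) \<le> (LINT \<xi>|lborel. norm (g \<xi>))"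
  unfolding inv_fourier_wave
  using integral_norm_bound[of lborel "\<lambda>\<xi>. g \<xi> * wave x \<xi>"] by (simp add: norm_mult)

lemma continuous_on_inv_fourier:
  assumes f: "integrable lborel f"
  shows "continuous_on S (inv_fourier f)"
proof -
  have [measurable]: "f \<in> borel_measurable borel" using f by auto
  have "isCont (inv_fourier f) a" for a
  proof (unfold continuous_at_sequentially comp_def, intro allI impI)
    fix X assume X: "X \<longlonglongrightarrow> a"
    show "(\<lambda>n. inv_fourier f (X n)) \<longlonglongrightarrow> inv_fourier f a"
      unfolding inv_fourier_wave
    proof (rule integral_dominated_convergence[where w="\<lambda>x. norm (f x)"])
      show "AE x in lborel. (\<lambda>n. f x * wave (X n) x) \<longlonglongrightarrow> f x * wave a x"
      proof (intro AE_I2 tendsto_mult_left)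
        fix x
        have "isCont (\<lambda>\<xi>. wave \<xi> x) a"
          by (rule continuous_on_interior[of UNIV]) (auto intro!: continuous_intros)
        then show "(\<lambda>n. wave (X n) x) \<longlonglongrightarrow> wave a x" using X by (rule isCont_tendsto_compose)
      qed
    qed (use f in \<open>auto simp: norm_mult\<close>)
  qed
  then show ?thesis by (simp add: continuous_at_imp_continuous_on)
qed

lemma continuous_on_fourier:
  assumes "integrable lborel f"
  shows "continuous_on S (fourier f)"
proof -
  have "continuous_on S (inv_fourier f \<circ> uminus)"
    by (intro continuous_on_compose continuous_on_inv_fourier assms continuous_intros)
  then show ?thesis by (simp add: fourier_eq_inv_fourier[abs_def] comp_def)
qed

lemma borel_measurable_inv_fourier:
  "integrable lborel f \<Longrightarrow> inv_fourier f \<in> borel_measurable borel"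
  by (intro borel_measurable_continuous_onI continuous_on_inv_fourier)

lemma borel_measurable_fourier:
  "integrable lborel f \<Longrightarrow> fourier f \<in> borel_measurable borel"
  by (intro borel_measurable_continuous_onI continuous_on_fourier)

lemma inv_fourier_sum:
  assumes "\<And>i. i \<in> I \<Longrightarrow> integrable lborel (f i)"
  shows "inv_fourier (\<lambda>x. \<Sum>i\<in>I. f i x) \<xi> = (\<Sum>i\<in>I. inv_fourier (f i) \<xi>)"
  using assms by (simp add: inv_fourier_wave sum_distrib_right integrable_mult_wave)

lemma fourier_sum:
  assumes "\<And>i. i \<in> I \<Longrightarrow> integrable lborel (f i)"
  shows "fourier (\<lambda>x. \<Sum>i\<in>I. f i x) \<xi> = (\<Sum>i\<in>I. fourier (f i) \<xi>)"
  using assms by (simp add: fourier_eq_inv_fourier inv_fourier_sum)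

lemma inv_fourier_cmult: "inv_fourier (\<lambda>x. c * f x) \<xi> = c * inv_fourier f \<xi>"
  by (simp add: inv_fourier_wave mult.assoc)

lemma inv_fourier_modulate: "inv_fourier (\<lambda>\<xi>. wave (- z) \<xi> * g \<xi>) x = inv_fourier g (x - z)"
  by (simp add: inv_fourier_wave wave_diff mult_ac)

lemma fourier_modulate_translate:
  assumes f: "integrable lborel f"
  shows "fourier (\<lambda>x. wave \<eta> x * f (x - y)) \<xi> = wave (\<eta> - \<xi>) y * fourier f (\<xi> - \<eta>)"
proof -
  have [measurable]: "f \<in> borel_measurable borel" using f by auto
  have "fourier (\<lambda>x. wave \<eta> x * f (x - y)) \<xi> = (LINT x|lborel. wave \<eta> (y + x) * f x * wave (- \<xi>) (y + x))"
    unfolding fourier_wave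
    by (subst lborel_integral_translate[where t=y, symmetric]) auto
  also have "\<dots> = (LINT x|lborel. wave (\<eta> - \<xi>) y * (f x * wave (- (\<xi> - \<eta>)) x))"
    by (intro Bochner_Integration.integral_cong refl)
      (simp add: wave_diff wave_add_right mult_ac)
  finally show ?thesis by (simp add: fourier_wave)
qed

lemma fourier_dilate:
  assumes f: "integrable lborel f"
  shows "fourier (dilate f k) \<xi> = fourier f ((2 powi (- k)) *\<^sub>R \<xi>)"
proof -
  have [measurable]: "f \<in> borel_measurable borel" using f by auto
  define c :: real where "c = 2 powi k"
  have c: "c > 0" "2 powi (- k) = 1 / c" "(2::real) powi (k * int DIM('a)) = c ^ DIM('a)"
    by (auto simp: c_def power_int_minus divide_simps power_int_mult)
  have "fourier f ((1 / c) *\<^sub>R \<xi>) = c ^ DIM('a) *\<^sub>R (LINT x|lborel. f (c *\<^sub>R x) * wave (- (1 / c) *\<^sub>R \<xi>) (c *\<^sub>R x))"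
    unfolding fourier_wave using c
    by (subst lborel_integral_affine[where c=c and t=0]) auto
  also have "\<dots> = fourier (dilate f k) \<xi>"
    unfolding fourier_wave dilate_def c c_def[symmetric]
    using c(1) by (simp add: wave_def scaleR_conv_of_real mult.assoc flip: of_real_power)
  finally show ?thesis by (simp add: c)
qed

lemma integrable_dilate:
  assumes f: "integrable lborel f"
  shows "integrable lborel (dilate f k)"
  unfolding dilate_def
  using lborel_integrable_affine[of "2 powi k" f 0] f by simp

text \<open>The convolution theorem with the second function given on the frequency side. This form
  fits \<open>multiplier m f\<close>, which is defined as an inverse transform and is not known to
  be integrable.\<close>

lemma convol_inv_fourier:
  assumes a: "integrable lborel a" and F: "integrable lborel F"
  shows "convol a (inv_fourier F) x = inv_fourier (\<lambda>\<xi>. fourier a \<xi> * F \<xi>) x"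
proof -
  have [measurable]: "a \<in> borel_measurable borel" "F \<in> borel_measurable borel" using a F by auto
  have [measurable]: "inv_fourier F \<in> borel_measurable borel" using F by (rule borel_measurable_inv_fourier)
  have int: "integrable (lborel \<Otimes>\<^sub>M lborel) (\<lambda>(y, \<xi>). a y * F \<xi> * wave (x - y) \<xi>)"
    by (rule integrable_product_bound[OF a F]) (auto simp: norm_mult)
  have "convol a (inv_fourier F) x = (LINT y|lborel. a (x - y) * inv_fourier F y)"
    by (simp add: convol_def)
  also have "\<dots> = (LINT y|lborel. a y * inv_fourier F (x - y))"
    by (subst lborel_integral_affine[where c="-1" and t=x]) auto
  also have "\<dots> = (LINT y|lborel. LINT \<xi>|lborel. a y * F \<xi> * wave (x - y) \<xi>)"
    by (simp add: inv_fourier_wave mult.assoc)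
  also have "\<dots> = (LINT \<xi>|lborel. LINT y|lborel. a y * F \<xi> * wave (x - y) \<xi>)"
    using lborel_pair.Fubini_integral[OF int] by simp
  also have "\<dots> = (LINT \<xi>|lborel. (LINT y|lborel. a y * wave (- \<xi>) y) * (F \<xi> * wave x \<xi>))"
  proof (intro Bochner_Integration.integral_cong refl)
    fix \<xi>
    have "a y * F \<xi> * wave (x - y) \<xi> = (a y * wave (- \<xi>) y) * (F \<xi> * wave x \<xi>)" for y
      by (simp add: wave_diff wave_minus[of \<xi>] wave_sym[of "-y"])
    then show "(LINT y|lborel. a y * F \<xi> * wave (x - y) \<xi>) = (LINT y|lborel. a y * wave (- \<xi>) y) * (F \<xi> * wave x \<xi>)"
      by (simp only: integral_mult_left_zero)
  qed
  finally show ?thesis by (simp add: inv_fourier_wave fourier_wave mult.assoc)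
qed

section \<open>The Gaussian and Fourier inversion\<close>

definition gauss :: "'a::euclidean_space \<Rightarrow> real" where
  "gauss x = (\<Prod>b\<in>Basis. std_normal_density (x \<bullet> b))"

lemma gauss_nonneg: "0 \<le> gauss x"
  by (simp add: gauss_def prod_nonneg)

lemma gauss_le: "gauss x \<le> gauss (0::'a)" for x :: "'a::euclidean_space"
  unfolding gauss_def by (intro prod_mono) (auto simp: std_normal_density_def divide_right_mono)

lemma gauss_pos: "0 < gauss x"
  unfolding gauss_def by (intro prod_pos) (auto simp: std_normal_density_def)

lemma continuous_on_gauss: "continuous_on S gauss"
  unfolding gauss_def[abs_def] std_normal_density_def by (intro continuous_intros) auto

lemma borel_measurable_gauss [measurable]: "gauss \<in> borel_measurable borel"
  by (intro borel_measurable_continuous_onI continuous_on_gauss)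

lemma integrable_gauss: "integrable lborel gauss"
  and integral_gauss: "(LINT x|lborel. gauss x) = 1"
  using integral_lborel_prod[of "\<lambda>_. std_normal_density"]
  by (simp_all add: gauss_def[abs_def] integrable_normal_density)

text \<open>The product structure reduces the transform to the characteristic function of the
  standard normal distribution in each coordinate. The result
  \<open>exp (- (2 * pi * (y \<bullet> b))^2 / 2)\<close> is the density at
  \<open>2 * pi * (y \<bullet> b)\<close> divided by the density at 0, whence the scaling and the
  denominator.\<close>

lemma inv_fourier_gauss:
  "inv_fourier (\<lambda>x. of_real (gauss x)) y = of_real (gauss ((2 * pi) *\<^sub>R y) / gauss (0::'a))" for y :: "'a::euclidean_space"
proof -
  have 1: "(LINT x|lborel. std_normal_density x * cis (t * x)) = complex_of_real (exp (- t\<^sup>2 / 2))" for t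
    using fun_cong[OF char_std_normal_distribution, of t]
    by (simp add: char_def integral_density cis_conv_exp scaleR_conv_of_real)
  have "of_real (gauss x) * wave y x = (\<Prod>b\<in>Basis. std_normal_density (x \<bullet> b) * cis (2 * pi * (y \<bullet> b) * (x \<bullet> b)))" for x
  proof -
    have "wave y x = (\<Prod>b\<in>Basis. cis (2 * pi * (y \<bullet> b) * (x \<bullet> b)))"
      unfolding wave_def euclidean_inner[of x y] cis_conv_exp
      by (subst exp_sum[symmetric]) (simp_all add: sum_distrib_left mult_ac)
    then show ?thesis by (simp add: gauss_def prod.distrib)
  qed
  then have "inv_fourier (\<lambda>x. of_real (gauss x)) y
      = (LINT x|lborel. (\<Prod>b\<in>Basis. of_real (std_normal_density (x \<bullet> b)) * cis (2 * pi * (y \<bullet> b) * (x \<bullet> b))))"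
    by (simp add: inv_fourier_wave)
  also have "\<dots> = (\<Prod>b\<in>Basis. LINT x|lborel. std_normal_density x * cis (2 * pi * (y \<bullet> b) * x))"
  proof (rule integral_lborel_prod)
    fix b
    show "integrable lborel (\<lambda>x. complex_of_real (std_normal_density x) * cis (2 * pi * (y \<bullet> b) * x))"
      using integrable_mult_wave[of "\<lambda>x. complex_of_real (std_normal_density x)" "y \<bullet> b"] integrable_normal_density
      by (simp add: wave_def mult_ac)
  qed
  also have "\<dots> = (\<Prod>b\<in>Basis. complex_of_real (exp (- (2 * pi * (y \<bullet> b))\<^sup>2 / 2)))"
    by (simp add: 1)
  also have "\<dots> = of_real (gauss ((2 * pi) *\<^sub>R y) / gauss (0::'a))"
    by (simp add: gauss_def std_normal_density_def prod_dividef mult.assoc power_one_over flip: of_real_prod)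
  finally show ?thesis .
qed

text \<open>Pairing \<^term>\<open>fourier f\<close> with a wide Gaussian amounts to averaging \<open>f\<close> against a narrow one.\<close>

theorem fourier_inversion:
  assumes f: "integrable lborel f" and cont: "continuous_on UNIV f" and bnd: "\<And>x. norm (f x) \<le> B"
    and Ff: "integrable lborel (fourier f)"
  shows "inv_fourier (fourier f) x = (f x :: complex)"
proof -
  have [measurable]: "f \<in> borel_measurable borel" "fourier f \<in> borel_measurable borel" using f Ff by auto
  have ig: "integrable lborel (\<lambda>\<xi>. complex_of_real (gauss (a *\<^sub>R \<xi> :: 'a)))" if "a \<noteq> 0" for a
    using lborel_integrable_affine[OF that integrable_gauss, of 0] by (intro integrable_of_real) simp
  have eq: "(LINT \<xi>|lborel. fourier f \<xi> * wave x \<xi> * gauss (a *\<^sub>R \<xi>))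
      = (LINT z|lborel. f (x - (a / (2 * pi)) *\<^sub>R z) * gauss z) / of_real ((2 * pi) ^ DIM('a) * gauss (0::'a))"
    if a: "a > 0" for a
  proof -
    have int: "integrable (lborel \<Otimes>\<^sub>M lborel) (\<lambda>(\<xi>, y). f y * gauss (a *\<^sub>R \<xi>) * wave (x - y) \<xi>)"
      by (rule integrable_product_bound[OF ig[of a] f]) (use a in \<open>auto simp: norm_mult\<close>)
    have "(LINT \<xi>|lborel. fourier f \<xi> * wave x \<xi> * gauss (a *\<^sub>R \<xi>))
        = (LINT \<xi>|lborel. LINT y|lborel. f y * gauss (a *\<^sub>R \<xi>) * wave (x - y) \<xi>)"
    proof (intro Bochner_Integration.integral_cong refl)
      fix \<xi>
      have "f y * gauss (a *\<^sub>R \<xi>) * wave (x - y) \<xi> = (f y * wave (- \<xi>) y) * (wave x \<xi> * gauss (a *\<^sub>R \<xi>))" for y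
        by (simp add: wave_diff wave_minus[of \<xi>] wave_sym[of "-y"])
      then show "fourier f \<xi> * wave x \<xi> * gauss (a *\<^sub>R \<xi>) = (LINT y|lborel. f y * gauss (a *\<^sub>R \<xi>) * wave (x - y) \<xi>)"
        by (simp only: integral_mult_left_zero) (simp add: fourier_wave)
    qed
    also have "\<dots> = (LINT y|lborel. LINT \<xi>|lborel. f y * gauss (a *\<^sub>R \<xi>) * wave (x - y) \<xi>)"
      using lborel_pair.Fubini_integral[OF int] by simp
    also have "\<dots> = (LINT y|lborel. f y * (gauss ((2 * pi / a) *\<^sub>R (x - y)) / (a ^ DIM('a) * gauss (0::'a))))"
    proof (intro Bochner_Integration.integral_cong refl)
      fix y
      have "inv_fourier (\<lambda>\<xi>. of_real (gauss \<xi>)) ((1 / a) *\<^sub>R (x - y))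
          = a ^ DIM('a) *\<^sub>R (LINT \<xi>|lborel. gauss (a *\<^sub>R \<xi>) * wave ((1 / a) *\<^sub>R (x - y)) (a *\<^sub>R \<xi>))"
        unfolding inv_fourier_wave using a
        by (subst lborel_integral_affine[where c=a and t=0]) auto
      also have "\<dots> = a ^ DIM('a) * (LINT \<xi>|lborel. gauss (a *\<^sub>R \<xi>) * wave (x - y) \<xi>)"
        using a by (simp add: wave_scaleR scaleR_conv_of_real)
      finally have "(LINT \<xi>|lborel. gauss (a *\<^sub>R \<xi>) * wave (x - y) \<xi>)
          = gauss ((2 * pi / a) *\<^sub>R (x - y)) / (a ^ DIM('a) * gauss (0::'a))"
        using a gauss_pos[of "0::'a"] by (simp add: inv_fourier_gauss field_simps)
      then show "(LINT \<xi>|lborel. f y * gauss (a *\<^sub>R \<xi>) * wave (x - y) \<xi>)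
          = f y * (gauss ((2 * pi / a) *\<^sub>R (x - y)) / (a ^ DIM('a) * gauss (0::'a)))"
        by (simp add: mult.assoc)
    qed
    \<comment> \<open>Substituting for \<open>y\<close> the point x moved by
      \<open>- (a / (2 * pi))\<close> times z turns the narrow Gaussian into \<open>gauss z\<close>;
      the Jacobian cancels the power of \<open>a\<close> and leaves a constant independent of
      \<open>a\<close>.\<close>
    also have "\<dots> = (a / (2 * pi)) ^ DIM('a) *\<^sub>R
        (LINT z|lborel. f (x + (- a / (2 * pi)) *\<^sub>R z) * (gauss z / (a ^ DIM('a) * gauss (0::'a))))"
      using a
      by (subst lborel_integral_affine[where c="- a / (2 * pi)" and t=x]) (auto simp: abs_of_pos)
    also have "\<dots> = (LINT z|lborel. f (x - (a / (2 * pi)) *\<^sub>R z) * gauss z) / of_real ((2 * pi) ^ DIM('a) * gauss (0::'a))"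
      using a by (simp add: scaleR_conv_of_real field_simps)
    finally show ?thesis .
  qed
  define a where "a n = inverse (real (Suc n))" for n
  have a: "a \<longlonglongrightarrow> 0" "a n > 0" for n
    unfolding a_def by (rule LIMSEQ_inverse_real_of_nat) simp
  have gauss_cont: "isCont gauss (0::'a)"
    using continuous_on_gauss[of "UNIV :: 'a set"] by (simp add: continuous_on_eq_continuous_at)
  \<comment> \<open>Both sides of \<open>eq\<close> are passed to the limit of small parameter: the
    left side is dominated through the integrability of \<open>fourier f\<close>, the right side
    through the bound \<open>B\<close>, with pointwise convergence from the continuity of
    \<open>f\<close> at \<open>x\<close>.\<close>
  have "(\<lambda>n. LINT \<xi>|lborel. fourier f \<xi> * wave x \<xi> * gauss (a n *\<^sub>R \<xi>))
      \<longlonglongrightarrow> (LINT \<xi>|lborel. fourier f \<xi> * wave x \<xi> * gauss (0::'a))"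
  proof (rule integral_dominated_convergence[where w="\<lambda>\<xi>. norm (fourier f \<xi>) * gauss (0::'a)"])
    show "AE \<xi> in lborel. (\<lambda>n. fourier f \<xi> * wave x \<xi> * gauss (a n *\<^sub>R \<xi>)) \<longlonglongrightarrow> fourier f \<xi> * wave x \<xi> * gauss (0::'a)"
    proof (intro AE_I2 tendsto_mult_left tendsto_of_real)
      fix \<xi> :: 'a
      have "(\<lambda>n. a n *\<^sub>R \<xi>) \<longlonglongrightarrow> 0" using tendsto_scaleR[OF a(1) tendsto_const[of \<xi>]] by simp
      then show "(\<lambda>n. gauss (a n *\<^sub>R \<xi>)) \<longlonglongrightarrow> gauss (0::'a)" by (rule isCont_tendsto_compose[OF gauss_cont])
    qed
  qed (use Ff in \<open>auto simp: norm_mult gauss_nonneg gauss_le intro!: mult_left_mono\<close>)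
  moreover have "(\<lambda>n. LINT z|lborel. f (x - (a n / (2 * pi)) *\<^sub>R z) * gauss z) \<longlonglongrightarrow> (LINT z|lborel. f x * gauss (z::'a))"
  proof (rule integral_dominated_convergence[where w="\<lambda>z::'a. B * gauss z"])
    show "AE z in lborel. (\<lambda>n. f (x - (a n / (2 * pi)) *\<^sub>R z) * gauss z) \<longlonglongrightarrow> f x * gauss z"
    proof (intro AE_I2 tendsto_mult_right)
      fix z :: 'a
      have "(\<lambda>n. x - (a n / (2 * pi)) *\<^sub>R z) \<longlonglongrightarrow> x - (0 / (2 * pi)) *\<^sub>R z" by (intro tendsto_intros a) auto
      moreover have "isCont f x" using cont by (simp add: continuous_on_eq_continuous_at)
      ultimately show "(\<lambda>n. f (x - (a n / (2 * pi)) *\<^sub>R z)) \<longlonglongrightarrow> f x" by (auto intro: isCont_tendsto_compose)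
    qed
  qed (use integrable_gauss in \<open>auto simp: norm_mult gauss_nonneg bnd intro!: mult_right_mono\<close>)
  then have "(\<lambda>n. LINT \<xi>|lborel. fourier f \<xi> * wave x \<xi> * gauss (a n *\<^sub>R \<xi>))
      \<longlonglongrightarrow> (LINT z|lborel. f x * gauss (z::'a)) / of_real ((2 * pi) ^ DIM('a) * gauss (0::'a))"
    unfolding eq[OF a(2)] by (intro tendsto_divide tendsto_const) (use gauss_pos[of "0::'a"] in auto)
  ultimately have "(LINT \<xi>|lborel. fourier f \<xi> * wave x \<xi> * gauss (0::'a))
      = (LINT z|lborel. f x * gauss (z::'a)) / of_real ((2 * pi) ^ DIM('a) * gauss (0::'a))"
    by (rule LIMSEQ_unique)
  then have "inv_fourier (fourier f) x * gauss (0::'a) = f x / of_real ((2 * pi) ^ DIM('a) * gauss (0::'a))"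
    by (simp add: inv_fourier_wave integral_gauss)
  then have "inv_fourier (fourier f) x * ((2 * pi) ^ DIM('a) * gauss (0::'a) * gauss (0::'a)) = f x"
    using gauss_pos[of "0::'a"] by (simp add: field_simps)
  \<comment> \<open>One factor \<open>gauss 0\<close> comes from the limit on the left, the other
    from the transform of the Gaussian; each equals \<open>2 * pi\<close> to the power minus half
    the dimension, so together they cancel the Jacobian.\<close>
  moreover have "(2 * pi) ^ DIM('a) * gauss (0::'a) * gauss (0::'a) = 1"
  proof -
    have "gauss (0::'a) = (1 / sqrt (2 * pi)) ^ DIM('a)" by (simp add: gauss_def std_normal_density_def)
    then have "(2 * pi) ^ DIM('a) * gauss (0::'a) * gauss (0::'a) = ((2 * pi) * (1 / sqrt (2 * pi)) * (1 / sqrt (2 * pi))) ^ DIM('a)"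
      by (simp only: power_mult_distrib)
    then show ?thesis by simp
  qed
  then have "complex_of_real ((2 * pi) ^ DIM('a) * gauss (0::'a) * gauss (0::'a)) = 1" by simp
  ultimately show ?thesis by (simp only: mult_1_right)
qed

section \<open>Decay of the inverse transform and vanishing moments\<close>

lemma partial_outside_support:
  assumes zero: "\<And>x. norm x > R \<Longrightarrow> f x = 0" and "norm x > R"
  shows "partial b f x = 0"
proof -
  have "open {x::'a. norm x > R}" by (intro open_Collect_less continuous_intros)
  then have "(f has_derivative (\<lambda>h. 0)) (at x)"
    by (rule has_derivative_transform_within_open[OF has_derivative_const[of 0]]) (use assms in auto)
  then show ?thesis by (rule partial_eqI)
qed

lemma integrable_smooth_compact_support:
  fixes f :: "'a::euclidean_space \<Rightarrow> complex"
  assumes f: "smooth f" and zero: "\<And>x. norm x > R \<Longrightarrow> f x = 0"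
  shows "integrable lborel f"
proof -
  have "integrable lborel (\<lambda>x. indicator (cball 0 R) x *\<^sub>R f x)"
    by (intro borel_integrable_compact compact_cball smooth_continuous_on f)
  moreover have "indicator (cball 0 R) x *\<^sub>R f x = f x" for x
    using zero[of x] by (auto simp: indicator_def)
  ultimately show ?thesis by simp
qed

lemma smooth_increment_le:
  fixes f :: "'a::euclidean_space \<Rightarrow> complex"
  assumes f: "smooth f" and B: "\<And>y. norm (partial b f y) \<le> B" and t: "t > 0"
  shows "norm (f (x + t *\<^sub>R b) - f x) \<le> B * t"
proof -
  have d: "((\<lambda>s. f (x + s *\<^sub>R b)) has_derivative (\<lambda>h. frechet_derivative f (at (x + s *\<^sub>R b)) (h *\<^sub>R b))) (at s)" for s
  proof -
    have "((\<lambda>s. x + s *\<^sub>R b) has_derivative (\<lambda>h. h *\<^sub>R b)) (at s)" by (auto intro!: derivative_eq_intros)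
    from has_derivative_compose[OF this smooth_has_derivative[OF f]] show ?thesis .
  qed
  have "\<exists>s\<in>{0<..<t}. norm (f (x + t *\<^sub>R b) - f (x + 0 *\<^sub>R b))
      \<le> norm (frechet_derivative f (at (x + s *\<^sub>R b)) ((t - 0) *\<^sub>R b))"
    by (rule mvt_general[OF t _ d]) (intro continuous_intros continuous_on_compose2[OF smooth_continuous_on[OF f, of UNIV]], auto)
  then obtain s where "norm (f (x + t *\<^sub>R b) - f x) \<le> norm (frechet_derivative f (at (x + s *\<^sub>R b)) (t *\<^sub>R b))"
    by auto
  also have "\<dots> = t * norm (partial b f (x + s *\<^sub>R b))"
    using linear_cmul[OF linear_frechet_derivative[OF smooth_differentiable[OF f]]] t by simp
  also have "\<dots> \<le> B * t" using B t by (simp add: mult.commute)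
  finally show ?thesis .
qed

lemma norm_divideR_le: "norm y \<le> B * t \<Longrightarrow> t > 0 \<Longrightarrow> norm (y /\<^sub>R t) \<le> B"
  by (simp add: pos_divide_le_eq divide_inverse_commute[symmetric])

text \<open>The integral of each difference quotient vanishes by translation invariance.\<close>

lemma integral_partial_eq_0:
  fixes f :: "'a::euclidean_space \<Rightarrow> complex"
  assumes f: "smooth f" and zero: "\<And>x. norm x > R \<Longrightarrow> f x = 0" and b: "b \<in> Basis"
  shows "(LINT x|lborel. partial b f x) = 0"
proof -
  have int: "integrable lborel f" by (rule integrable_smooth_compact_support[OF f zero])
  have [measurable]: "f \<in> borel_measurable borel" "partial b f \<in> borel_measurable borel"
    using smooth_continuous_on[OF f] smooth_continuous_on[OF smooth_partial[OF f b]]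
    by (simp_all add: borel_measurable_continuous_onI)
  have "compact (partial b f ` cball 0 R)"
    by (intro compact_continuous_image smooth_continuous_on smooth_partial f b compact_cball)
  then have "bounded (partial b f ` cball 0 R)" by (rule compact_imp_bounded)
  then obtain B0 where B0: "\<And>x. x \<in> cball 0 R \<Longrightarrow> norm (partial b f x) \<le> B0"
    unfolding bounded_iff by (metis imageI)
  have B: "norm (partial b f x) \<le> max B0 0" for x
  proof (cases "norm x \<le> R")
    case True
    then show ?thesis using B0[of x] by (simp add: le_max_iff_disj)
  next
    case False
    then show ?thesis using partial_outside_support[of R f x b, OF zero] by simp
  qed
  define t where "t n = inverse (real (Suc n))" for n
  have t: "t \<longlonglongrightarrow> 0" "t n > 0" "t n \<le> 1" for n
    unfolding t_def by (rule LIMSEQ_inverse_real_of_nat) (auto simp: field_simps)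
  have inc: "integrable lborel (\<lambda>x. f (x + t n *\<^sub>R b))" for n
    using lborel_integrable_affine[of 1 f "t n *\<^sub>R b"] int by (simp add: add.commute)
  \<comment> \<open>Since all steps \<open>t n\<close> are at most 1, every quotient vanishes
    outside the ball of radius \<open>R + 1\<close>; inside, the mean value theorem bounds it by the
    supremum of the derivative.\<close>
  have "(\<lambda>n. LINT x|lborel. (f (x + t n *\<^sub>R b) - f x) /\<^sub>R t n) \<longlonglongrightarrow> (LINT x|lborel. partial b f x)"
  proof (rule integral_dominated_convergence[where w="\<lambda>x. max B0 0 * indicator (cball 0 (R + 1)) x"])
    show "integrable lborel (\<lambda>x::'a. max B0 0 * indicator (cball 0 (R + 1)) x)"
      by (intro integrable_mult_right integrable_real_indicator) (use emeasure_bounded_finite[OF bounded_cball] in auto)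
    show "AE x in lborel. (\<lambda>n. (f (x + t n *\<^sub>R b) - f x) /\<^sub>R t n) \<longlonglongrightarrow> partial b f x"
    proof (rule AE_I2)
      fix x
      show "(\<lambda>n. (f (x + t n *\<^sub>R b) - f x) /\<^sub>R t n) \<longlonglongrightarrow> partial b f x"
        by (rule difference_quotient_tendsto[OF smooth_has_derivative[OF f] t(1,2)])
    qed
    show "AE x in lborel. norm ((f (x + t n *\<^sub>R b) - f x) /\<^sub>R t n) \<le> max B0 0 * indicator (cball 0 (R + 1)) x" for n
    proof (rule AE_I2)
      fix x
      show "norm ((f (x + t n *\<^sub>R b) - f x) /\<^sub>R t n) \<le> max B0 0 * indicator (cball 0 (R + 1)) x"
      proof (cases "norm x \<le> R + 1")
        case True
        then show ?thesis
          using norm_divideR_le[OF smooth_increment_le[OF f B t(2), of x n] t(2)] by simp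
      next
        case False
        have "norm x \<le> norm (x + t n *\<^sub>R b) + t n"
          using norm_triangle_ineq4[of "x + t n *\<^sub>R b" "t n *\<^sub>R b"] t(2)[of n] b by simp
        then have "f (x + t n *\<^sub>R b) = 0" "f x = 0"
          using False t(3)[of n] by (auto intro!: zero)
        then show ?thesis by simp
      qed
    qed
  qed (use int in auto)
  moreover have "(LINT x|lborel. (f (x + t n *\<^sub>R b) - f x) /\<^sub>R t n) = 0" for n
    using inc[of n] int lborel_integral_translate[of f "t n *\<^sub>R b"] by (simp add: add.commute)
  ultimately show ?thesis by (simp only: LIMSEQ_const_iff)
qed

lemma smooth_wave: "smooth (wave \<xi>)"
proof (rule smooth_coinduct[where A="range (\<lambda>c x. c * wave \<xi> x)"])
  have d: "((\<lambda>x. c * wave \<xi> x) has_derivative (\<lambda>h. c * (2 * pi * \<i> * (h \<bullet> \<xi>) * wave \<xi> x))) (at x)" for c x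
    by (intro has_derivative_mult_right wave_has_derivative)
  show "wave \<xi> \<in> range (\<lambda>c x. c * wave \<xi> x)" by (rule range_eqI[of _ _ 1]) simp
  fix g assume "g \<in> range (\<lambda>c x. c * wave \<xi> x)"
  then obtain c where g: "g = (\<lambda>x. c * wave \<xi> x)" by blast
  show "g differentiable at x" for x using d g differentiableI by blast
  fix b
  have "partial b g = (\<lambda>x. (c * (2 * pi * \<i> * (b \<bullet> \<xi>))) * wave \<xi> x)"
    unfolding g by (rule ext) (simp add: partial_eqI[OF d] mult.assoc)
  then show "partial b g \<in> range (\<lambda>c x. c * wave \<xi> x)" by (rule range_eqI)
qed

text \<open>Integration by parts: the derivative of the product of \<open>g\<close> with the
  character has integral zero by \<open>integral_partial_eq_0\<close>, and the product rule splits
  it into the two transforms.\<close>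

lemma inv_fourier_partial:
  assumes g: "smooth g" and zero: "\<And>x. norm x > R \<Longrightarrow> g x = 0" and b: "b \<in> Basis"
  shows "inv_fourier (partial b g) x = - (2 * pi * \<i> * (x \<bullet> b)) * inv_fourier g x"
proof -
  have int: "integrable lborel g" by (rule integrable_smooth_compact_support[OF g zero])
  have int': "integrable lborel (partial b g)"
    by (rule integrable_smooth_compact_support[OF smooth_partial[OF g b] partial_outside_support[OF zero]])
  have eq: "partial b (\<lambda>\<xi>. g \<xi> * wave x \<xi>) \<xi> = (2 * pi * \<i> * (x \<bullet> b)) * (g \<xi> * wave x \<xi>) + partial b g \<xi> * wave x \<xi>" for \<xi>
    using partial_eqI[OF has_derivative_mult[OF smooth_has_derivative[OF g] wave_has_derivative]]
    by (simp add: inner_commute mult_ac)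
  have "0 = (LINT \<xi>|lborel. partial b (\<lambda>\<xi>. g \<xi> * wave x \<xi>) \<xi>)"
    using integral_partial_eq_0[OF smooth_mult[OF g smooth_wave] _ b, of R x] zero by simp
  also have "\<dots> = (2 * pi * \<i> * (x \<bullet> b)) * inv_fourier g x + inv_fourier (partial b g) x"
    unfolding eq inv_fourier_wave
    by (subst Bochner_Integration.integral_add) (auto intro!: integrable_mult_right integrable_mult_wave int int')
  finally show ?thesis by (simp add: eq_neg_iff_add_eq_0 add.commute)
qed

text \<open>Each power of the coordinate is traded for one derivative of \<open>g\<close>, which
  keeps its support in the same ball; hence the induction over all \<open>g\<close>. The gained
  factor \<open>2 * pi\<close> exceeds 1 and is dropped.\<close>

lemma coordinate_power_inv_fourier_bounded:
  assumes "smooth g" and "\<And>x. norm x > R \<Longrightarrow> g x = 0" and b: "b \<in> Basis"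
  shows "\<exists>K. \<forall>x. \<bar>x \<bullet> b\<bar> ^ n * norm (inv_fourier g x) \<le> K"
  using assms(1,2)
proof (induction n arbitrary: g)
  case 0
  then show ?case using norm_inv_fourier_le by auto
next
  case (Suc n)
  have "partial b g x = 0" if "norm x > R" for x by (rule partial_outside_support[OF Suc.prems(2) that])
  from Suc.IH[OF smooth_partial[OF Suc.prems(1) b] this]
  obtain K where K: "\<And>x. \<bar>x \<bullet> b\<bar> ^ n * norm (inv_fourier (partial b g) x) \<le> K" by blast
  have "\<bar>x \<bullet> b\<bar> ^ Suc n * norm (inv_fourier g x) \<le> K" for x
  proof -
    have "1 * (\<bar>x \<bullet> b\<bar> ^ Suc n * norm (inv_fourier g x)) \<le> (2 * pi) * (\<bar>x \<bullet> b\<bar> ^ Suc n * norm (inv_fourier g x))"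
      using pi_gt3 by (intro mult_right_mono) auto
    also have "\<dots> = \<bar>x \<bullet> b\<bar> ^ n * norm (inv_fourier (partial b g) x)"
      by (simp add: inv_fourier_partial[OF Suc.prems b] norm_mult)
    finally show ?thesis using K[of x] by simp
  qed
  then show ?case by blast
qed

lemma norm_le_DIM_coordinate:
  fixes x :: "'a::euclidean_space"
  shows "\<exists>b\<in>Basis. norm x \<le> DIM('a) * \<bar>x \<bullet> b\<bar>"
proof (rule ccontr)
  assume "\<not> ?thesis"
  then have "\<And>b. b \<in> Basis \<Longrightarrow> \<bar>x \<bullet> b\<bar> < norm x / DIM('a)" by (auto simp: field_simps not_le)
  then have "(\<Sum>b\<in>Basis. \<bar>x \<bullet> b\<bar>) < (\<Sum>b\<in>(Basis::'a set). norm x / DIM('a))"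
    by (intro sum_strict_mono) auto
  then show False using norm_le_l1[of x] by simp
qed

text \<open>At each point some coordinate is comparable to the norm, so bounds for coordinate powers
  suffice. Which coordinate it is depends on the point, so the constants \<open>K b\<close> are
  summed over \<open>Basis\<close>; the final \<open>+ 1\<close> makes the constant
  positive.\<close>

lemma inv_fourier_decay:
  fixes g :: "'a::euclidean_space \<Rightarrow> complex"
  assumes "smooth g" and "\<And>x. norm x > R \<Longrightarrow> g x = 0"
  shows "\<exists>C>0. \<forall>x. norm (inv_fourier g x) \<le> C / (1 + norm x) ^ n"
proof -
  have "\<exists>K. \<forall>b\<in>Basis. \<forall>x. \<bar>x \<bullet> b\<bar> ^ n * norm (inv_fourier g x) \<le> K b"
    by (intro bchoice ballI coordinate_power_inv_fourier_bounded[OF assms])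
  then obtain K where K: "\<And>b x. b \<in> Basis \<Longrightarrow> \<bar>x \<bullet> b\<bar> ^ n * norm (inv_fourier g x) \<le> K b" by blast
  define L where "L = (LINT \<xi>|lborel. norm (g \<xi>))"
  define C where "C = 2 ^ n * (L + DIM('a) ^ n * (\<Sum>b\<in>Basis. K b)) + 1"
  have K0: "0 \<le> K b" if "b \<in> Basis" for b
    using K[OF that, of 0] by (meson mult_nonneg_nonneg norm_ge_zero order_trans zero_le_power abs_ge_zero)
  have L0: "0 \<le> L" by (simp add: L_def)
  have "norm (inv_fourier g x) \<le> C / (1 + norm x) ^ n" for x
  proof -
    obtain b :: 'a where b: "b \<in> Basis" "norm x \<le> DIM('a) * \<bar>x \<bullet> b\<bar>" using norm_le_DIM_coordinate by blast
    have "(1 + norm x) ^ n \<le> (2 * max 1 (norm x)) ^ n" by (intro power_mono) auto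
    also have "\<dots> = 2 ^ n * max 1 (norm x) ^ n" by (simp add: power_mult_distrib)
    also have "max 1 (norm x) ^ n \<le> 1 + norm x ^ n" by (auto simp: max_def)
    also have "norm x ^ n \<le> (DIM('a) * \<bar>x \<bullet> b\<bar>) ^ n" using b by (intro power_mono) auto
    finally have "(1 + norm x) ^ n \<le> 2 ^ n * (1 + DIM('a) ^ n * \<bar>x \<bullet> b\<bar> ^ n)" by (simp add: power_mult_distrib)
    then have "(1 + norm x) ^ n * norm (inv_fourier g x) \<le> 2 ^ n * (1 + DIM('a) ^ n * \<bar>x \<bullet> b\<bar> ^ n) * norm (inv_fourier g x)"
      by (intro mult_right_mono) auto
    also have "\<dots> = 2 ^ n * (norm (inv_fourier g x) + DIM('a) ^ n * (\<bar>x \<bullet> b\<bar> ^ n * norm (inv_fourier g x)))"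
      by (simp add: algebra_simps)
    also have "\<dots> \<le> 2 ^ n * (L + DIM('a) ^ n * (\<Sum>b\<in>Basis. K b))"
    proof (intro mult_left_mono add_mono)
      show "norm (inv_fourier g x) \<le> L" unfolding L_def by (rule norm_inv_fourier_le)
      have "K b \<le> (\<Sum>b\<in>Basis. K b)" using b K0 by (intro member_le_sum) auto
      then show "\<bar>x \<bullet> b\<bar> ^ n * norm (inv_fourier g x) \<le> (\<Sum>b\<in>Basis. K b)" using K[OF b(1), of x] by simp
    qed auto
    also have "\<dots> \<le> C" by (simp add: C_def)
    finally have "norm (inv_fourier g x) * (1 + norm x) ^ n \<le> C" by (simp add: mult.commute)
    moreover have "(1 + norm x) ^ n > 0" using norm_ge_zero[of x] by (intro zero_less_power) linarith
    ultimately show ?thesis by (simp add: pos_le_divide_eq)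
  qed
  moreover have "C > 0"
  proof -
    have "0 \<le> 2 ^ n * (L + DIM('a) ^ n * (\<Sum>b\<in>Basis. K b))"
      using L0 K0 by (intro mult_nonneg_nonneg add_nonneg_nonneg sum_nonneg) auto
    then show ?thesis by (simp add: C_def)
  qed
  ultimately show ?thesis by blast
qed

text \<open>Up to the factor \<open>2 * pi * \<i>\<close>, the transform of
  \<open>(x \<bullet> b)\<close> times \<open>h\<close> is the derivative in direction
  \<open>b\<close> of the transform of \<open>h\<close>, taken under the integral, and that function
  vanishes on an open ball.\<close>

lemma inv_fourier_coordinate_eq_0:
  fixes h :: "'a::euclidean_space \<Rightarrow> complex"
  assumes h: "integrable lborel h" and hb: "integrable lborel (\<lambda>x. (x \<bullet> b) *\<^sub>R h x)"
    and zero: "\<And>\<xi>. norm \<xi> < r \<Longrightarrow> inv_fourier h \<xi> = 0" and \<xi>: "norm \<xi> < r"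
  shows "inv_fourier (\<lambda>x. (x \<bullet> b) *\<^sub>R h x) \<xi> = 0"
proof -
  have [measurable]: "h \<in> borel_measurable borel" using h by auto
  define t where "t n = inverse (real (Suc n))" for n
  have t: "t \<longlonglongrightarrow> 0" "t n > 0" for n
    unfolding t_def by (rule LIMSEQ_inverse_real_of_nat) auto
  let ?q = "\<lambda>n x. (wave (\<xi> + t n *\<^sub>R b) x - wave \<xi> x) /\<^sub>R t n"
  have "(\<lambda>n. LINT x|lborel. h x * ?q n x)
      \<longlonglongrightarrow> (LINT x|lborel. h x * (2 * pi * \<i> * (x \<bullet> b) * wave \<xi> x))"
  proof (rule integral_dominated_convergence[where w="\<lambda>x. 2 * pi * norm ((x \<bullet> b) *\<^sub>R h x)"])
    show "integrable lborel (\<lambda>x. 2 * pi * norm ((x \<bullet> b) *\<^sub>R h x))"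
      using hb by (intro integrable_mult_right integrable_norm)
    show "AE x in lborel. (\<lambda>n. h x * ?q n x)
        \<longlonglongrightarrow> h x * (2 * pi * \<i> * (x \<bullet> b) * wave \<xi> x)"
    proof (intro AE_I2 tendsto_mult_left)
      fix x
      show "(\<lambda>n. ?q n x) \<longlonglongrightarrow> 2 * pi * \<i> * (x \<bullet> b) * wave \<xi> x"
        using difference_quotient_tendsto[OF wave_has_derivative[of x \<xi>] t, of b]
        unfolding wave_sym[of x] by (simp add: inner_commute)
    qed
    show "AE x in lborel. norm (h x * ?q n x)
        \<le> 2 * pi * norm ((x \<bullet> b) *\<^sub>R h x)" for n
    proof (rule AE_I2)
      fix x
      have "wave (\<xi> + t n *\<^sub>R b) x - wave \<xi> x = wave \<xi> x * (wave (t n *\<^sub>R b) x - 1)"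
        by (simp add: wave_add algebra_simps)
      then have "norm (wave (\<xi> + t n *\<^sub>R b) x - wave \<xi> x) \<le> 2 * pi * \<bar>x \<bullet> b\<bar> * t n"
        using norm_wave_minus_one[of "t n *\<^sub>R b" x] t(2)[of n] by (simp add: norm_mult abs_mult mult_ac)
      then have "norm (?q n x) \<le> 2 * pi * \<bar>x \<bullet> b\<bar>"
        by (rule norm_divideR_le[OF _ t(2)])
      from mult_left_mono[OF this, of "norm (h x)"]
      show "norm (h x * ?q n x) \<le> 2 * pi * norm ((x \<bullet> b) *\<^sub>R h x)"
        by (simp add: norm_mult mult_ac)
    qed
  qed auto
  moreover have "\<forall>\<^sub>F n in sequentially. (LINT x|lborel. h x * ?q n x) = 0"
  proof -
    have "(\<lambda>n. norm (\<xi> + t n *\<^sub>R b)) \<longlonglongrightarrow> norm (\<xi> + 0 *\<^sub>R b)" by (intro tendsto_intros t)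
    then have "\<forall>\<^sub>F n in sequentially. norm (\<xi> + t n *\<^sub>R b) < r" using \<xi> by (auto dest: order_tendstoD(2))
    then show ?thesis
    proof eventually_elim
      case (elim n)
      have "(LINT x|lborel. h x * ?q n x)
          = (LINT x|lborel. (h x * wave (\<xi> + t n *\<^sub>R b) x - h x * wave \<xi> x) /\<^sub>R t n)"
        by (intro Bochner_Integration.integral_cong refl) (simp add: algebra_simps)
      also have "\<dots> = (inv_fourier h (\<xi> + t n *\<^sub>R b) - inv_fourier h \<xi>) /\<^sub>R t n"
        using integrable_mult_wave[OF h] by (simp add: inv_fourier_wave)
      finally show ?case using zero elim \<xi> by simp
    qed
  qed
  ultimately have "(LINT x|lborel. h x * (2 * pi * \<i> * (x \<bullet> b) * wave \<xi> x)) = 0"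
    using LIMSEQ_unique[OF _ tendsto_eventually] by blast
  moreover have "(2 * pi * \<i>) * inv_fourier (\<lambda>x. (x \<bullet> b) *\<^sub>R h x) \<xi>
      = (LINT x|lborel. h x * (2 * pi * \<i> * (x \<bullet> b) * wave \<xi> x))"
    unfolding inv_fourier_wave integral_mult_right_zero[symmetric]
    by (intro Bochner_Integration.integral_cong refl) (simp add: scaleR_conv_of_real mult_ac)
  ultimately show ?thesis by simp
qed

lemma abs_monomial_le: "\<bar>monomial \<alpha> x\<bar> \<le> (1 + norm x) ^ (\<Sum>b\<in>Basis. \<alpha> b)"
proof -
  have "\<bar>monomial \<alpha> x\<bar> = (\<Prod>b\<in>Basis. \<bar>x \<bullet> b\<bar> ^ \<alpha> b)"
    by (simp add: monomial_def abs_prod power_abs)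
  also have "\<dots> \<le> (\<Prod>b\<in>Basis. (1 + norm x) ^ \<alpha> b)"
    by (intro prod_mono conjI power_mono) (auto intro: order_trans[OF Basis_le_norm])
  finally show ?thesis by (simp add: power_sum)
qed

lemma integrable_monomial_schwartz:
  assumes f: "f \<in> schwartz"
  shows "integrable lborel (\<lambda>x. monomial \<alpha> x *\<^sub>R f x)"
proof (rule Bochner_Integration.integrable_bound[OF integrable_schwartz_weighted[OF f, of "\<Sum>b\<in>Basis. \<alpha> b"]])
  have [measurable]: "f \<in> borel_measurable borel" by (rule schwartz_measurable[OF f])
  show "(\<lambda>x. monomial \<alpha> x *\<^sub>R f x) \<in> borel_measurable lborel" unfolding monomial_def by measurable
qed (auto simp: abs_of_nonneg intro!: mult_right_mono abs_monomial_le)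

lemma monomial_Suc:
  assumes "b \<in> Basis" and "\<alpha> b = Suc n"
  shows "monomial \<alpha> x = (x \<bullet> b) * monomial (\<alpha>(b := n)) x"
proof -
  have "(\<Prod>c\<in>Basis - {b}. (x \<bullet> c) ^ \<alpha> c) = (\<Prod>c\<in>Basis - {b}. (x \<bullet> c) ^ (\<alpha>(b := n)) c)"
    by (intro prod.cong) auto
  then show ?thesis
    using assms by (simp add: monomial_def prod.remove[OF finite_Basis assms(1)])
qed

text \<open>Moments are, up to constants, derivatives of the transform at the origin, so they vanish
  if the spectrum stays away from the origin.\<close>

lemma schwartz_inftyI:
  assumes f: "f \<in> schwartz" and r: "r > 0" and zero: "\<And>\<xi>. norm \<xi> < r \<Longrightarrow> fourier f \<xi> = 0"
  shows "f \<in> schwartz_infty"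
proof -
  \<comment> \<open>The claim is made on the whole ball: vanishing at the origin alone could not be
    differentiated in the induction on the degree.\<close>
  have *: "inv_fourier (\<lambda>x. monomial \<alpha> x *\<^sub>R f x) \<xi> = 0" if "norm \<xi> < r" for \<alpha> \<xi>
    using that
  proof (induction "\<Sum>b\<in>Basis. \<alpha> b" arbitrary: \<alpha> \<xi>)
    case 0
    then have "monomial \<alpha> x = 1" for x by (simp add: monomial_def)
    then show ?case using zero[of "- \<xi>"] 0 by (simp add: fourier_eq_inv_fourier)
  next
    case (Suc n)
    then obtain b where b: "b \<in> Basis" "\<alpha> b \<noteq> 0" by (metis nat.distinct(1) sum.neutral)
    then obtain k where k: "\<alpha> b = Suc k" using not0_implies_Suc by blast
    let ?\<beta> = "\<alpha>(b := k)"
    have "(\<Sum>c\<in>Basis - {b}. \<alpha> c) = (\<Sum>c\<in>Basis - {b}. ?\<beta> c)" by (intro sum.cong) auto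
    then have n: "n = (\<Sum>c\<in>Basis. ?\<beta> c)"
      using Suc(2) k by (simp add: sum.remove[OF finite_Basis b(1)])
    have eq: "(x \<bullet> b) *\<^sub>R monomial ?\<beta> x *\<^sub>R f x = monomial \<alpha> x *\<^sub>R f x" for x
      by (simp add: monomial_Suc[of b \<alpha>, OF b(1) k])
    show ?case
      using inv_fourier_coordinate_eq_0[of "\<lambda>x. monomial ?\<beta> x *\<^sub>R f x" b r \<xi>]
        integrable_monomial_schwartz[OF f] Suc.hyps(1)[OF n] Suc.prems
      unfolding eq by blast
  qed
  have "(LINT x|lborel. monomial \<alpha> x *\<^sub>R f x) = 0" for \<alpha>
    using *[of 0 \<alpha>] r by (simp add: inv_fourier_wave)
  then show ?thesis using f by (simp add: schwartz_infty_def)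
qed

section \<open>Littlewood--Paley pieces of wave packets\<close>

text \<open>The packets sit at frequencies \<open>2 ^ freq n\<close>; the gaps make each Littlewood--Paley piece and each
  dilated cutoff see at most one packet.\<close>

definition freq :: "nat \<Rightarrow> nat" where
  "freq n = 10 * n + 10"

lemma freq_ge: "freq n \<ge> 10"
  by (simp add: freq_def)

locale lp_packets =
  fixes \<psi> :: "'a::euclidean_space \<Rightarrow> complex" and e :: 'a
  assumes lp: "is_littlewood_paley \<psi>" and norm_e: "norm e = 1"
begin

definition packet :: "nat \<Rightarrow> 'a \<Rightarrow> 'a \<Rightarrow> complex" where
  "packet n y x = wave (2 ^ freq n *\<^sub>R e) x * \<psi> (x - y)"

abbreviation psi_hat :: "int \<Rightarrow> 'a \<Rightarrow> complex" where
  "psi_hat j \<xi> \<equiv> fourier \<psi> ((2 powi (- j)) *\<^sub>R \<xi>)"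

abbreviation own_piece :: "nat \<Rightarrow> 'a \<Rightarrow> 'a \<Rightarrow> complex" where
  "own_piece n y \<equiv> LP_piece \<psi> (int (freq n)) (packet n y)"

lemma schwartz_psi: "\<psi> \<in> schwartz"
  using lp by (simp add: is_littlewood_paley_def)

lemma integrable_psi: "integrable lborel \<psi>"
  by (rule integrable_schwartz[OF schwartz_psi])

text \<open>The support condition is silent on the two boundary spheres. There the value is a limit
  of zeros, by continuity along the scaled points \<open>c n\<close> times \<open>\<xi>\<close>,
  which approach from inside the small sphere (\<open>s = -1\<close>) or from outside the large one
  (\<open>s = 1\<close>).\<close>

lemma fourier_psi_eq_0:
  assumes \<xi>: "norm \<xi> \<le> 1/2 \<or> 2 \<le> norm \<xi>"
  shows "fourier \<psi> \<xi> = 0"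
proof -
  define s :: real where "s = (if norm \<xi> \<le> 1/2 then -1 else 1)"
  define c where "c n = 1 + s * inverse (real (Suc n))" for n
  have "fourier \<psi> (c n *\<^sub>R \<xi>) = 0" for n
  proof -
    have "0 < inverse (real (Suc n))" "inverse (real (Suc n)) \<le> 1" by (auto simp: inverse_le_1_iff)
    then have c: "0 \<le> c n" "norm \<xi> \<le> 1/2 \<Longrightarrow> c n < 1" "\<not> norm \<xi> \<le> 1/2 \<Longrightarrow> 1 < c n"
      by (auto simp: c_def s_def)
    have "c n * norm \<xi> < 1/2 \<or> 2 < c n * norm \<xi>"
    proof (cases "norm \<xi> \<le> 1/2")
      case True
      then show ?thesis using mult_left_mono[OF True c(1)] c(2) by linarith
    next
      case False
      then have "1 * norm \<xi> < c n * norm \<xi>" using c(3) by (intro mult_strict_right_mono) auto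
      then show ?thesis using \<xi> False by linarith
    qed
    then show ?thesis
      using lp closure_subset[of "{\<xi>. fourier \<psi> \<xi> \<noteq> 0}"] c(1)
      unfolding is_littlewood_paley_def fsupp_def by force
  qed
  moreover have "(\<lambda>n. c n *\<^sub>R \<xi>) \<longlonglongrightarrow> (1 + s * 0) *\<^sub>R \<xi>"
    unfolding c_def by (intro tendsto_intros LIMSEQ_inverse_real_of_nat)
  then have "(\<lambda>n. fourier \<psi> (c n *\<^sub>R \<xi>)) \<longlonglongrightarrow> fourier \<psi> \<xi>"
    using continuous_on_fourier[OF integrable_psi, of UNIV]
    by (auto simp: continuous_on_eq_continuous_at intro: isCont_tendsto_compose)
  ultimately show ?thesis by (simp add: LIMSEQ_const_iff)
qed

text \<open>In the partition of unity at a unit vector, the terms \<open>k = 1\<close> and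
  \<open>k = -1\<close> evaluate \<open>fourier \<psi>\<close> exactly on the boundary spheres,
  where it vanishes; only \<open>k = 0\<close> remains. This value normalizes the lower bounds
  below.\<close>

lemma fourier_psi_e: "fourier \<psi> e = 1"
proof -
  have "e \<noteq> 0" using norm_e by auto
  then have "((\<lambda>k::int. fourier (dilate \<psi> k) e) has_sum 1) UNIV"
    using lp by (simp add: is_littlewood_paley_def)
  moreover have "fourier (dilate \<psi> k) e = 0" if "k \<noteq> 0" for k
  proof -
    have n: "norm ((2 powi (- k)) *\<^sub>R e) = 2 powi (- k)" by (simp add: norm_e)
    have "k \<ge> 1 \<or> - k \<ge> 1" using that by linarith
    then have "norm ((2 powi (- k)) *\<^sub>R e) \<le> 1/2 \<or> 2 \<le> norm ((2 powi (- k)) *\<^sub>R e)"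
    proof
      assume "k \<ge> 1"
      then have "(2::real) powi (- k) \<le> 2 powi (- 1)" by (intro power_int_increasing) auto
      then show ?thesis unfolding n by simp
    next
      assume "- k \<ge> 1"
      then have "(2::real) powi 1 \<le> 2 powi (- k)" by (intro power_int_increasing) auto
      then show ?thesis unfolding n by simp
    qed
    then show ?thesis using fourier_psi_eq_0 by (simp add: fourier_dilate integrable_psi)
  qed
  then have "((\<lambda>k::int. fourier (dilate \<psi> k) e) has_sum fourier (dilate \<psi> 0) e) UNIV"
    by (intro has_sum_finite_neutralI[of "{0}"]) auto
  ultimately have "fourier (dilate \<psi> 0) e = 1" using has_sum_unique by blast
  then show ?thesis by (simp add: fourier_dilate integrable_psi)
qed

lemma integrable_fourier_psi: "integrable lborel (fourier \<psi>)"
proof -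
  have "integrable lborel (\<lambda>x. indicator (cball 0 2) x *\<^sub>R fourier \<psi> x)"
    by (intro borel_integrable_compact compact_cball continuous_on_fourier integrable_psi)
  moreover have "indicator (cball 0 2) x *\<^sub>R fourier \<psi> x = fourier \<psi> x" for x
    using fourier_psi_eq_0[of x] by (auto simp: indicator_def)
  ultimately show ?thesis by simp
qed

lemma inv_fourier_fourier_schwartz:
  fixes f :: "'a \<Rightarrow> complex"
  assumes f: "f \<in> schwartz" and "integrable lborel (fourier f)"
  shows "inv_fourier (fourier f) = f"
proof
  fix x :: 'a
  obtain B where "\<And>x. norm (f x) \<le> B / (1 + norm x) ^ 0" using schwartz_decay[OF f] by blast
  then show "inv_fourier (fourier f) x = f x"
    by (intro fourier_inversion[where B=B] integrable_schwartz smooth_continuous_on schwartz_smooth assms) auto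
qed

lemma inv_fourier_fourier_psi: "inv_fourier (fourier \<psi>) = \<psi>"
  by (rule inv_fourier_fourier_schwartz[OF schwartz_psi integrable_fourier_psi])

text \<open>A Bernstein-type bound: by inversion \<open>\<psi>\<close> is a superposition of
  characters of frequency below 2, each Lipschitz with constant at most
  \<open>4 * pi\<close>.\<close>

lemma psi_lipschitz: "\<exists>K\<ge>0. \<forall>x y. norm (\<psi> x - \<psi> y) \<le> K * norm (x - y)"
proof (intro exI conjI allI)
  let ?L = "LINT \<xi>|lborel. norm (fourier \<psi> \<xi>)"
  show "0 \<le> 4 * pi * ?L" by simp
  fix x y :: 'a
  have "\<psi> x - \<psi> y = inv_fourier (fourier \<psi>) x - inv_fourier (fourier \<psi>) y"
    by (simp add: inv_fourier_fourier_psi)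
  also have "\<dots> = (LINT \<xi>|lborel. fourier \<psi> \<xi> * wave x \<xi> - fourier \<psi> \<xi> * wave y \<xi>)"
    using integrable_mult_wave[OF integrable_fourier_psi] by (simp add: inv_fourier_wave)
  finally have eq: "\<psi> x - \<psi> y = (LINT \<xi>|lborel. fourier \<psi> \<xi> * wave x \<xi> - fourier \<psi> \<xi> * wave y \<xi>)" .
  have "norm (\<psi> x - \<psi> y) \<le> (LINT \<xi>|lborel. norm (fourier \<psi> \<xi> * wave x \<xi> - fourier \<psi> \<xi> * wave y \<xi>))"
    unfolding eq by (rule integral_norm_bound)
  also have "\<dots> \<le> (LINT \<xi>|lborel. 4 * pi * norm (x - y) * norm (fourier \<psi> \<xi>))"
  proof (rule integral_mono)
    fix \<xi> :: 'a
    show "norm (fourier \<psi> \<xi> * wave x \<xi> - fourier \<psi> \<xi> * wave y \<xi>) \<le> 4 * pi * norm (x - y) * norm (fourier \<psi> \<xi>)"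
    proof (cases "norm \<xi> \<ge> 2")
      case True
      then show ?thesis by (simp add: fourier_psi_eq_0)
    next
      case False
      have "wave x \<xi> - wave y \<xi> = wave y \<xi> * (wave (x - y) \<xi> - 1)"
        using wave_add[of y "x - y" \<xi>] by (simp add: algebra_simps)
      then have "norm (wave x \<xi> - wave y \<xi>) \<le> 2 * pi * \<bar>\<xi> \<bullet> (x - y)\<bar>"
        using norm_wave_minus_one[of "x - y" \<xi>] by (simp add: norm_mult)
      also have "\<dots> \<le> 2 * pi * (norm \<xi> * norm (x - y))"
        by (intro mult_left_mono Cauchy_Schwarz_ineq2) auto
      also have "\<dots> \<le> 2 * pi * (2 * norm (x - y))"
        using False by (intro mult_left_mono mult_right_mono) auto
      finally have "norm (wave x \<xi> - wave y \<xi>) \<le> 4 * pi * norm (x - y)" by simp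
      from mult_left_mono[OF this, of "norm (fourier \<psi> \<xi>)"] show ?thesis
        unfolding right_diff_distrib[symmetric] norm_mult by (simp add: mult_ac)
    qed
  qed (auto intro!: integrable_norm Bochner_Integration.integrable_diff integrable_mult_wave integrable_fourier_psi
      integrable_mult_right)
  finally show "norm (\<psi> x - \<psi> y) \<le> 4 * pi * ?L * norm (x - y)" by (simp add: mult_ac)
qed

lemma schwartz_packet: "packet n y \<in> schwartz"
  unfolding packet_def[abs_def] by (rule schwartz_modulate_translate[OF schwartz_psi])

lemma fourier_packet: "fourier (packet n y) \<xi> = wave (2 ^ freq n *\<^sub>R e - \<xi>) y * fourier \<psi> (\<xi> - 2 ^ freq n *\<^sub>R e)"
  unfolding packet_def[abs_def] by (rule fourier_modulate_translate[OF integrable_psi])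

text \<open>The packet has unit spatial scale, so its spectrum lies within distance 2 of a point of
  norm \<open>2 ^ freq n\<close>, which is at least 1024. The stated annulus is much larger than
  necessary for this ball, but it is the one on which the rescaled cutoff equals 1.\<close>

lemma fourier_packet_support:
  assumes "fourier (packet n y) \<xi> \<noteq> 0"
  shows "2 ^ freq n < 2 * norm \<xi>" "norm \<xi> < 2 * 2 ^ freq n"
proof -
  have *: "norm (\<xi> - 2 ^ freq n *\<^sub>R e) < 2"
    using assms fourier_psi_eq_0[of "\<xi> - 2 ^ freq n *\<^sub>R e"] by (auto simp: fourier_packet not_le[symmetric])
  have n: "norm (2 ^ freq n *\<^sub>R e) = 2 ^ freq n" by (simp add: norm_e)
  have "(2::real) ^ 10 \<le> 2 ^ freq n" by (intro power_increasing freq_ge) auto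
  moreover have "norm \<xi> \<le> norm (\<xi> - 2 ^ freq n *\<^sub>R e) + 2 ^ freq n"
    using norm_triangle_ineq[of "\<xi> - 2 ^ freq n *\<^sub>R e" "2 ^ freq n *\<^sub>R e"] by (simp add: n[simplified] norm_e)
  moreover have "2 ^ freq n \<le> norm (\<xi> - 2 ^ freq n *\<^sub>R e) + norm \<xi>"
    using norm_triangle_ineq4[of \<xi> "\<xi> - 2 ^ freq n *\<^sub>R e"] by (simp add: norm_e)
  ultimately show "2 ^ freq n < 2 * norm \<xi>" "norm \<xi> < 2 * 2 ^ freq n" using * by auto
qed

lemma integrable_fourier_packet: "integrable lborel (fourier (packet n y))"
proof -
  have "integrable lborel (\<lambda>x. indicator (cball 0 (2 * 2 ^ freq n)) x *\<^sub>R fourier (packet n y) x)"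
    by (intro borel_integrable_compact compact_cball continuous_on_fourier integrable_schwartz schwartz_packet)
  moreover have "indicator (cball 0 (2 * 2 ^ freq n)) x *\<^sub>R fourier (packet n y) x = fourier (packet n y) x" for x
    using fourier_packet_support(2)[of n y x] by (cases "fourier (packet n y) x = 0") auto
  ultimately show ?thesis by simp
qed

lemma inv_fourier_fourier_packet: "inv_fourier (fourier (packet n y)) = packet n y"
  by (rule inv_fourier_fourier_schwartz[OF schwartz_packet integrable_fourier_packet])

lemma LP_piece_inv_fourier:
  assumes "integrable lborel F"
  shows "LP_piece \<psi> j (inv_fourier F) x = inv_fourier (\<lambda>\<xi>. psi_hat j \<xi> * F \<xi>) x"
  by (simp add: LP_piece_def convol_inv_fourier[OF integrable_dilate[OF integrable_psi] assms]
      fourier_dilate[OF integrable_psi])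

lemma integrable_fourier_psi_mult:
  assumes F: "integrable lborel F"
  shows "integrable lborel (\<lambda>\<xi>. psi_hat j \<xi> * F \<xi>)"
proof (rule Bochner_Integration.integrable_bound)
  have [measurable]: "F \<in> borel_measurable borel" "fourier \<psi> \<in> borel_measurable borel"
    using F borel_measurable_fourier[OF integrable_psi] by auto
  show "integrable lborel (\<lambda>\<xi>. of_real (LINT x|lborel. norm (\<psi> x)) * F \<xi>)" using F by simp
  show "(\<lambda>\<xi>. psi_hat j \<xi> * F \<xi>) \<in> borel_measurable lborel" by measurable
  show "AE \<xi> in lborel. norm (psi_hat j \<xi> * F \<xi>)
      \<le> norm (of_real (LINT x|lborel. norm (\<psi> x)) * F \<xi>)"
    using norm_inv_fourier_le[of \<psi>]
    by (auto simp: norm_mult fourier_eq_inv_fourier abs_of_nonneg intro!: mult_right_mono)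
qed

lemma LP_piece_packet:
  "LP_piece \<psi> j (packet n y) x = inv_fourier (\<lambda>\<xi>. psi_hat j \<xi> * fourier (packet n y) \<xi>) x"
  using LP_piece_inv_fourier[OF integrable_fourier_packet] by (simp add: inv_fourier_fourier_packet)

text \<open>The multiplier of the piece and the spectrum of the packet lie in open annuli reaching
  one octave to either side of \<open>2 powi j\<close> and \<open>2 ^ freq n\<close>. Strictness of
  the bounds excludes an overlap at distance exactly 2.\<close>

lemma LP_piece_packet_eq_0:
  assumes "1 < \<bar>j - int (freq n)\<bar>"
  shows "LP_piece \<psi> j (packet n y) x = 0"
proof -
  have "psi_hat j \<xi> * fourier (packet n y) \<xi> = 0" for \<xi>
  proof (rule ccontr)
    assume "psi_hat j \<xi> * fourier (packet n y) \<xi> \<noteq> 0"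
    then have 1: "psi_hat j \<xi> \<noteq> 0" and 2: "fourier (packet n y) \<xi> \<noteq> 0" by auto
    have 3: "1/2 < 2 powi (- j) * norm \<xi>" "2 powi (- j) * norm \<xi> < 2"
      using fourier_psi_eq_0[of "(2 powi (- j)) *\<^sub>R \<xi>"] 1 by (auto simp: not_le[symmetric])
    have 4: "2 powi j < 2 * norm \<xi>" "norm \<xi> < 2 * 2 powi j"
      using 3 by (auto simp: power_int_minus field_simps)
    have "(2::real) powi j < 2 powi (int (freq n) + 2)"
      using 4(1) fourier_packet_support(2)[OF 2] by (simp add: power_int_add)
    moreover have "(2::real) powi (int (freq n)) < 2 powi (j + 2)"
      using 4(2) fourier_packet_support(1)[OF 2] by (simp add: power_int_add)
    ultimately have "j < int (freq n) + 2" "int (freq n) < j + 2"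
      using power_int_increasing[of "int (freq n) + 2" j "2::real"] power_int_increasing[of "j + 2" "int (freq n)" "2::real"]
      by (auto simp: not_le[symmetric])
    then show False using assms by linarith
  qed
  then show ?thesis unfolding LP_piece_packet inv_fourier_wave by (simp only: mult_zero_left) simp
qed

text \<open>The convolution variable is rescaled so that the kernel is \<open>\<psi>\<close> at unit
  scale. The packet then enters through \<open>\<psi>\<close> at a point displaced by only
  \<open>2 powi (- j)\<close> times z, and its modulation leaves the integral as a factor of modulus
  one.\<close>

lemma LP_piece_packet_integral:
  "LP_piece \<psi> j (packet n y) x = wave (2 ^ freq n *\<^sub>R e) x *
     (LINT z|lborel. \<psi> z * wave (- (2 powi (- j)) *\<^sub>R 2 ^ freq n *\<^sub>R e) z * \<psi> (x - y - (2 powi (- j)) *\<^sub>R z))"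
proof -
  have [measurable]: "\<psi> \<in> borel_measurable borel" "packet n y \<in> borel_measurable borel"
    by (rule schwartz_measurable, rule schwartz_psi schwartz_packet)+
  define c :: real where "c = 2 powi (- j)"
  have c: "c > 0" "(2::real) powi j = 1 / c" "(2::real) powi (j * int DIM('a)) * c ^ DIM('a) = 1"
    by (auto simp: c_def power_int_minus divide_simps power_int_mult)
  have [measurable]: "dilate \<psi> j \<in> borel_measurable borel" unfolding dilate_def[abs_def] by measurable
  have "LP_piece \<psi> j (packet n y) x = c ^ DIM('a) *\<^sub>R (LINT z|lborel. dilate \<psi> j (c *\<^sub>R z) * packet n y (x - c *\<^sub>R z))"
    unfolding LP_piece_def convol_def
    by (subst lborel_integral_affine[where c="- c" and t=x]) (use c in auto)
  also have "\<dots> = (LINT z|lborel. (c ^ DIM('a) * 2 powi (j * int DIM('a))) *\<^sub>R (\<psi> z * packet n y (x - c *\<^sub>R z)))"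
    unfolding integral_scaleR_right[symmetric]
    by (intro Bochner_Integration.integral_cong refl) (use c in \<open>simp add: dilate_def scaleR_conv_of_real\<close>)
  also have "\<dots> = (LINT z|lborel. wave (2 ^ freq n *\<^sub>R e) x *
      (\<psi> z * wave (- c *\<^sub>R 2 ^ freq n *\<^sub>R e) z * \<psi> (x - y - c *\<^sub>R z)))"
  proof (intro Bochner_Integration.integral_cong refl)
    fix z
    have "wave (2 ^ freq n *\<^sub>R e) (x - c *\<^sub>R z) = wave (2 ^ freq n *\<^sub>R e) x * wave (- c *\<^sub>R 2 ^ freq n *\<^sub>R e) z"
      by (simp add: wave_diff_right) (simp add: wave_def mult_ac)
    moreover have "\<psi> (x - c *\<^sub>R z - y) = \<psi> (x - y - c *\<^sub>R z)" by (simp add: algebra_simps)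
    ultimately show "(c ^ DIM('a) * 2 powi (j * int DIM('a))) *\<^sub>R (\<psi> z * packet n y (x - c *\<^sub>R z))
        = wave (2 ^ freq n *\<^sub>R e) x * (\<psi> z * wave (- c *\<^sub>R 2 ^ freq n *\<^sub>R e) z * \<psi> (x - y - c *\<^sub>R z))"
      using c(3) by (simp add: packet_def mult_ac)
  qed
  finally show ?thesis by (simp add: c_def)
qed

section \<open>Pointwise bounds for the pieces of a packet\<close>

lemma integrable_psi_product:
  "integrable lborel (\<lambda>z. \<psi> z * wave \<eta> z * \<psi> (w - r *\<^sub>R z))"
proof -
  obtain B where B: "\<And>x. norm (\<psi> x) \<le> B / (1 + norm x) ^ 0" using schwartz_decay[OF schwartz_psi] by blast
  have [measurable]: "\<psi> \<in> borel_measurable borel" by (rule schwartz_measurable[OF schwartz_psi])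
  show ?thesis
  proof (rule Bochner_Integration.integrable_bound)
    show "integrable lborel (\<lambda>z. of_real B * \<psi> z)" using integrable_psi by simp
    have "norm (\<psi> x) \<le> \<bar>B\<bar>" for x using B[of x] by simp
    then show "AE z in lborel. norm (\<psi> z * wave \<eta> z * \<psi> (w - r *\<^sub>R z)) \<le> norm (of_real B * \<psi> z)"
      by (intro AE_I2) (simp add: norm_mult, metis mult.commute mult_left_mono norm_ge_zero)
  qed measurable
qed

text \<open>For \<open>j \<ge> 0\<close> the displacement is at most \<open>norm z\<close>, so
  Peetre's inequality moves the decay to \<open>x - y\<close> at the cost of a weighted integral of
  \<open>\<psi>\<close>, uniformly in \<open>j\<close>, \<open>n\<close> and
  \<open>y\<close>.\<close>

lemma LP_piece_packet_upper:
  "\<exists>C>0. \<forall>j\<ge>0. \<forall>n y x. norm (LP_piece \<psi> j (packet n y) x) \<le> C / (1 + norm (x - y)) ^ M"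
proof -
  obtain C where C: "C > 0" "\<And>x. norm (\<psi> x) \<le> C / (1 + norm x) ^ M" using schwartz_decay[OF schwartz_psi] by blast
  let ?L = "LINT z|lborel. norm ((1 + norm z) ^ M *\<^sub>R \<psi> z)"
  have "norm (LP_piece \<psi> j (packet n y) x) \<le> (C * ?L + 1) / (1 + norm (x - y)) ^ M" if j: "j \<ge> 0" for j n y x
  proof -
    define r :: real where "r = 2 powi (- j)"
    have r: "0 < r" "r \<le> 1" unfolding r_def using j power_int_increasing[of "- j" 0 "2::real"] by auto
    let ?w = "x - y"
    have pos: "(1 + norm v) ^ M > 0" for v :: 'a using norm_ge_zero[of v] by (intro zero_less_power) linarith
    have "norm (LP_piece \<psi> j (packet n y) x)
        = norm (LINT z|lborel. \<psi> z * wave (- r *\<^sub>R 2 ^ freq n *\<^sub>R e) z * \<psi> (?w - r *\<^sub>R z))"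
      unfolding LP_piece_packet_integral r_def by (simp add: norm_mult)
    also have "\<dots> \<le> (LINT z|lborel. norm (\<psi> z * wave (- r *\<^sub>R 2 ^ freq n *\<^sub>R e) z * \<psi> (?w - r *\<^sub>R z)))"
      by (rule integral_norm_bound)
    also have "\<dots> \<le> (LINT z|lborel. C / (1 + norm ?w) ^ M * norm ((1 + norm z) ^ M *\<^sub>R \<psi> z))"
    proof (rule integral_mono)
      fix z
      have "(1 + norm ?w) ^ M \<le> ((1 + norm (?w - r *\<^sub>R z)) * (1 + norm (r *\<^sub>R z))) ^ M"
        by (intro power_mono bracket_shift) auto
      also have "\<dots> \<le> ((1 + norm (?w - r *\<^sub>R z)) * (1 + norm z)) ^ M"
        using r by (intro power_mono mult_left_mono) (auto intro: mult_left_le_one_le)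
      finally have "(1 + norm ?w) ^ M \<le> (1 + norm (?w - r *\<^sub>R z)) ^ M * (1 + norm z) ^ M" by (simp add: power_mult_distrib)
      then have "C / (1 + norm (?w - r *\<^sub>R z)) ^ M \<le> C / (1 + norm ?w) ^ M * (1 + norm z) ^ M"
        using pos[of ?w] pos[of "?w - r *\<^sub>R z"] C(1) by (simp add: field_simps)
      then have "norm (\<psi> (?w - r *\<^sub>R z)) \<le> C / (1 + norm ?w) ^ M * (1 + norm z) ^ M"
        using C(2) order_trans by blast
      from mult_left_mono[OF this, of "norm (\<psi> z)"]
      show "norm (\<psi> z * wave (- r *\<^sub>R 2 ^ freq n *\<^sub>R e) z * \<psi> (?w - r *\<^sub>R z))
          \<le> C / (1 + norm ?w) ^ M * norm ((1 + norm z) ^ M *\<^sub>R \<psi> z)"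
        by (simp add: norm_mult abs_of_nonneg mult_ac)
    qed (intro integrable_norm integrable_psi_product integrable_mult_right integrable_schwartz_weighted schwartz_psi)+
    also have "\<dots> = C * ?L / (1 + norm ?w) ^ M" by simp
    also have "\<dots> \<le> (C * ?L + 1) / (1 + norm ?w) ^ M"
      using pos[of ?w] by (intro divide_right_mono) auto
    finally show ?thesis .
  qed
  moreover have "C * ?L + 1 > 0" using C(1) by (intro add_nonneg_pos mult_nonneg_nonneg) auto
  ultimately show ?thesis by blast
qed

text \<open>At the packet's own scale the remaining modulation has frequency \<open>- e\<close>.
  Without the displacement the integral would be \<open>fourier \<psi> e = 1\<close> times
  \<open>\<psi> (x - y)\<close>; the displacement costs the Lipschitz constant times a first moment
  times \<open>(1/2) ^ freq n\<close>.\<close>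

lemma LP_piece_packet_lower:
  "\<exists>K\<ge>0. \<forall>n y x. norm (\<psi> (x - y)) - K * (1/2) ^ freq n \<le> norm (own_piece n y x)"
proof -
  obtain K where K: "K \<ge> 0" "\<And>x y. norm (\<psi> x - \<psi> y) \<le> K * norm (x - y)" using psi_lipschitz by blast
  let ?L = "LINT z|lborel. norm ((1 + norm z) ^ 1 *\<^sub>R \<psi> z)"
  have int1: "integrable lborel (\<lambda>z. (1 + norm z) ^ 1 *\<^sub>R \<psi> z)"
    by (rule integrable_schwartz_weighted[OF schwartz_psi])
  have "norm (\<psi> (x - y)) - (K * ?L) * (1/2) ^ freq n \<le> norm (own_piece n y x)" for n y x
  proof -
    define r :: real where "r = (1/2) ^ freq n"
    have r: "2 powi (- int (freq n)) = r" "r *\<^sub>R 2 ^ freq n *\<^sub>R e = e" "r > 0"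
      by (auto simp: r_def power_int_minus power_one_over divide_simps)
    let ?w = "x - y"
    let ?g = "\<lambda>z. \<psi> z * wave (- e) z * \<psi> (?w - r *\<^sub>R z)"
    let ?h = "\<lambda>z. \<psi> z * wave (- e) z * \<psi> ?w"
    let ?I = "LINT z|lborel. ?g z"
    have piece: "norm (own_piece n y x) = norm ?I"
      unfolding LP_piece_packet_integral r scaleR_minus_left by (simp add: norm_mult)
    have "\<psi> ?w = (LINT z|lborel. ?h z)"
      using fourier_psi_e by (simp add: fourier_wave)
    then have eq: "\<psi> ?w - ?I = (LINT z|lborel. ?h z - ?g z)"
      using integrable_psi_product integrable_mult_wave[OF integrable_psi]
      by (subst Bochner_Integration.integral_diff) auto
    have "norm (\<psi> ?w - ?I) \<le> (LINT z|lborel. norm (?h z - ?g z))"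
      unfolding eq by (rule integral_norm_bound)
    also have "\<dots> \<le> (LINT z|lborel. K * r * norm ((1 + norm z) ^ 1 *\<^sub>R \<psi> z))"
    proof (rule integral_mono)
      fix z
      have "norm (\<psi> ?w - \<psi> (?w - r *\<^sub>R z)) \<le> K * (r * norm z)" using K(2)[of ?w "?w - r *\<^sub>R z"] r(3) by simp
      also have "\<dots> \<le> K * (r * (1 + norm z))" using K(1) r(3) by (intro mult_left_mono) auto
      finally have "norm (\<psi> ?w - \<psi> (?w - r *\<^sub>R z)) \<le> K * (r * (1 + norm z))" .
      from mult_left_mono[OF this, of "norm (\<psi> z)"]
      show "norm (?h z - ?g z)
          \<le> K * r * norm ((1 + norm z) ^ 1 *\<^sub>R \<psi> z)"
        unfolding right_diff_distrib[symmetric] norm_mult by (simp add: mult_ac)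
    qed (intro integrable_norm Bochner_Integration.integrable_diff integrable_mult_left integrable_mult_wave
        integrable_psi integrable_psi_product integrable_mult_right int1)+
    also have "\<dots> = K * ?L * r" by simp
    finally have "norm (\<psi> ?w - ?I) \<le> K * ?L * r" .
    moreover have "norm (\<psi> ?w) - norm ?I \<le> norm (\<psi> ?w - ?I)" by (rule norm_triangle_ineq2)
    ultimately show ?thesis unfolding piece r_def by linarith
  qed
  moreover have "K * ?L \<ge> 0" using K(1) by (intro mult_nonneg_nonneg) auto
  ultimately show ?thesis by blast
qed

lemma psi_nonzero: "\<exists>x. \<psi> x \<noteq> 0"
proof (rule ccontr)
  assume "\<not> ?thesis"
  then have "fourier \<psi> e = 0" by (simp add: fourier_wave)
  then show False by (simp add: fourier_psi_e)
qed

end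

section \<open>Quasi-norms\<close>

lemma epow_ennreal: "0 \<le> a \<Longrightarrow> epow (ennreal a) r = ennreal (a powr r)"
  by (simp add: epow_def)

lemma epow_mono: "x \<le> y \<Longrightarrow> 0 \<le> r \<Longrightarrow> epow x r \<le> epow y r"
  by (cases x; cases y) (auto simp: epow_def powr_mono2 top_unique)

lemma epow_zero [simp]: "epow 0 r = 0"
  by (simp add: epow_def)

text \<open>Makes \<open>enn2real (1 / q)\<close> available as the reciprocal exponent with value 0
  at infinity, so that one formula can state the bounds for finite and infinite exponents.\<close>

lemma exponent_cases:
  fixes q :: ennreal
  assumes "0 < q"
  obtains (infinite) "q = \<infinity>" "enn2real (1 / q) = 0"
  | (finite) r where "r > 0" "q = ennreal r" "enn2real q = r" "enn2real (1 / q) = 1 / r" "q \<noteq> \<infinity>"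
proof (cases q rule: ennreal_cases)
  case (real r)
  then have "r > 0" using assms by (auto simp: order.order_iff_strict)
  then show ?thesis using finite[of r] real
    by (metis divide_ennreal ennreal_1 ennreal_neq_top enn2real_ennreal infinity_ennreal_def zero_le_one less_imp_le zero_le_divide_1_iff)
next
  case top
  then show ?thesis using infinite by simp
qed

lemma infsum_le_ennreal:
  fixes f :: "'i \<Rightarrow> ennreal"
  assumes "\<And>F. finite F \<Longrightarrow> F \<subseteq> A \<Longrightarrow> sum f F \<le> c"
  shows "infsum f A \<le> c"
  unfolding nonneg_infsum_complete[of A f, OF zero_le] by (intro SUP_least) (use assms in auto)

lemma sum_le_infsum_ennreal:
  fixes f :: "'i \<Rightarrow> ennreal"
  assumes "finite F" "F \<subseteq> A"
  shows "sum f F \<le> infsum f A"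
  unfolding nonneg_infsum_complete[of A f, OF zero_le] by (intro SUP_upper) (use assms in auto)

lemma infsum_finite_support_ennreal:
  fixes f :: "'i \<Rightarrow> ennreal"
  assumes "finite J" and "\<And>j. j \<in> A \<Longrightarrow> j \<notin> J \<Longrightarrow> f j = 0"
  shows "infsum f A \<le> sum f J"
proof (rule infsum_le_ennreal)
  fix F assume F: "finite F" "F \<subseteq> A"
  have "sum f F = sum f (F \<inter> J)" using F assms by (intro sum.mono_neutral_right) auto
  also have "\<dots> \<le> sum f J" using assms by (intro sum_mono2) auto
  finally show "sum f F \<le> sum f J" .
qed

text \<open>For infinite \<open>q\<close> the power of the cardinality is 1, as \<open>J\<close> is
  nonempty, and the claim is about a single term of the supremum.\<close>

lemma lnorm_ge_card:
  assumes q: "0 < q" and J: "finite J" "J \<noteq> {}" and v: "0 \<le> v" and ge: "\<And>j. j \<in> J \<Longrightarrow> ennreal v \<le> a j"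
  shows "ennreal (real (card J) powr enn2real (1 / q) * v) \<le> lnorm q a"
  using q
proof (cases rule: exponent_cases)
  case infinite
  obtain j where j: "j \<in> J" using J by blast
  have "card J \<noteq> 0" using J by auto
  then have "ennreal (real (card J) powr enn2real (1 / q) * v) = ennreal v" using infinite by simp
  also have "\<dots> \<le> (SUP j. a j)" using ge[OF j] by (rule SUP_upper2[OF UNIV_I])
  finally show ?thesis using infinite by (simp add: lnorm_def)
next
  case (finite r)
  have "ennreal (card J * v powr r) = (\<Sum>j\<in>J. epow (ennreal v) r)"
    using v by (simp add: epow_ennreal ennreal_mult ennreal_of_nat_eq_real_of_nat)
  also have "\<dots> \<le> (\<Sum>j\<in>J. epow (a j) r)" using finite by (intro sum_mono epow_mono ge) auto
  also have "\<dots> \<le> (\<Sum>\<^sub>\<infinity>j. epow (a j) r)" using J by (intro sum_le_infsum_ennreal) auto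
  finally have "epow (ennreal (card J * v powr r)) (1 / r) \<le> epow (\<Sum>\<^sub>\<infinity>j. epow (a j) r) (1 / r)"
    using finite by (intro epow_mono) auto
  moreover have "epow (ennreal (card J * v powr r)) (1 / r) = ennreal (real (card J) powr (1 / r) * v)"
    using v finite by (simp add: epow_ennreal powr_mult powr_powr)
  ultimately show ?thesis using finite by (simp add: lnorm_def)
qed

lemma lnorm_le_card:
  assumes q: "0 < q" and J: "finite J" "J \<noteq> {}" and v: "0 \<le> v"
    and le: "\<And>j. j \<in> J \<Longrightarrow> a j \<le> ennreal v" and zero: "\<And>j. j \<notin> J \<Longrightarrow> a j = 0"
  shows "lnorm q a \<le> ennreal (real (card J) powr enn2real (1 / q) * v)"
  using q
proof (cases rule: exponent_cases)
  case infinite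
  have "card J \<noteq> 0" using J by auto
  then have "ennreal (real (card J) powr enn2real (1 / q) * v) = ennreal v" using infinite by simp
  moreover have "a j \<le> ennreal v" for j using le[of j] zero[of j] by (cases "j \<in> J") auto
  then have "(SUP j. a j) \<le> ennreal v" by (intro SUP_least)
  ultimately show ?thesis using infinite by (simp add: lnorm_def)
next
  case (finite r)
  have "(\<Sum>\<^sub>\<infinity>j. epow (a j) r) \<le> (\<Sum>j\<in>J. epow (a j) r)"
    using J zero by (intro infsum_finite_support_ennreal) auto
  also have "\<dots> \<le> (\<Sum>j\<in>J. epow (ennreal v) r)" using finite by (intro sum_mono epow_mono le) auto
  also have "\<dots> = ennreal (card J * v powr r)"
    using v by (simp add: epow_ennreal ennreal_mult ennreal_of_nat_eq_real_of_nat)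
  finally have "epow (\<Sum>\<^sub>\<infinity>j. epow (a j) r) (1 / r) \<le> epow (ennreal (card J * v powr r)) (1 / r)"
    using finite by (intro epow_mono) auto
  moreover have "epow (ennreal (card J * v powr r)) (1 / r) = ennreal (real (card J) powr (1 / r) * v)"
    using v finite by (simp add: epow_ennreal powr_mult powr_powr)
  ultimately show ?thesis using finite by (simp add: lnorm_def)
qed

text \<open>Only the majorant \<open>G\<close> is ever integrated. Monotonicity of the nonnegative
  integral holds for arbitrary functions, so the lemma applies directly to the sums and suprema over
  scales in \<open>TL_norm\<close>.\<close>

lemma Lnorm_le_of_integral:
  assumes r: "r > 0" and I: "I \<ge> 0" and g: "\<And>x. x \<in> space M \<Longrightarrow> g x \<le> ennreal (G x)"
    and int: "(\<integral>\<^sup>+x. ennreal (G x powr r) \<partial>M) \<le> ennreal I" and G: "\<And>x. 0 \<le> G x"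
  shows "Lnorm (ennreal r) M g \<le> ennreal (I powr (1 / r))"
proof -
  have "(\<integral>\<^sup>+x. epow (g x) r \<partial>M) \<le> (\<integral>\<^sup>+x. ennreal (G x powr r) \<partial>M)"
    using r G g by (intro nn_integral_mono) (simp flip: epow_ennreal add: epow_mono)
  then have "(\<integral>\<^sup>+x. epow (g x) r \<partial>M) \<le> ennreal I" using int by (rule order_trans)
  then have "epow (\<integral>\<^sup>+x. epow (g x) r \<partial>M) (1 / r) \<le> epow (ennreal I) (1 / r)"
    using r by (intro epow_mono) auto
  then show ?thesis using r I by (simp add: Lnorm_def epow_ennreal)
qed

text \<open>Chebyshev's inequality, read as a lower bound for the quasi-norm.\<close>

lemma Lnorm_ge_of_measure:
  assumes r: "r > 0" and v: "0 \<le> v" and \<mu>: "0 \<le> \<mu>" and D: "D \<in> sets M" "ennreal \<mu> \<le> emeasure M D"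
    and g: "\<And>x. x \<in> D \<Longrightarrow> ennreal v \<le> g x"
  shows "ennreal (v * \<mu> powr (1 / r)) \<le> Lnorm (ennreal r) M g"
proof -
  have "ennreal (v powr r * \<mu>) \<le> ennreal (v powr r) * emeasure M D"
    using D \<mu> by (simp add: ennreal_mult mult_left_mono)
  also have "\<dots> = (\<integral>\<^sup>+x. ennreal (v powr r) * indicator D x \<partial>M)"
    using D by (simp add: nn_integral_cmult_indicator)
  also have "\<dots> \<le> (\<integral>\<^sup>+x. epow (g x) r \<partial>M)"
    using v g r by (intro nn_integral_mono) (auto simp: indicator_def simp flip: epow_ennreal intro: epow_mono)
  finally have "epow (ennreal (v powr r * \<mu>)) (1 / r) \<le> epow (\<integral>\<^sup>+x. epow (g x) r \<partial>M) (1 / r)"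
    using r by (intro epow_mono) auto
  moreover have "epow (ennreal (v powr r * \<mu>)) (1 / r) = ennreal (v * \<mu> powr (1 / r))"
    using r v \<mu> by (simp add: epow_ennreal powr_mult powr_powr)
  ultimately show ?thesis using r by (simp add: Lnorm_def)
qed

lemma nn_integral_bracket_finite:
  assumes "s \<ge> 2 * real DIM('a)"
  shows "(\<integral>\<^sup>+x. ennreal ((1 + norm (x::'a)) powr (- s)) \<partial>lborel)
    = ennreal (LINT x|lborel. (1 + norm (x::'a::euclidean_space)) powr (- s))"
  using integrable_bracket[OF assms] by (intro nn_integral_eq_integral) auto

section \<open>Dyadic cubes\<close>

lemma emeasure_dyadic_cube:
  "0 < emeasure lborel (dyadic_cube \<nu> n :: 'a::euclidean_space set)"
  "emeasure lborel (dyadic_cube \<nu> n :: 'a::euclidean_space set) < \<infinity>"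
  and sets_dyadic_cube: "(dyadic_cube \<nu> n :: 'a::euclidean_space set) \<in> sets borel"
proof -
  let ?h = "2 powi (- \<nu>) :: real"
  define l :: 'a where "l = (\<Sum>b\<in>Basis. (?h * of_int (n b)) *\<^sub>R b)"
  define u :: 'a where "u = (\<Sum>b\<in>Basis. (?h * (of_int (n b) + 1)) *\<^sub>R b)"
  have lb: "l \<bullet> b = ?h * of_int (n b)" "u \<bullet> b = ?h * (of_int (n b) + 1)" if "b \<in> Basis" for b
    using that by (simp_all add: l_def u_def)
  have lu: "l \<bullet> b < u \<bullet> b" if "b \<in> Basis" for b
    using that lb by (simp add: distrib_left)
  show [measurable]: "(dyadic_cube \<nu> n :: 'a set) \<in> sets borel"
  proof -
    have "(dyadic_cube \<nu> n :: 'a set) = (\<Inter>b\<in>Basis. {x. ?h * of_int (n b) \<le> x \<bullet> b} \<inter> {x. x \<bullet> b < ?h * (of_int (n b) + 1)})"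
      by (auto simp: dyadic_cube_def)
    also have "\<dots> \<in> sets borel" by (intro sets.countable_INT') (auto intro: countable_finite)
    finally show ?thesis .
  qed
  have sub: "box l u \<subseteq> (dyadic_cube \<nu> n :: 'a set)" "(dyadic_cube \<nu> n :: 'a set) \<subseteq> cbox l u"
    by (auto simp: dyadic_cube_def box_def cbox_def lb less_imp_le)
  have "0 < emeasure lborel (box l u)"
  proof -
    have "\<forall>b\<in>Basis. l \<bullet> b \<le> u \<bullet> b" using lu by (auto intro: less_imp_le)
    then have "emeasure lborel (box l u) = ennreal (\<Prod>b\<in>Basis. (u - l) \<bullet> b)" by (intro emeasure_lborel_box) auto
    moreover have "0 < (\<Prod>b\<in>Basis. (u - l) \<bullet> b)" using lu by (intro prod_pos) (auto simp: inner_diff_left)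
    ultimately show ?thesis by simp
  qed
  also have "\<dots> \<le> emeasure lborel (dyadic_cube \<nu> n :: 'a set)" using sub by (intro emeasure_mono) auto
  finally show "0 < emeasure lborel (dyadic_cube \<nu> n :: 'a set)" .
  have "emeasure lborel (dyadic_cube \<nu> n :: 'a set) \<le> emeasure lborel (cbox l u)" using sub by (intro emeasure_mono) auto
  also have "\<dots> < \<infinity>" by (rule emeasure_bounded_finite[OF bounded_cbox])
  finally show "emeasure lborel (dyadic_cube \<nu> n :: 'a set) < \<infinity>" .
qed

text \<open>The sets on which pieces are large are taken to be dyadic cubes, so that the same set
  can be used for finite \<open>p\<close> and for the cube averages at
  \<open>p = \<infinity>\<close>. The side length is small compared with
  \<open>\<delta> / DIM('a)\<close> because the norm is estimated by the sum of the
  coordinates.\<close>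

lemma dyadic_cube_in_ball:
  fixes x :: "'a::euclidean_space"
  assumes \<delta>: "\<delta> > 0"
  obtains \<nu> n where "0 \<le> \<nu>" "x \<in> dyadic_cube \<nu> n" "dyadic_cube \<nu> n \<subseteq> ball x \<delta>"
proof -
  obtain k :: nat where k: "real DIM('a) / \<delta> < 2 ^ k" using real_arch_pow[of 2] by auto
  define h :: real where "h = 2 powi (- int k)"
  have h: "h > 0" "DIM('a) * h < \<delta>"
    using k \<delta> by (auto simp: h_def power_int_minus field_simps)
  define n :: "'a \<Rightarrow> int" where "n b = \<lfloor>(x \<bullet> b) / h\<rfloor>" for b
  have n: "h * of_int (n b) \<le> x \<bullet> b" "x \<bullet> b < h * (of_int (n b) + 1)" for b
  proof -
    have "of_int (n b) \<le> (x \<bullet> b) / h" "(x \<bullet> b) / h < of_int (n b) + 1"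
      unfolding n_def using floor_correct[of "(x \<bullet> b) / h"] by auto
    then show "h * of_int (n b) \<le> x \<bullet> b" "x \<bullet> b < h * (of_int (n b) + 1)"
      using h(1) by (simp_all only: pos_le_divide_eq pos_divide_less_eq mult.commute[of h])
  qed
  have "norm (x - y) < \<delta>" if y: "y \<in> dyadic_cube (int k) n" for y
  proof -
    have "norm (x - y) \<le> (\<Sum>b\<in>Basis. \<bar>(x - y) \<bullet> b\<bar>)" by (rule norm_le_l1)
    also have "\<dots> \<le> (\<Sum>b\<in>(Basis::'a set). h)"
    proof (rule sum_mono)
      fix b :: 'a assume "b \<in> Basis"
      then have "h * of_int (n b) \<le> y \<bullet> b" "y \<bullet> b < h * (of_int (n b) + 1)"
        using y by (auto simp: dyadic_cube_def h_def)
      then show "\<bar>(x - y) \<bullet> b\<bar> \<le> h" using n[of b] by (simp add: inner_diff_left distrib_left)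
    qed
    also have "\<dots> < \<delta>" using h by simp
    finally show ?thesis .
  qed
  then have "dyadic_cube (int k) n \<subseteq> ball x \<delta>" by (auto simp: dist_norm)
  moreover have "x \<in> dyadic_cube (int k) n" using n by (simp add: dyadic_cube_def h_def)
  ultimately show ?thesis using that[of "int k" n] by simp
qed

section \<open>A Herz norm estimate for translates\<close>

lemma annulus_subset_cball: "(annulus l :: 'a::euclidean_space set) \<subseteq> cball 0 (2 ^ (l + 1))"
  by (auto simp: annulus_def)

lemma sets_annulus: "(annulus l :: 'a::euclidean_space set) \<in> sets borel"
  unfolding annulus_def by (cases "l = 0") auto

lemma emeasure_annulus_le: "emeasure lborel (annulus l :: 'a::euclidean_space set) \<le> ennreal (2 powr (real DIM('a) * (l + 2)))"
proof -
  let ?s = "2 ^ (l + 1) :: real"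
  have "(annulus l :: 'a set) \<subseteq> cbox (- (?s *\<^sub>R One)) (?s *\<^sub>R One)"
  proof
    fix x :: 'a assume "x \<in> annulus l"
    then have "x \<in> cball 0 ?s" using annulus_subset_cball by blast
    then have "norm x \<le> ?s" by simp
    then have "\<bar>x \<bullet> b\<bar> \<le> ?s" if "b \<in> Basis" for b
      using Basis_le_norm[OF that, of x] by linarith
    then show "x \<in> cbox (- (?s *\<^sub>R One)) (?s *\<^sub>R One)"
      by (auto simp: mem_box abs_le_iff) (metis minus_le_iff)
  qed
  then have "emeasure lborel (annulus l :: 'a set) \<le> emeasure lborel (cbox (- (?s *\<^sub>R One)) (?s *\<^sub>R One) :: 'a set)"
    by (intro emeasure_mono) auto
  also have "\<dots> = ennreal ((2 * ?s) ^ DIM('a))"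
  proof -
    have "(\<Prod>b\<in>Basis. (?s *\<^sub>R One - - (?s *\<^sub>R One)) \<bullet> (b::'a)) = (\<Prod>b\<in>(Basis::'a set). 2 * ?s)"
      by (intro prod.cong refl) (simp add: inner_add_left)
    then show ?thesis by (subst emeasure_lborel_cbox) auto
  qed
  also have "(2 * ?s) ^ DIM('a) = (2 ^ (l + 2)) ^ DIM('a)" by simp
  also have "\<dots> = 2 ^ (DIM('a) * (l + 2))" by (simp only: power_mult[symmetric] mult.commute)
  also have "\<dots> = 2 powr real (DIM('a) * (l + 2))" by (rule powr_realpow[symmetric]) simp
  also have "real (DIM('a) * (l + 2)) = real DIM('a) * (l + 2)" by (simp add: algebra_simps)
  finally show ?thesis .
qed

text \<open>The sphere of radius \<open>2 ^ l0\<close> is the common boundary of the annuli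
  \<open>l0 - 1\<close> and \<open>l0\<close>, so these two are excluded;
  \<open>Suc l \<noteq> l0\<close> avoids truncated subtraction at \<open>l0 = 0\<close>.\<close>

lemma far_from_translate:
  fixes x z :: "'a::euclidean_space"
  assumes z: "norm z = 2 ^ l0" and x: "x \<in> annulus l" and l: "l \<noteq> 0" "l \<noteq> l0" "Suc l \<noteq> l0"
  shows "2 ^ l \<le> 2 * norm (x - z)"
proof -
  have x': "2 ^ l < norm x" "norm x \<le> 2 * 2 ^ l" using x l(1) by (auto simp: annulus_def)
  have "norm x \<le> norm (x - z) + norm z" "norm z \<le> norm (x - z) + norm x"
    using norm_triangle_ineq[of "x - z" z] norm_triangle_ineq4[of x "x - z"] by auto
  show ?thesis
  proof (cases "l0 < l")
    case True
    then have "(2::real) ^ Suc l0 \<le> 2 ^ l" by (intro power_increasing) auto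
    then show ?thesis using x' z \<open>norm x \<le> norm (x - z) + norm z\<close> by simp
  next
    case False
    then have "(2::real) ^ Suc (Suc l) \<le> 2 ^ l0" using l by (intro power_increasing) auto
    then show ?thesis using x' z \<open>norm z \<le> norm (x - z) + norm x\<close> by simp
  qed
qed

text \<open>The point is the uniformity in the position \<open>l0\<close> of the peaks. The powers
  are bounded term by term, which is valid for \<open>t\<close> below 1 as well: a peak contributes
  at most \<open>(2 * K) powr r\<close>, and the rest is a geometric series of ratio
  \<open>(1/2) powr r\<close>.\<close>

lemma lnorm_two_peaks:
  fixes t :: ennreal
  assumes t: "0 < t" and K: "K \<ge> 0"
  shows "\<exists>B. \<forall>a l0. (\<forall>l. a l \<le> ennreal (K * ((1/2) ^ l + (if l = l0 \<or> Suc l = l0 then 1 else 0))))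
     \<longrightarrow> lnorm t a \<le> ennreal B"
  using t
proof (cases rule: exponent_cases)
  case infinite
  have "lnorm t a \<le> ennreal (2 * K)"
    if a: "\<And>l. a l \<le> ennreal (K * ((1/2) ^ l + (if l = l0 \<or> Suc l = l0 then 1 else 0)))" for a l0
  proof -
    have "a l \<le> ennreal (2 * K)" for l
    proof -
      have "(1/2 :: real) ^ l \<le> 1" by (intro power_le_one) auto
      then have "K * ((1/2) ^ l + (if l = l0 \<or> Suc l = l0 then 1 else 0)) \<le> K * 2" using K by (intro mult_left_mono) auto
      then show ?thesis using a[of l] by (simp add: mult.commute order_trans ennreal_leI)
    qed
    then show ?thesis using infinite by (simp add: lnorm_def SUP_least)
  qed
  then show ?thesis by blast
next
  case (finite r)
  define \<rho> :: real where "\<rho> = (1/2) powr r"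
  have "\<rho> < (1/2) powr 0" unfolding \<rho>_def using finite by (intro powr_less_mono') auto
  then have \<rho>: "0 \<le> \<rho>" "\<rho> < 1" by (auto simp: \<rho>_def)
  let ?S = "(2 * K) powr r * ((\<Sum>l. \<rho> ^ l) + 2)"
  have "lnorm t a \<le> ennreal (?S powr (1 / r))"
    if a: "\<And>l. a l \<le> ennreal (K * ((1/2) ^ l + (if l = l0 \<or> Suc l = l0 then 1 else 0)))" for a l0
  proof -
    let ?i = "\<lambda>l. (if l = l0 \<or> Suc l = l0 then 1 else 0 :: real)"
    have le: "epow (a l) r \<le> ennreal ((2 * K) powr r * (\<rho> ^ l + ?i l))" for l
    proof -
      have *: "(K * ((1/2) ^ l + ?i l)) powr r \<le> (2 * K) powr r * (\<rho> ^ l + ?i l)"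
      proof (cases "l = l0 \<or> Suc l = l0")
        case True
        have "(1/2 :: real) ^ l \<le> 1" by (intro power_le_one) auto
        then have "K * ((1/2) ^ l + 1) \<le> 2 * K" using K mult_left_mono[of "(1/2)^l" 1 K] by (simp add: algebra_simps)
        then have "(K * ((1/2) ^ l + 1)) powr r \<le> (2 * K) powr r" using K finite by (intro powr_mono2) auto
        also have "\<dots> \<le> (2 * K) powr r * (\<rho> ^ l + 1)" using \<rho> by (simp add: distrib_left)
        finally show ?thesis using True by simp
      next
        case False
        have "((1/2 :: real) ^ l) powr r = \<rho> ^ l"
          by (simp add: \<rho>_def powr_power flip: powr_realpow) (simp add: powr_powr mult.commute)
        then have "(K * (1/2) ^ l) powr r = K powr r * \<rho> ^ l" using K by (simp add: powr_mult)
        also have "\<dots> \<le> (2 * K) powr r * \<rho> ^ l" using K finite \<rho> by (intro mult_right_mono powr_mono2) auto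
        finally show ?thesis using False by simp
      qed
      have "epow (a l) r \<le> epow (ennreal (K * ((1/2) ^ l + ?i l))) r" using a finite by (intro epow_mono) auto
      also have "\<dots> = ennreal ((K * ((1/2) ^ l + ?i l)) powr r)" using K by (intro epow_ennreal) auto
      also have "\<dots> \<le> ennreal ((2 * K) powr r * (\<rho> ^ l + ?i l))" by (rule ennreal_leI[OF *])
      finally show ?thesis .
    qed
    have "(\<Sum>\<^sub>\<infinity>l. epow (a l) r) \<le> ennreal ?S"
    proof (rule infsum_le_ennreal)
      fix F :: "nat set" assume F: "finite F"
      have "(\<Sum>l\<in>F. epow (a l) r) \<le> (\<Sum>l\<in>F. ennreal ((2 * K) powr r * (\<rho> ^ l + ?i l)))"
        by (intro sum_mono le)
      also have "\<dots> = ennreal (\<Sum>l\<in>F. (2 * K) powr r * (\<rho> ^ l + ?i l))"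
        using \<rho> by (intro sum_ennreal) auto
      also have "(\<Sum>l\<in>F. (2 * K) powr r * (\<rho> ^ l + ?i l)) = (2 * K) powr r * ((\<Sum>l\<in>F. \<rho> ^ l) + (\<Sum>l\<in>F. ?i l))"
        by (simp add: sum_distrib_left[symmetric] sum.distrib)
      also have "\<dots> \<le> ?S"
      proof (intro mult_left_mono add_mono)
        show "(\<Sum>l\<in>F. \<rho> ^ l) \<le> (\<Sum>l. \<rho> ^ l)"
          using \<rho> F by (intro sum_le_suminf summable_geometric) auto
        have "(\<Sum>l\<in>F. ?i l) = (\<Sum>l\<in>F \<inter> {l0, l0 - 1}. ?i l)"
          using F by (intro sum.mono_neutral_right) auto
        also have "\<dots> \<le> (\<Sum>l\<in>F \<inter> {l0, l0 - 1}. 1)" by (intro sum_mono) auto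
        also have "\<dots> = card (F \<inter> {l0, l0 - 1})" by simp
        also have "\<dots> \<le> card {l0, l0 - 1}" by (intro of_nat_mono card_mono) auto
        also have "\<dots> \<le> 2" by (auto simp: card_insert_if)
        finally show "(\<Sum>l\<in>F. ?i l) \<le> 2" .
      qed auto
      finally show "(\<Sum>l\<in>F. epow (a l) r) \<le> ennreal ?S" by (simp add: ennreal_leI)
    qed
    then have "epow (\<Sum>\<^sub>\<infinity>l. epow (a l) r) (1 / r) \<le> epow (ennreal ?S) (1 / r)"
      using finite by (intro epow_mono) auto
    also have "epow (ennreal ?S) (1 / r) = ennreal (?S powr (1 / r))"
      using \<rho> by (intro epow_ennreal mult_nonneg_nonneg add_nonneg_nonneg suminf_nonneg summable_geometric) auto
    finally show ?thesis using finite by (simp add: lnorm_def)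
  qed
  then show ?thesis by blast
qed

text \<open>The translate is concentrated in the two annuli next to \<open>norm z = 2 ^ l0\<close>, where the
  factor \<open>a\<close> compensates the weight; elsewhere the decay of \<open>F\<close> dominates.\<close>

lemma herz_norm_translate_bounded:
  fixes t :: ennreal and w :: "nat \<Rightarrow> real"
  assumes t: "0 < t" and r: "0 < r" and M: "real M \<ge> 2 * (real DIM('a) / r) + 2"
    and C: "C > 0" and w: "\<And>l. 0 \<le> w l" "mono w" "\<And>l. w l \<le> W * 2 ^ l"
  shows "\<exists>B. \<forall>(F::'a::euclidean_space \<Rightarrow> complex) a z l0.
     (\<forall>x. norm (F x) \<le> C / (1 + norm x) ^ M) \<longrightarrow> norm z = 2 ^ l0 \<longrightarrow> 0 \<le> a \<longrightarrow> a \<le> 1 \<longrightarrow> a * w l0 \<le> 1 \<longrightarrow>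
     herz_norm (ennreal r) t w (\<lambda>x. of_real a * F (x - z)) \<le> ennreal B"
proof -
  let ?d = "real DIM('a)"
  define I where "I = (LINT x|lborel. (1 + norm (x::'a)) powr (- (M * r)))"
  \<comment> \<open>\<open>K1\<close> bounds the quasi-norm over the whole space and serves the peak
    annuli and the central ball, where \<open>w 0 \<le> W\<close>; \<open>K2\<close> collects the
    constants of the far annuli.\<close>
  define K1 where "K1 = C * I powr (1 / r)"
  define K2 where "K2 = C * 2 powr (2 * ?d / r + M) * W"
  define K where "K = max (K1 * (1 + W)) K2"
  have W: "W \<ge> 0" using w(1)[of 0] w(3)[of 0] by simp
  have K1: "K1 \<ge> 0" using C by (simp add: K1_def)
  have "K1 * (1 + W) \<ge> 0" using K1 W by simp
  then have K: "K \<ge> 0" "K1 \<le> K" "K1 * W \<le> K" "K2 \<le> K"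
    using K1 W by (auto simp: K_def distrib_left le_max_iff_disj)
  have Mr: "M * r \<ge> 2 * ?d"
  proof -
    have "2 * ?d = 2 * (?d / r) * r" using r by simp
    also have "\<dots> \<le> M * r" using M r by (intro mult_right_mono) auto
    finally show ?thesis .
  qed
  have main: "Lnorm (ennreal r) (restrict_space lborel (annulus l)) (\<lambda>x. ennreal (norm (of_real a * F (x - z)))) * ennreal (w l)
      \<le> ennreal (K * ((1/2) ^ l + (if l = l0 \<or> Suc l = l0 then 1 else 0)))"
    if F: "\<And>x. norm (F x) \<le> C / (1 + norm x) ^ M" and z: "norm z = 2 ^ l0" and a: "0 \<le> a" "a \<le> 1" "a * w l0 \<le> 1"
    for F :: "'a \<Rightarrow> complex" and a z l0 l
  proof -
    let ?R = "restrict_space lborel (annulus l :: 'a set)"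
    let ?L = "Lnorm (ennreal r) ?R (\<lambda>x. ennreal (norm (of_real a * F (x - z))))"
    let ?i = "(if l = l0 \<or> Suc l = l0 then 1 else 0) :: real"
    let ?E = "- real M * (real l - 1) + ?d / r * (real l + 2)"
    have ann: "(annulus l :: 'a set) \<inter> space lborel \<in> sets lborel" using sets_annulus by simp
    have F': "norm (of_real a * F (x - z)) \<le> a * C * (1 + norm (x - z)) powr (- real M)" for x
    proof -
      have "a * norm (F (x - z)) \<le> a * (C / (1 + norm (x - z)) ^ M)" using F a(1) by (intro mult_left_mono) auto
      then show ?thesis using a(1) by (simp add: norm_mult bracket_power)
    qed
    have all: "?L \<le> ennreal (a * K1)"
    proof -
      have "?L \<le> ennreal (((a * C) powr r * I) powr (1 / r))"
      proof (rule Lnorm_le_of_integral[OF r])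
        show "0 \<le> (a * C) powr r * I" by (simp add: I_def)
        show "ennreal (norm (of_real a * F (x - z))) \<le> ennreal (a * C * (1 + norm (x - z)) powr (- real M))" for x
          by (rule ennreal_leI[OF F'])
        have "(\<integral>\<^sup>+x. ennreal ((a * C * (1 + norm (x - z)) powr (- real M)) powr r) \<partial>?R)
            \<le> (\<integral>\<^sup>+x. ennreal ((a * C * (1 + norm (x - z)) powr (- real M)) powr r) \<partial>lborel)"
          by (subst nn_integral_restrict_space[OF ann], rule nn_integral_mono) (auto simp: indicator_def)
        also have "\<dots> = (\<integral>\<^sup>+x. ennreal ((a * C) powr r) * ennreal ((1 + norm (x - z)) powr (- (M * r))) \<partial>lborel)"
          using a C by (intro nn_integral_cong) (simp add: powr_mult powr_powr ennreal_mult)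
        also have "\<dots> = ennreal ((a * C) powr r) * (\<integral>\<^sup>+x. ennreal ((1 + norm (x - z)) powr (- (M * r))) \<partial>lborel)"
          by (rule nn_integral_cmult) measurable
        also have "(\<integral>\<^sup>+x. ennreal ((1 + norm (x - z)) powr (- (M * r))) \<partial>lborel)
            = (\<integral>\<^sup>+x. ennreal ((1 + norm (x::'a)) powr (- (M * r))) \<partial>lborel)"
          by (subst nn_integral_lborel_affine[where c=1 and t=z]) auto
        also have "\<dots> = ennreal I" unfolding I_def by (rule nn_integral_bracket_finite[OF Mr])
        finally show "(\<integral>\<^sup>+x. ennreal ((a * C * (1 + norm (x - z)) powr (- real M)) powr r) \<partial>?R) \<le> ennreal ((a * C) powr r * I)"
          by (simp add: ennreal_mult I_def)
      qed (use a C in auto)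
      also have "((a * C) powr r * I) powr (1 / r) = a * K1"
        using a C r by (simp add: powr_mult powr_powr K1_def I_def)
      finally show ?thesis .
    qed
    show ?thesis
    proof (cases "l = 0 \<or> l = l0 \<or> Suc l = l0")
      case True
      \<comment> \<open>In a peak annulus \<open>w l \<le> w l0\<close> by monotonicity, so
        \<open>a * w l0 \<le> 1\<close> absorbs the weight; in the central ball the summand
        \<open>(1/2) ^ 0\<close> does.\<close>
      have "K1 * (a * w l) \<le> K * ((1/2) ^ l + ?i)"
      proof (cases "l = l0 \<or> Suc l = l0")
        case True
        then have "w l \<le> w l0" using w(2) by (auto simp: mono_def)
        then have "a * w l \<le> 1" using a mult_left_mono[of "w l" "w l0" a] by simp
        then have "K1 * (a * w l) \<le> K1 * 1" using K1 by (intro mult_left_mono)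
        also have "\<dots> \<le> K * ((1/2) ^ l + 1)" using K by (simp add: distrib_left add_increasing)
        finally show ?thesis using True by simp
      next
        case False
        then have l: "l = 0" using \<open>l = 0 \<or> l = l0 \<or> Suc l = l0\<close> by simp
        have "a * w l \<le> 1 * W" using a w(1)[of 0] w(3)[of 0] unfolding l by (intro mult_mono) auto
        then have "K1 * (a * w l) \<le> K1 * W" using K1 by (intro mult_left_mono) auto
        then show ?thesis using K(3) False l by simp
      qed
      then have "ennreal (a * K1) * ennreal (w l) \<le> ennreal (K * ((1/2) ^ l + ?i))"
        using a K1 w(1) by (simp add: ennreal_mult[symmetric] ennreal_leI mult_ac)
      then show ?thesis using mult_right_mono[OF all, of "ennreal (w l)"] by (meson order_trans zero_le)
    next
      case False
      \<comment> \<open>The supremum bound from the distance \<open>2 powr (real l - 1)\<close> to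
        the centre of the translate, with \<open>a\<close> estimated by 1.\<close>
      let ?v = "C * 2 powr (- real M * (real l - 1))"
      have "?L \<le> ennreal ((?v powr r * 2 powr (?d * (real l + 2))) powr (1 / r))"
      proof (rule Lnorm_le_of_integral[OF r])
        show "ennreal (norm (of_real a * F (x - z))) \<le> ennreal ?v" if "x \<in> space ?R" for x
        proof (rule ennreal_leI)
          have "x \<in> annulus l" using that by (simp add: space_restrict_space)
          then have "2 ^ l \<le> 2 * norm (x - z)" using far_from_translate[OF z] False by auto
          then have "2 powr (real l - 1) \<le> 1 + norm (x - z)" by (simp add: powr_diff powr_realpow)
          then have "(1 + norm (x - z)) powr (- real M) \<le> (2 powr (real l - 1)) powr (- real M)"
            by (intro powr_mono2') auto
          then have "a * C * (1 + norm (x - z)) powr (- real M) \<le> 1 * C * (2 powr (real l - 1)) powr (- real M)"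
            using a C by (intro mult_mono) auto
          then show "norm (of_real a * F (x - z)) \<le> ?v" using F'[of x] by (simp add: powr_powr mult.commute)
        qed
        have "(\<integral>\<^sup>+x. ennreal (?v powr r) \<partial>?R) = ennreal (?v powr r) * emeasure lborel (annulus l :: 'a set)"
          using ann by (simp add: emeasure_restrict_space space_restrict_space)
        also have "\<dots> \<le> ennreal (?v powr r) * ennreal (2 powr (?d * (real l + 2)))"
          using emeasure_annulus_le[of l, where 'a='a] by (intro mult_left_mono) (auto simp: add.commute)
        finally show "(\<integral>\<^sup>+x. ennreal (?v powr r) \<partial>?R) \<le> ennreal (?v powr r * 2 powr (?d * (real l + 2)))"
          by (simp add: ennreal_mult)
      qed (use C in auto)
      also have "(?v powr r * 2 powr (?d * (real l + 2))) powr (1 / r) = C * 2 powr (?E)"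
        using C r by (simp add: powr_mult powr_powr powr_add[symmetric])
      finally have "?L * ennreal (w l)
          \<le> ennreal (C * 2 powr (?E)) * ennreal (w l)"
        by (rule mult_right_mono) simp
      also have "\<dots> = ennreal (C * 2 powr (?E) * w l)"
        using C w(1) by (simp add: ennreal_mult)
      also have "\<dots> \<le> ennreal (K * (1/2) ^ l)"
      proof (rule ennreal_leI)
        \<comment> \<open>Each step of \<open>l\<close> gains \<open>M\<close> binary orders from
          the decay and loses \<open>?d / r\<close> to the volume and 1 to the weight. The choice of
          \<open>M\<close> leaves a gain of at least 1, that is, the factor
          \<open>(1/2) ^ l\<close>.\<close>
        have "?d / r \<ge> 0" using r by simp
        then have "real l * (2 * (?d / r) + 2) \<ge> real l * (?d / r + 2)" by (intro mult_left_mono) auto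
        moreover have "real l * (2 * (?d / r) + 2) \<le> real l * M" using M by (intro mult_left_mono) auto
        ultimately have "?E \<le> (2 * ?d / r + M) - 2 * real l"
          by (simp add: algebra_simps)
        then have "2 powr (?E) \<le> 2 powr ((2 * ?d / r + M) - 2 * real l)"
          by (intro powr_mono) auto
        then have "C * 2 powr (?E) * w l
            \<le> C * 2 powr ((2 * ?d / r + M) - 2 * real l) * (W * 2 ^ l)"
          using C w by (intro mult_mono) auto
        also have "\<dots> = K2 * (2 powr (- 2 * real l) * 2 ^ l)"
          by (simp add: K2_def powr_diff powr_minus divide_inverse mult_ac)
        also have "2 powr (- 2 * real l) * 2 ^ l = (1/2 :: real) ^ l"
          by (simp add: powr_minus powr_realpow[symmetric] powr_powr powr_add[symmetric] power_one_over divide_simps)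
        also have "K2 * (1/2) ^ l \<le> K * (1/2) ^ l" using K by (intro mult_right_mono) auto
        finally show "C * 2 powr (?E) * w l \<le> K * (1/2) ^ l" .
      qed
      finally show ?thesis using False by simp
    qed
  qed
  obtain B where B: "\<And>a l0. (\<forall>l. a l \<le> ennreal (K * ((1/2) ^ l + (if l = l0 \<or> Suc l = l0 then 1 else 0)))) \<Longrightarrow> lnorm t a \<le> ennreal B"
    using lnorm_two_peaks[OF t K(1)] by blast
  show ?thesis
    unfolding herz_norm_def by (intro exI[of _ B] allI impI B[rule_format] main) auto
qed

section \<open>The multiplier\<close>

locale lp_multiplier = lp_packets \<psi> e for \<psi> :: "'a::euclidean_space \<Rightarrow> complex" and e :: 'a +
  fixes \<phi> :: "'a \<Rightarrow> real" and a :: "nat \<Rightarrow> real"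
  assumes cutoff: "is_cutoff \<phi>" and a_nonneg: "\<And>n. 0 \<le> a n" and a_le_1: "\<And>n. a n \<le> 1"
    and a_antimono: "\<And>m n. m \<le> n \<Longrightarrow> a n \<le> a m"
begin

definition shift :: "nat \<Rightarrow> 'a" where
  "shift n = 2 ^ n *\<^sub>R e"

definition bump :: "nat \<Rightarrow> 'a \<Rightarrow> real" where
  "bump n \<xi> = \<phi> ((2 powi (- int (freq n))) *\<^sub>R \<xi>)"

text \<open>At each point at most one term of the series is nonzero, by \<open>bump_unique\<close>,
  so the infinite sum is a genuine value and not a default.\<close>

definition symbol :: "'a \<Rightarrow> complex" where
  "symbol \<xi> = (\<Sum>n. of_real (a n * bump n \<xi>) * wave (- shift n) \<xi>)"

definition packets :: "nat set \<Rightarrow> (nat \<Rightarrow> 'a) \<Rightarrow> 'a \<Rightarrow> complex" where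
  "packets A y x = (\<Sum>n\<in>A. packet n (y n) x)"

section \<open>The symbol and its action on packets\<close>

lemma cutoff_bounds: "0 \<le> \<phi> \<xi>" "\<phi> \<xi> \<le> 1"
  and cutoff_eq_1: "1/2 \<le> norm \<xi> \<Longrightarrow> norm \<xi> \<le> 2 \<Longrightarrow> \<phi> \<xi> = 1"
  and cutoff_smooth: "smooth \<phi>"
  using cutoff by (auto simp: is_cutoff_def)

lemma cutoff_support: "\<phi> \<xi> \<noteq> 0 \<Longrightarrow> 1/4 \<le> norm \<xi> \<and> norm \<xi> \<le> 4"
  using cutoff closure_subset[of "{\<xi>. \<phi> \<xi> \<noteq> 0}"] unfolding is_cutoff_def fsupp_def by blast

text \<open>The outer and inner radii of the support of \<open>\<phi>\<close> have ratio
  \<open>16 = 2 ^ 4\<close>.\<close>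

lemma cutoff_overlap:
  assumes "\<phi> ((2 powi i) *\<^sub>R \<xi>) \<noteq> 0" and "\<phi> ((2 powi j) *\<^sub>R \<xi>) \<noteq> 0"
  shows "\<bar>i - j\<bar> \<le> 4"
proof -
  have *: "i \<le> j + 4" if "\<phi> ((2 powi i) *\<^sub>R \<xi>) \<noteq> 0" "\<phi> ((2 powi j) *\<^sub>R \<xi>) \<noteq> 0" for i j
  proof (rule ccontr)
    assume "\<not> ?thesis"
    then have "(2::real) powi (j + 4) < 2 powi i" by (intro power_int_strict_increasing) auto
    then have lt: "16 * 2 powi j < (2::real) powi i" by (simp add: power_int_add)
    have b: "1/4 \<le> 2 powi j * norm \<xi>" "2 powi i * norm \<xi> \<le> 4"
      using cutoff_support[OF that(1)] cutoff_support[OF that(2)] by simp_all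
    then have "norm \<xi> > 0" by (cases "\<xi> = 0") auto
    then have "16 * 2 powi j * norm \<xi> < 2 powi i * norm \<xi>" using lt by (intro mult_strict_right_mono)
    then show False using b by linarith
  qed
  show ?thesis using *[OF assms] *[OF assms(2,1)] by linarith
qed

lemma bump_unique: "bump m \<xi> \<noteq> 0 \<Longrightarrow> bump n \<xi> \<noteq> 0 \<Longrightarrow> m = n"
  unfolding bump_def by (drule (1) cutoff_overlap) (auto simp: freq_def)

lemma symbol_eq:
  assumes "\<And>m. m \<noteq> n \<Longrightarrow> bump m \<xi> = 0"
  shows "symbol \<xi> = of_real (a n * bump n \<xi>) * wave (- shift n) \<xi>"
  unfolding symbol_def using assms by (subst suminf_finite[of "{n}"]) auto

lemma symbol_cases:
  obtains n where "symbol \<xi> = of_real (a n * bump n \<xi>) * wave (- shift n) \<xi>"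
proof (cases "\<exists>n. bump n \<xi> \<noteq> 0")
  case True
  then show ?thesis using that symbol_eq bump_unique by metis
next
  case False
  then show ?thesis using that[of 0] symbol_eq[of 0 \<xi>] by blast
qed

lemma norm_symbol_le: "norm (symbol \<xi>) \<le> 1"
proof -
  obtain n where "symbol \<xi> = of_real (a n * bump n \<xi>) * wave (- shift n) \<xi>" by (rule symbol_cases)
  then have "norm (symbol \<xi>) = a n * bump n \<xi>"
    using a_nonneg cutoff_bounds by (simp add: norm_mult bump_def)
  also have "\<dots> \<le> 1 * 1" using a_nonneg a_le_1 cutoff_bounds by (intro mult_mono) (auto simp: bump_def)
  finally show ?thesis by simp
qed

lemma borel_measurable_symbol: "symbol \<in> borel_measurable borel"
proof -
  have [measurable]: "\<phi> \<in> borel_measurable borel"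
    by (intro borel_measurable_continuous_onI smooth_continuous_on cutoff_smooth)
  show ?thesis unfolding symbol_def[abs_def] bump_def by measurable
qed

lemma symbol_L_infty: "symbol \<in> L_infty"
proof -
  have [measurable]: "symbol \<in> borel_measurable borel" by (rule borel_measurable_symbol)
  have "esssup lborel (\<lambda>x. ennreal (norm (symbol x))) \<le> 1"
    by (intro esssup_I) (auto simp: norm_symbol_le)
  then show ?thesis by (simp add: L_infty_def Lnorm_def order_le_less_trans)
qed

text \<open>The bump of piece \<open>n\<close> equals 1 on the whole spectrum of packet
  \<open>n\<close>, and the other bumps vanish there. On packets the operator is thus exactly a
  translation times \<open>a n\<close>, without error terms.\<close>

lemma symbol_mult_fourier_packet:
  "symbol \<xi> * fourier (packet n y) \<xi> = of_real (a n) * (wave (- shift n) \<xi> * fourier (packet n y) \<xi>)"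
proof (cases "fourier (packet n y) \<xi> = 0")
  case False
  then have "2 ^ freq n < 2 * norm \<xi>" "norm \<xi> < 2 * 2 ^ freq n" by (rule fourier_packet_support)+
  then have "bump n \<xi> = 1"
    unfolding bump_def by (intro cutoff_eq_1) (auto simp: power_int_minus field_simps)
  moreover then have "symbol \<xi> = of_real (a n * bump n \<xi>) * wave (- shift n) \<xi>"
    using bump_unique[of _ \<xi> n] by (intro symbol_eq) auto
  ultimately show ?thesis by simp
qed simp

lemma packets_eq_inv_fourier: "packets A y = inv_fourier (\<lambda>\<xi>. \<Sum>n\<in>A. fourier (packet n (y n)) \<xi>)"
  by (rule ext) (simp add: packets_def inv_fourier_sum integrable_fourier_packet inv_fourier_fourier_packet)

lemma fourier_packets: "fourier (packets A y) \<xi> = (\<Sum>n\<in>A. fourier (packet n (y n)) \<xi>)"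
  unfolding packets_def[abs_def] by (intro fourier_sum integrable_schwartz schwartz_packet)

lemma LP_piece_packets: "LP_piece \<psi> j (packets A y) x = (\<Sum>n\<in>A. LP_piece \<psi> j (packet n (y n)) x)"
proof -
  have "LP_piece \<psi> j (packets A y) x
      = inv_fourier (\<lambda>\<xi>. \<Sum>n\<in>A. psi_hat j \<xi> * fourier (packet n (y n)) \<xi>) x"
    unfolding packets_eq_inv_fourier
    by (subst LP_piece_inv_fourier) (auto simp: sum_distrib_left integrable_fourier_packet)
  also have "\<dots> = (\<Sum>n\<in>A. LP_piece \<psi> j (packet n (y n)) x)"
    unfolding LP_piece_packet by (intro inv_fourier_sum integrable_fourier_psi_mult integrable_fourier_packet)
  finally show ?thesis .
qed

text \<open>Everything is kept on the frequency side, where the modulation by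
  \<open>- shift n\<close> commutes with the multiplier of the piece and turns into a translation at
  the end.\<close>

lemma LP_piece_multiplier:
  "LP_piece \<psi> j (multiplier symbol (packets A y)) x
    = (\<Sum>n\<in>A. of_real (a n) * LP_piece \<psi> j (packet n (y n)) (x - shift n))"
proof -
  let ?G = "\<lambda>n \<xi>. of_real (a n) * (wave (- shift n) \<xi> * fourier (packet n (y n)) \<xi>)"
  have int: "integrable lborel (?G n)" for n
    using integrable_mult_wave[OF integrable_fourier_packet, of n "y n" "- shift n"]
    by (simp add: mult.commute)
  have "multiplier symbol (packets A y) = inv_fourier (\<lambda>\<xi>. \<Sum>n\<in>A. ?G n \<xi>)"
    unfolding multiplier_def fourier_packets sum_distrib_left symbol_mult_fourier_packet ..
  then have "LP_piece \<psi> j (multiplier symbol (packets A y)) x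
      = inv_fourier (\<lambda>\<xi>. \<Sum>n\<in>A. psi_hat j \<xi> * ?G n \<xi>) x"
    using int by (simp add: LP_piece_inv_fourier sum_distrib_left)
  also have "\<dots> = (\<Sum>n\<in>A. inv_fourier (\<lambda>\<xi>. psi_hat j \<xi> * ?G n \<xi>) x)"
    by (intro inv_fourier_sum integrable_fourier_psi_mult int)
  also have "\<dots> = (\<Sum>n\<in>A. of_real (a n) * LP_piece \<psi> j (packet n (y n)) (x - shift n))"
  proof (rule sum.cong[OF refl])
    fix n
    have "(\<lambda>\<xi>. psi_hat j \<xi> * ?G n \<xi>)
        = (\<lambda>\<xi>. of_real (a n) * (wave (- shift n) \<xi> * (psi_hat j \<xi> * fourier (packet n (y n)) \<xi>)))"
      by (simp add: mult_ac)
    then show "inv_fourier (\<lambda>\<xi>. psi_hat j \<xi> * ?G n \<xi>) x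
        = of_real (a n) * LP_piece \<psi> j (packet n (y n)) (x - shift n)"
      by (simp only: inv_fourier_cmult inv_fourier_modulate LP_piece_packet)
  qed
  finally show ?thesis .
qed

lemma packets_schwartz_infty: "packets A y \<in> schwartz_infty"
proof (rule schwartz_inftyI)
  show "packets A y \<in> schwartz"
    unfolding packets_def[abs_def] by (intro schwartz_sum schwartz_packet)
  show "(1::real) > 0" by simp
  fix \<xi> :: 'a assume \<xi>: "norm \<xi> < 1"
  have "fourier (packet n (y n)) \<xi> = 0" for n
  proof (rule ccontr)
    assume "fourier (packet n (y n)) \<xi> \<noteq> 0"
    then have "2 ^ freq n < 2 * norm \<xi>" by (rule fourier_packet_support)
    moreover have "(2::real) ^ 10 \<le> 2 ^ freq n" by (intro power_increasing freq_ge) auto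
    ultimately show False using \<xi> by simp
  qed
  then show "fourier (packets A y) \<xi> = 0" by (simp add: fourier_packets)
qed

section \<open>Rescaled pieces of the symbol and their Herz norms\<close>

definition kernel :: "int \<Rightarrow> 'a \<Rightarrow> complex" where
  "kernel i = inv_fourier (\<lambda>\<xi>. of_real (\<phi> ((2 powi i) *\<^sub>R \<xi>)) * of_real (\<phi> \<xi>))"

text \<open>A rescaled piece of the symbol, stripped of its translation and its factor, depends only
  on the offset \<open>i\<close> between the dilate and the piece. Only nine offsets occur, so one
  constant serves for all of them.\<close>

lemma kernel_decay: "\<exists>C>0. \<forall>i\<in>{-4..4}. \<forall>x. norm (kernel i x) \<le> C / (1 + norm x) ^ M"
proof -
  have "\<exists>C>0. \<forall>x. norm (kernel i x) \<le> C / (1 + norm x) ^ M" for i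
    unfolding kernel_def
  proof (rule inv_fourier_decay[where R=4])
    show "smooth (\<lambda>\<xi>. complex_of_real (\<phi> ((2 powi i) *\<^sub>R \<xi>)) * complex_of_real (\<phi> \<xi>))"
      by (intro smooth_mult smooth_of_real smooth_scaleR cutoff_smooth)
    show "complex_of_real (\<phi> ((2 powi i) *\<^sub>R \<xi>)) * complex_of_real (\<phi> \<xi>) = 0" if "4 < norm \<xi>" for \<xi>
      using cutoff_support[of \<xi>] that by auto
  qed
  then obtain C where C: "\<And>i. C i > 0" "\<And>i x. norm (kernel i x) \<le> C i / (1 + norm x) ^ M" by metis
  have "norm (kernel i x) \<le> (\<Sum>i\<in>{-4..4}. C i) / (1 + norm x) ^ M" if "i \<in> {-4..4}" for i x
  proof -
    have "C i \<le> (\<Sum>i\<in>{-4..4}. C i)" using that C(1) by (intro member_le_sum) (auto intro: less_imp_le)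
    then have "C i / (1 + norm x) ^ M \<le> (\<Sum>i\<in>{-4..4}. C i) / (1 + norm x) ^ M"
      by (intro divide_right_mono) auto
    then show ?thesis using C(2)[of i x] by linarith
  qed
  moreover have "(\<Sum>i\<in>{-4..4::int}. C i) > 0" using C(1) by (intro sum_pos) auto
  ultimately show ?thesis by blast
qed

abbreviation rescaled :: "int \<Rightarrow> 'a \<Rightarrow> complex" where
  "rescaled k \<xi> \<equiv> symbol ((2 powi k) *\<^sub>R \<xi>) * of_real (\<phi> \<xi>)"

text \<open>Reduces every dilate to the situation of \<open>herz_norm_translate_bounded\<close>: a
  translate of one of finitely many kernels, with a factor compensating the weight at its
  distance.\<close>

lemma rescaled_symbol:
  assumes w: "\<And>l. 0 \<le> w l" "mono w" and aw: "\<And>n. a n * w (11 * n + 14) \<le> 1"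
  shows "\<exists>i\<in>{-4..4}. \<exists>c z l0. inv_fourier (rescaled k) = (\<lambda>x. of_real c * kernel i (x - z))
     \<and> norm z = 2 ^ l0 \<and> 0 \<le> c \<and> c \<le> 1 \<and> c * w l0 \<le> 1"
proof (cases "\<exists>n. \<bar>k - int (freq n)\<bar> \<le> 4")
  case True
  then obtain n where n: "\<bar>k - int (freq n)\<bar> \<le> 4" by blast
  define i where "i = k - int (freq n)"
  define z where "z = (2 powi k) *\<^sub>R shift n"
  define l0 where "l0 = nat (k + int n)"
  \<comment> \<open>From \<open>\<bar>k - (10 * n + 10)\<bar> \<le> 4\<close>: the sum
    \<open>k + n\<close> is at most \<open>11 * n + 14\<close> and at least 6, so the exponent of
    the rescaled distance is a natural number.\<close>
  have k: "0 \<le> k + int n" "l0 \<le> 11 * n + 14" using n by (auto simp: freq_def l0_def)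
  have bump_scale: "bump m ((2 powi k) *\<^sub>R \<xi>) = \<phi> ((2 powi (k - int (freq m))) *\<^sub>R \<xi>)" for m \<xi>
    by (simp add: bump_def power_int_diff power_int_minus field_simps)
  have "rescaled k \<xi>
      = of_real (a n) * (wave (- z) \<xi> * (of_real (\<phi> ((2 powi i) *\<^sub>R \<xi>)) * of_real (\<phi> \<xi>)))" for \<xi>
  proof (cases "\<phi> \<xi> = 0")
    case False
    have "bump m ((2 powi k) *\<^sub>R \<xi>) = 0" if "m \<noteq> n" for m
    proof (rule ccontr)
      assume "bump m ((2 powi k) *\<^sub>R \<xi>) \<noteq> 0"
      \<comment> \<open>The undilated factor \<open>\<phi> \<xi>\<close> counts as the dilate with
        exponent 0. Both \<open>freq m\<close> and \<open>freq n\<close> would lie within 4 of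
        \<open>k\<close>, although distinct frequencies differ by at least 10.\<close>
      then have "\<bar>k - int (freq m) - 0\<bar> \<le> 4" using False unfolding bump_scale
        by (intro cutoff_overlap[where \<xi>=\<xi>]) auto
      then show False using n that by (auto simp: freq_def)
    qed
    then have "symbol ((2 powi k) *\<^sub>R \<xi>) = of_real (a n * bump n ((2 powi k) *\<^sub>R \<xi>)) * wave (- shift n) ((2 powi k) *\<^sub>R \<xi>)"
      by (rule symbol_eq)
    moreover have "wave (- shift n) ((2 powi k) *\<^sub>R \<xi>) = wave (- z) \<xi>" by (simp add: wave_def z_def)
    ultimately show ?thesis by (simp add: bump_scale i_def)
  qed simp
  then have "inv_fourier (rescaled k) = (\<lambda>x. of_real (a n) * kernel i (x - z))"
    unfolding kernel_def by (simp only: inv_fourier_cmult[abs_def] inv_fourier_modulate[abs_def])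
  moreover have "norm z = 2 ^ l0"
  proof -
    have "norm z = 2 powi k * 2 powi int n" by (simp add: z_def shift_def norm_e)
    also have "\<dots> = 2 powi (k + int n)" by (rule power_int_add[symmetric]) simp
    also have "k + int n = int l0" using k(1) by (simp add: l0_def)
    finally show ?thesis by simp
  qed
  moreover have "a n * w l0 \<le> 1"
  proof -
    have "a n * w l0 \<le> a n * w (11 * n + 14)" using k(2) w(2) a_nonneg by (intro mult_left_mono monoD[OF w(2)])
    then show ?thesis using aw[of n] by simp
  qed
  moreover have "i \<in> {-4..4}" using n by (auto simp: i_def)
  ultimately show ?thesis using a_nonneg a_le_1 by blast
next
  case False
  have "rescaled k \<xi> = 0" for \<xi>
  proof (rule ccontr)
    assume nz: "rescaled k \<xi> \<noteq> 0"
    obtain n where "symbol ((2 powi k) *\<^sub>R \<xi>) = of_real (a n * bump n ((2 powi k) *\<^sub>R \<xi>)) * wave (- shift n) ((2 powi k) *\<^sub>R \<xi>)"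
      by (rule symbol_cases)
    then have "\<phi> ((2 powi (k - int (freq n))) *\<^sub>R \<xi>) \<noteq> 0" "\<phi> ((2 powi 0) *\<^sub>R \<xi>) \<noteq> 0"
      using nz by (auto simp: bump_def power_int_diff power_int_minus field_simps)
    then have "\<bar>k - int (freq n) - 0\<bar> \<le> 4" by (rule cutoff_overlap)
    then show False using False by auto
  qed
  \<comment> \<open>Dummy data for the zero function: the factor 0 and the translation
    \<open>e\<close> of norm \<open>2 ^ 0\<close>.\<close>
  then have "inv_fourier (rescaled k) = (\<lambda>x. of_real 0 * kernel 0 (x - e))"
    unfolding inv_fourier_wave by (intro ext) (simp only: mult_zero_left of_real_0, simp)
  then show ?thesis using norm_e by (intro bexI[of _ 0] exI[of _ "0::real"] exI[of _ e] exI[of _ "0::nat"]) auto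
qed

lemma herz_mult_symbol_finite:
  assumes t: "0 < t" and r: "0 < r" and w: "\<And>l. 0 \<le> w l" "mono w" "\<And>l. w l \<le> W * 2 ^ l"
    and aw: "\<And>n. a n * w (11 * n + 14) \<le> 1"
  shows "herz_mult \<phi> (ennreal r) t w symbol < \<infinity>"
proof -
  obtain M :: nat where M: "2 * (real DIM('a) / r) + 2 \<le> real M" using real_arch_simple by blast
  obtain C where C: "C > 0" "\<And>i x. i \<in> {-4..4} \<Longrightarrow> norm (kernel i x) \<le> C / (1 + norm x) ^ M"
    using kernel_decay by blast
  obtain B where B: "\<And>(F::'a \<Rightarrow> complex) a z l0. (\<And>x. norm (F x) \<le> C / (1 + norm x) ^ M) \<Longrightarrow> norm z = 2 ^ l0 \<Longrightarrow>
      0 \<le> a \<Longrightarrow> a \<le> 1 \<Longrightarrow> a * w l0 \<le> 1 \<Longrightarrow> herz_norm (ennreal r) t w (\<lambda>x. of_real a * F (x - z)) \<le> ennreal B"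
    using herz_norm_translate_bounded[OF t r M C(1) w] by blast
  have "herz_norm (ennreal r) t w (inv_fourier (rescaled k)) \<le> ennreal B" for k
  proof -
    obtain i c z l0 where i: "i \<in> {-4..4}"
      and eq: "inv_fourier (rescaled k) = (\<lambda>x. of_real c * kernel i (x - z))"
      and c: "norm z = 2 ^ l0" "0 \<le> c" "c \<le> 1" "c * w l0 \<le> 1"
      using rescaled_symbol[OF w(1,2) aw, of k] by blast
    show ?thesis unfolding eq by (rule B[OF C(2)[OF i] c])
  qed
  then have "herz_mult \<phi> (ennreal r) t w symbol \<le> ennreal B"
    unfolding herz_mult_def by (intro SUP_least)
  then show ?thesis by (simp add: order_le_less_trans)
qed

end

section \<open>Norms of sums of packets\<close>

lemma inverse_exponent_mono:
  fixes p q :: ennreal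
  assumes p: "0 < p" and pq: "p < q"
  shows "enn2real (1 / q) \<le> enn2real (1 / p)"
  using p
proof (cases rule: exponent_cases)
  case infinite
  then show ?thesis using pq by simp
next
  case p: (finite r)
  have "0 < q" using assms by (rule less_trans)
  then show ?thesis
  proof (cases rule: exponent_cases)
    case infinite
    then show ?thesis by simp
  next
    case (finite r')
    then have "r \<le> r'" using p pq by (simp add: ennreal_less_iff)
    then show ?thesis using p(1,4) finite(4) by (simp add: divide_left_mono)
  qed
qed

context lp_multiplier
begin

abbreviation stacked :: "nat set \<Rightarrow> 'a \<Rightarrow> complex" where
  "stacked A \<equiv> packets A (\<lambda>_. 0)"

text \<open>With this sign the operator, which moves packet \<open>n\<close> by
  \<open>shift n\<close>, gathers all packets at the origin.\<close>

abbreviation spread :: "nat set \<Rightarrow> 'a \<Rightarrow> complex" where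
  "spread A \<equiv> packets A (\<lambda>n. - shift n)"

abbreviation piece :: "int \<Rightarrow> ('a \<Rightarrow> complex) \<Rightarrow> 'a \<Rightarrow> ennreal" where
  "piece j f x \<equiv> ennreal (norm (LP_piece \<psi> j f x))"

section \<open>Quasi-norms of the test functions and of their images\<close>

lemma freq_near_unique:
  "\<bar>j - int (freq m)\<bar> \<le> 1 \<Longrightarrow> \<bar>j - int (freq n)\<bar> \<le> 1 \<Longrightarrow> m = n"
  by (simp add: freq_def)

lemma LP_piece_packets_near:
  assumes "finite A" "n \<in> A" "\<bar>j - int (freq n)\<bar> \<le> 1"
  shows "LP_piece \<psi> j (packets A y) x = LP_piece \<psi> j (packet n (y n)) x"
proof -
  have "LP_piece \<psi> j (packet m (y m)) x = 0" if "m \<noteq> n" for m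
    using freq_near_unique[of j m n] assms(3) that by (intro LP_piece_packet_eq_0) linarith
  then have "(\<Sum>m\<in>A. LP_piece \<psi> j (packet m (y m)) x) = (\<Sum>m\<in>{n}. LP_piece \<psi> j (packet m (y m)) x)"
    using assms by (intro sum.mono_neutral_right) auto
  then show ?thesis by (simp add: LP_piece_packets)
qed

lemma LP_piece_packets_far:
  assumes "\<And>n. n \<in> A \<Longrightarrow> 1 < \<bar>j - int (freq n)\<bar>"
  shows "LP_piece \<psi> j (packets A y) x = 0"
  using assms by (simp add: LP_piece_packets LP_piece_packet_eq_0)

lemma LP_piece_multiplier_at_freq:
  assumes "finite A" "n \<in> A"
  shows "LP_piece \<psi> (int (freq n)) (multiplier symbol (packets A y)) x
    = of_real (a n) * LP_piece \<psi> (int (freq n)) (packet n (y n)) (x - shift n)"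
proof -
  have "LP_piece \<psi> (int (freq n)) (packet m (y m)) (x - shift m) = 0" if "m \<noteq> n" for m
    using that by (intro LP_piece_packet_eq_0) (auto simp: freq_def)
  then have "(\<Sum>m\<in>A. of_real (a m) * LP_piece \<psi> (int (freq n)) (packet m (y m)) (x - shift m))
      = (\<Sum>m\<in>{n}. of_real (a m) * LP_piece \<psi> (int (freq n)) (packet m (y m)) (x - shift m))"
    using assms by (intro sum.mono_neutral_right) auto
  then show ?thesis by (simp add: LP_piece_multiplier)
qed

lemma LP_piece_packets_upper:
  obtains C where "C > 0"
    "\<And>A y j n x. finite A \<Longrightarrow> n \<in> A \<Longrightarrow> \<bar>j - int (freq n)\<bar> \<le> 1 \<Longrightarrow>
      norm (LP_piece \<psi> j (packets A y) x) \<le> C / (1 + norm (x - y n)) ^ M"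
proof -
  obtain C where C: "C > 0" "\<And>j n y x. 0 \<le> j \<Longrightarrow> norm (LP_piece \<psi> j (packet n y) x) \<le> C / (1 + norm (x - y)) ^ M"
    using LP_piece_packet_upper by blast
  show ?thesis
  proof (rule that[OF C(1)])
    fix A y j n x assume A: "finite A" "n \<in> A" "\<bar>j - int (freq n)\<bar> \<le> 1"
    then have "0 \<le> j" using freq_ge[of n] by linarith
    then show "norm (LP_piece \<psi> j (packets A y) x) \<le> C / (1 + norm (x - y n)) ^ M"
      unfolding LP_piece_packets_near[OF A] by (rule C(2))
  qed
qed

text \<open>At most three scales per packet are active, and all active pieces share one decaying
  majorant centred at the origin. So the sequence norm is at most
  \<open>(3 * card A) powr (1/q)\<close> times that majorant, and \<open>M\<close> is large enough
  to make its r-th power integrable.\<close>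

lemma TL_norm_unshifted_le:
  assumes p: "p = ennreal r" "r > 0" and q: "0 < q"
  obtains C where "C > 0" "\<And>A. finite A \<Longrightarrow> A \<noteq> {} \<Longrightarrow>
    TL_norm \<psi> p q (stacked A) \<le> ennreal (C * card A powr enn2real (1 / q))"
proof -
  obtain M :: nat where "2 * real DIM('a) / r \<le> real M" using real_arch_simple by blast
  then have M: "2 * real DIM('a) \<le> M * r" using p by (simp add: field_simps)
  obtain C where C: "C > 0" "\<And>A y j n x. finite A \<Longrightarrow> n \<in> A \<Longrightarrow> \<bar>j - int (freq n)\<bar> \<le> 1 \<Longrightarrow>
      norm (LP_piece \<psi> j (packets A y) x) \<le> C / (1 + norm (x - y n)) ^ M"
    by (rule LP_piece_packets_upper[of M]) blast
  define I where "I = (LINT x|lborel. (1 + norm (x::'a)) powr (- (M * r)))"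
  have I: "0 \<le> I" by (simp add: I_def)
  let ?b = "enn2real (1 / q)"
  have b: "?b \<ge> 0" by simp
  have "TL_norm \<psi> p q (stacked A) \<le> ennreal ((3 powr ?b * C * I powr (1 / r) + 1) * card A powr ?b)"
    if A: "finite A" "A \<noteq> {}" for A
  proof -
    define J where "J = (\<Union>n\<in>A. {int (freq n) - 1..int (freq n) + 1})"
    have J: "finite J" "J \<noteq> {}" using A by (auto simp: J_def)
    have "j \<in> {i - 1..i + 1} \<longleftrightarrow> \<bar>j - i\<bar> \<le> 1" for i j :: int by auto
    then have J_iff: "j \<in> J \<longleftrightarrow> (\<exists>n\<in>A. \<bar>j - int (freq n)\<bar> \<le> 1)" for j
      unfolding J_def UN_iff by blast
    have "card J \<le> (\<Sum>n\<in>A. card {int (freq n) - 1..int (freq n) + 1})" unfolding J_def by (rule card_UN_le[OF A(1)])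
    then have card: "real (card J) \<le> 3 * card A" by simp
    define V where "V = (3 * card A) powr ?b * C"
    have V: "0 \<le> V" using C by (simp add: V_def)
    have "TL_norm \<psi> p q (stacked A) = Lnorm (ennreal r) lborel (\<lambda>x. lnorm q (\<lambda>j. piece j (stacked A) x))"
      using p by (simp add: TL_norm_def)
    also have "\<dots> \<le> ennreal ((V powr r * I) powr (1 / r))"
    proof (rule Lnorm_le_of_integral[OF p(2)])
      show "0 \<le> V powr r * I" using I by simp
      show "0 \<le> V * (1 + norm x) powr (- real M)" for x :: 'a using V by simp
      show "lnorm q (\<lambda>j. piece j (stacked A) x) \<le> ennreal (V * (1 + norm x) powr (- real M))" for x
      proof -
        have "lnorm q (\<lambda>j. piece j (stacked A) x)
            \<le> ennreal (real (card J) powr ?b * (C / (1 + norm x) ^ M))"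
        proof (rule lnorm_le_card[OF q J])
          show "0 \<le> C / (1 + norm x) ^ M" using C by simp
          show "piece j (stacked A) x \<le> ennreal (C / (1 + norm x) ^ M)" if "j \<in> J" for j
            using that C(2)[OF A(1), of _ j "\<lambda>_. 0" x] by (auto simp: J_iff intro: ennreal_leI)
          show "piece j (stacked A) x = 0" if "j \<notin> J" for j
            using that by (subst LP_piece_packets_far) (auto simp: J_iff not_le)
        qed
        also have "\<dots> \<le> ennreal (V * (1 + norm x) powr (- real M))"
        proof (rule ennreal_leI)
          have "real (card J) powr ?b \<le> (3 * card A) powr ?b" using card b by (intro powr_mono2) auto
          then have "real (card J) powr ?b * (C / (1 + norm x) ^ M) \<le> (3 * card A) powr ?b * (C / (1 + norm x) ^ M)"
            using C(1) by (intro mult_right_mono) auto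
          then show "real (card J) powr ?b * (C / (1 + norm x) ^ M) \<le> V * (1 + norm x) powr (- real M)"
            by (simp add: V_def bracket_power)
        qed
        finally show ?thesis .
      qed
      have "(\<integral>\<^sup>+x. ennreal ((V * (1 + norm (x::'a)) powr (- real M)) powr r) \<partial>lborel)
          = (\<integral>\<^sup>+x. ennreal (V powr r) * ennreal ((1 + norm (x::'a)) powr (- (M * r))) \<partial>lborel)"
        using V by (intro nn_integral_cong) (simp add: powr_mult powr_powr ennreal_mult)
      also have "\<dots> = ennreal (V powr r) * (\<integral>\<^sup>+x. ennreal ((1 + norm (x::'a)) powr (- (M * r))) \<partial>lborel)"
        by (rule nn_integral_cmult) measurable
      also have "\<dots> = ennreal (V powr r * I)"
        using nn_integral_bracket_finite[OF M] I by (simp add: I_def ennreal_mult)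
      finally show "(\<integral>\<^sup>+x. ennreal ((V * (1 + norm (x::'a)) powr (- real M)) powr r) \<partial>lborel) \<le> ennreal (V powr r * I)" by simp
    qed
    also have "\<dots> \<le> ennreal ((3 powr ?b * C * I powr (1 / r) + 1) * card A powr ?b)"
    proof (rule ennreal_leI)
      have "(V powr r * I) powr (1 / r) = V * I powr (1 / r)"
        using V I p by (simp add: powr_mult powr_powr)
      also have "\<dots> = 3 powr ?b * C * I powr (1 / r) * card A powr ?b" by (simp add: V_def powr_mult)
      also have "\<dots> \<le> (3 powr ?b * C * I powr (1 / r) + 1) * card A powr ?b" by (simp add: distrib_right)
      finally show "(V powr r * I) powr (1 / r) \<le> (3 powr ?b * C * I powr (1 / r) + 1) * card A powr ?b" .
    qed
    finally show ?thesis .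
  qed
  moreover have "0 < 3 powr ?b * C * I powr (1 / r) + 1" using C by (intro add_nonneg_pos) auto
  ultimately show ?thesis using that by blast
qed

text \<open>Compare with the shift closest to \<open>- x\<close>: every other one is at distance at least \<open>2 ^ n / 4\<close>.\<close>

lemma sum_shifts_le:
  assumes A: "finite A"
  shows "(\<Sum>n\<in>A. 1 / (1 + norm (x + shift n))) \<le> 9"
proof (cases "A = {}")
  case False
  obtain m where m: "m \<in> A" "\<And>n. n \<in> A \<Longrightarrow> norm (x + shift m) \<le> norm (x + shift n)"
    using arg_min_if_finite[OF A False, of "\<lambda>n. norm (x + shift n)"] by (metis not_le)
  have le: "1 / (1 + norm (x + shift n)) \<le> 4 * (1/2) ^ n" if n: "n \<in> A" "n \<noteq> m" for n
  proof -
    have "(2::real) ^ n \<le> 2 * \<bar>2 ^ n - 2 ^ m\<bar>"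
    proof (cases "m < n")
      case True
      then have le: "(2::real) ^ Suc m \<le> 2 ^ n" by (intro power_increasing) auto
      have "2 * b \<le> a \<Longrightarrow> a \<le> 2 * \<bar>a - b\<bar>" for a b :: real by (auto simp: abs_if)
      from this[of "2 ^ m" "2 ^ n"] le show ?thesis by simp
    next
      case False
      then have le: "(2::real) ^ Suc n \<le> 2 ^ m" using n by (intro power_increasing) auto
      have "0 \<le> a \<Longrightarrow> 2 * a \<le> b \<Longrightarrow> a \<le> 2 * \<bar>a - b\<bar>" for a b :: real by (auto simp: abs_if)
      from this[of "2 ^ n" "2 ^ m"] le show ?thesis by simp
    qed
    also have "\<bar>2 ^ n - 2 ^ m\<bar> = norm (shift n - shift m)"
      by (simp add: shift_def norm_e flip: scaleR_diff_left)
    also have "\<dots> \<le> norm (x + shift n) + norm (x + shift m)"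
      using norm_triangle_ineq4[of "x + shift n" "x + shift m"] by simp
    also have "\<dots> \<le> 2 * norm (x + shift n)" using m(2)[OF n(1)] by simp
    finally have "2 ^ n \<le> 4 * (1 + norm (x + shift n))" by simp
    then show ?thesis by (simp add: divide_simps add_nonneg_eq_0_iff power_one_over mult.commute) (smt (verit) norm_ge_zero)
  qed
  have "(\<Sum>n\<in>A. 1 / (1 + norm (x + shift n))) = 1 / (1 + norm (x + shift m)) + (\<Sum>n\<in>A - {m}. 1 / (1 + norm (x + shift n)))"
    using A m(1) by (simp add: sum.remove)
  also have "\<dots> \<le> 1 + (\<Sum>n\<in>A - {m}. 4 * (1/2) ^ n)"
    by (intro add_mono sum_mono le) (auto simp: divide_le_eq_1_pos add_pos_nonneg)
  also have "(\<Sum>n\<in>A - {m}. 4 * (1/2 :: real) ^ n) \<le> (\<Sum>n. 4 * (1/2) ^ n)"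
    using A by (intro sum_le_suminf summable_mult summable_geometric) auto
  also have "(\<Sum>n. 4 * (1/2 :: real) ^ n) = 8"
    by (simp add: suminf_mult suminf_geometric summable_geometric)
  finally show ?thesis by simp
qed simp

text \<open>The factor 3 counts the scales \<open>j\<close> within distance 1 of
  \<open>freq n\<close>.\<close>

lemma infsum_near_freq_le:
  assumes A: "finite A" and h: "\<And>n. 0 \<le> h n"
    and near: "\<And>j n. n \<in> A \<Longrightarrow> \<bar>j - int (freq n)\<bar> \<le> 1 \<Longrightarrow> f j \<le> ennreal (h n)"
    and far: "\<And>j. (\<And>n. n \<in> A \<Longrightarrow> 1 < \<bar>j - int (freq n)\<bar>) \<Longrightarrow> f j = 0"
  shows "infsum f B \<le> ennreal (3 * (\<Sum>n\<in>A. h n))"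
proof (rule infsum_le_ennreal)
  fix F :: "int set" assume F: "finite F"
  let ?g = "\<lambda>j n. if \<bar>j - int (freq n)\<bar> \<le> 1 then ennreal (h n) else 0"
  have "f j \<le> (\<Sum>n\<in>A. ?g j n)" for j
  proof (cases "\<exists>n\<in>A. \<bar>j - int (freq n)\<bar> \<le> 1")
    case True
    then obtain n where n: "n \<in> A" "\<bar>j - int (freq n)\<bar> \<le> 1" by blast
    then have "f j \<le> ?g j n" using near by simp
    also have "\<dots> \<le> (\<Sum>n\<in>A. ?g j n)" using A n by (intro member_le_sum) auto
    finally show ?thesis .
  next
    case False
    then show ?thesis using far[of j] by (force simp: not_le)
  qed
  then have "sum f F \<le> (\<Sum>j\<in>F. \<Sum>n\<in>A. ?g j n)" by (intro sum_mono)
  also have "\<dots> = (\<Sum>n\<in>A. \<Sum>j\<in>F. ?g j n)" by (rule sum.swap)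
  also have "\<dots> \<le> (\<Sum>n\<in>A. 3 * ennreal (h n))"
  proof (rule sum_mono)
    fix n
    have "(\<Sum>j\<in>F. ?g j n) = (\<Sum>j\<in>F \<inter> {int (freq n) - 1..int (freq n) + 1}. ?g j n)"
      using F by (intro sum.mono_neutral_right) auto
    also have "\<dots> \<le> (\<Sum>j\<in>{int (freq n) - 1..int (freq n) + 1}. ?g j n)" by (intro sum_mono2) auto
    also have "\<dots> = (\<Sum>j\<in>{int (freq n) - 1..int (freq n) + 1}. ennreal (h n))" by (intro sum.cong) auto
    also have "\<dots> = 3 * ennreal (h n)" by simp
    finally show "(\<Sum>j\<in>F. ?g j n) \<le> 3 * ennreal (h n)" .
  qed
  also have "\<dots> = ennreal (3 * (\<Sum>n\<in>A. h n))"
    using h by (simp add: sum_distrib_left[symmetric] ennreal_mult sum_nonneg sum_ennreal)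
  finally show "sum f F \<le> ennreal (3 * (\<Sum>n\<in>A. h n))" .
qed

text \<open>For \<open>q < p\<close> no spatial interaction has to be estimated: the sum \<open>S\<close> of the \<open>q\<close>-th powers is
  bounded, so \<open>S powr (p / q)\<close> is at most a constant times \<open>S\<close>.\<close>

lemma TL_norm_shifted_le:
  assumes q: "q = ennreal s" "s > 0" and qp: "q < p"
  obtains C where "C > 0" "\<And>A. finite A \<Longrightarrow> A \<noteq> {} \<Longrightarrow>
    TL_norm \<psi> p q (spread A) \<le> ennreal (C * card A powr enn2real (1 / p))"
proof -
  obtain M :: nat where "2 * real DIM('a) / s \<le> real M" using real_arch_simple by blast
  then have M: "2 * real DIM('a) \<le> M * s" using q by (simp add: field_simps)
  then have M1: "1 \<le> M * s" using DIM_positive[where 'a='a] by linarith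
  obtain C where C: "C > 0" "\<And>A y j n x. finite A \<Longrightarrow> n \<in> A \<Longrightarrow> \<bar>j - int (freq n)\<bar> \<le> 1 \<Longrightarrow>
      norm (LP_piece \<psi> j (packets A y) x) \<le> C / (1 + norm (x - y n)) ^ M"
    by (rule LP_piece_packets_upper[of M]) blast
  define I where "I = (LINT x|lborel. (1 + norm (x::'a)) powr (- (M * s)))"
  have I: "0 \<le> I" by (simp add: I_def)
  define h where "h x n = C powr s * (1 + norm (x + shift n)) powr (- (M * s))" for x n
  have h: "0 \<le> h x n" for x n by (simp add: h_def)
  \<comment> \<open>Three scales per packet times the 9 from \<open>sum_shifts_le\<close>, which
    applies because \<open>M * s\<close> is at least 1.\<close>
  define Y where "Y = 27 * C powr s"
  have Y: "Y > 0" using C by (simp add: Y_def)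
  have S_le: "3 * (\<Sum>n\<in>A. h x n) \<le> Y" if A: "finite A" for A x
  proof -
    have "(\<Sum>n\<in>A. (1 + norm (x + shift n)) powr (- (M * s))) \<le> (\<Sum>n\<in>A. 1 / (1 + norm (x + shift n)))"
    proof (rule sum_mono)
      fix n
      have "(1 + norm (x + shift n)) powr (- (M * s)) \<le> (1 + norm (x + shift n)) powr (- real 1)"
        using M1 by (intro powr_mono) auto
      then show "(1 + norm (x + shift n)) powr (- (M * s)) \<le> 1 / (1 + norm (x + shift n))"
        by (simp add: bracket_power del: of_nat_1)
    qed
    also have "\<dots> \<le> 9" by (rule sum_shifts_le[OF A])
    finally show ?thesis using C by (simp add: h_def Y_def flip: sum_distrib_left)
  qed
  have infsum_le: "(\<Sum>\<^sub>\<infinity>j\<in>B. epow (piece j (spread A) x) s)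
      \<le> ennreal (3 * (\<Sum>n\<in>A. h x n))" if A: "finite A" for A B x
  proof (rule infsum_near_freq_le[OF A h])
    fix j n assume n: "n \<in> A" "\<bar>j - int (freq n)\<bar> \<le> 1"
    have "norm (LP_piece \<psi> j (spread A) x) \<le> C * (1 + norm (x + shift n)) powr (- real M)"
      using C(2)[OF A n, of "\<lambda>n. - shift n" x] by (simp add: bracket_power)
    then have "epow (piece j (spread A) x) s
        \<le> epow (ennreal (C * (1 + norm (x + shift n)) powr (- real M))) s"
      using q by (intro epow_mono ennreal_leI) auto
    also have "\<dots> = ennreal (h x n)" using C(1) by (simp add: epow_ennreal h_def powr_mult powr_powr)
    finally show "epow (piece j (spread A) x) s \<le> ennreal (h x n)" .
  next
    fix j assume "\<And>n. n \<in> A \<Longrightarrow> 1 < \<bar>j - int (freq n)\<bar>"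
    then show "epow (piece j (spread A) x) s = 0"
      by (subst LP_piece_packets_far) auto
  qed
  have p: "0 < p" using qp by (auto intro: le_less_trans[OF zero_le])
  then show ?thesis
  proof (cases rule: exponent_cases)
    case infinite
    \<comment> \<open>Here the power of \<open>card A\<close> has exponent 0 and equals 1, and the
      pointwise bound by \<open>Y\<close> passes to the average over every cube.\<close>
    have "TL_norm \<psi> p q (spread A) \<le> ennreal (Y powr (1 / s) * card A powr enn2real (1 / p))"
      if A: "finite A" "A \<noteq> {}" for A
    proof -
      let ?F = "\<lambda>\<nu> x. \<Sum>\<^sub>\<infinity>j\<in>{\<nu>..}. epow (piece j (spread A) x) s"
      have "epow ((\<integral>\<^sup>+ x \<in> dyadic_cube \<nu> k. ?F \<nu> x \<partial>lborel)
          / emeasure lborel (dyadic_cube \<nu> k :: 'a set)) (1 / s) \<le> ennreal (Y powr (1 / s))" for \<nu> k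
      proof -
        let ?P = "dyadic_cube \<nu> k :: 'a set"
        have "(\<integral>\<^sup>+ x \<in> ?P. ?F \<nu> x \<partial>lborel)
            \<le> (\<integral>\<^sup>+ x \<in> ?P. ennreal Y \<partial>lborel)"
          using order_trans[OF infsum_le[OF A(1)] ennreal_leI[OF S_le[OF A(1)]]]
          by (intro nn_integral_mono mult_right_mono) auto
        also have "\<dots> = ennreal Y * emeasure lborel ?P"
          using sets_dyadic_cube[of \<nu> k] by (simp add: nn_integral_cmult_indicator)
        finally have "(\<integral>\<^sup>+ x \<in> ?P. ?F \<nu> x \<partial>lborel)
            / emeasure lborel ?P \<le> ennreal Y * emeasure lborel ?P / emeasure lborel ?P"
          by (rule divide_right_mono_ennreal)
        also have "\<dots> = ennreal Y"
          using emeasure_dyadic_cube[of \<nu> k] by (intro ennreal_mult_divide_eq) auto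
        finally show ?thesis using epow_mono[of _ "ennreal Y" "1 / s"] Y q by (simp add: epow_ennreal)
      qed
      then have "TL_norm \<psi> p q (spread A) \<le> ennreal (Y powr (1 / s))"
        using infinite q by (auto simp: TL_norm_def intro!: SUP_least)
      then show ?thesis using infinite A by simp
    qed
    then show ?thesis using that[of "Y powr (1 / s)"] Y by simp
  next
    case (finite r)
    have sr: "s < r" using qp q finite by (simp add: ennreal_less_iff)
    \<comment> \<open>The power of \<open>Y\<close> comes from splitting the power
      \<open>r / s\<close> of the sum as \<open>r / s - 1\<close> plus 1; the remaining factor is
      the integral of the contribution of one packet.\<close>
    define K where "K = Y powr (r / s - 1) * (3 * C powr s * I)"
    have K: "0 \<le> K" using I by (simp add: K_def)
    have "TL_norm \<psi> p q (spread A) \<le> ennreal ((K powr (1 / r) + 1) * card A powr enn2real (1 / p))"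
      if A: "finite A" "A \<noteq> {}" for A
    proof -
      let ?K = "ennreal (Y powr (r / s - 1) * (3 * C powr s))"
      have S0: "0 \<le> 3 * (\<Sum>n\<in>A. h x n)" for x using h by (simp add: sum_nonneg)
      have "TL_norm \<psi> p q (spread A) = Lnorm (ennreal r) lborel
          (\<lambda>x. lnorm q (\<lambda>j. piece j (spread A) x))"
        using finite by (simp add: TL_norm_def less_top[symmetric])
      also have "\<dots> \<le> ennreal ((K * card A) powr (1 / r))"
      proof (rule Lnorm_le_of_integral[OF finite(1)])
        show "0 \<le> K * card A" using K by simp
        show "0 \<le> (3 * (\<Sum>n\<in>A. h x n)) powr (1 / s)" for x by simp
        show "lnorm q (\<lambda>j. piece j (spread A) x) \<le> ennreal ((3 * (\<Sum>n\<in>A. h x n)) powr (1 / s))" for x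
        proof -
          have "epow (\<Sum>\<^sub>\<infinity>j. epow (piece j (spread A) x) s) (1 / s)
              \<le> epow (ennreal (3 * (\<Sum>n\<in>A. h x n))) (1 / s)"
            using q by (intro epow_mono infsum_le A) auto
          then show ?thesis using q S0[of x] by (simp add: lnorm_def epow_ennreal)
        qed
        have "(\<integral>\<^sup>+x. ennreal (((3 * (\<Sum>n\<in>A. h x n)) powr (1 / s)) powr r) \<partial>lborel)
            \<le> (\<integral>\<^sup>+x. (\<Sum>n\<in>A. ?K * ennreal ((1 + norm (x + shift n)) powr (- (M * s)))) \<partial>lborel)"
        proof (rule nn_integral_mono)
          fix x :: 'a
          let ?S = "3 * (\<Sum>n\<in>A. h x n)"
          have "(?S powr (1 / s)) powr r = ?S powr (r / s - 1) * ?S"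
          proof (cases "?S = 0")
            case False
            then have "?S > 0" using S0[of x] by linarith
            then show ?thesis by (simp add: powr_powr powr_diff)
          qed (use q in simp)
          also have "\<dots> \<le> Y powr (r / s - 1) * ?S"
            using S0[of x] S_le[OF A(1), of x] sr q by (intro mult_right_mono powr_mono2) auto
          also have "\<dots> = (\<Sum>n\<in>A. (Y powr (r / s - 1) * (3 * C powr s)) * (1 + norm (x + shift n)) powr (- (M * s)))"
            by (simp add: h_def sum_distrib_left mult_ac)
          finally have "ennreal ((?S powr (1 / s)) powr r)
              \<le> ennreal (\<Sum>n\<in>A. (Y powr (r / s - 1) * (3 * C powr s)) * (1 + norm (x + shift n)) powr (- (M * s)))"
            by (rule ennreal_leI)
          also have "\<dots> = (\<Sum>n\<in>A. ?K * ennreal ((1 + norm (x + shift n)) powr (- (M * s))))"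
            by (subst sum_ennreal[symmetric]) (auto simp: ennreal_mult)
          finally show "ennreal ((?S powr (1 / s)) powr r)
              \<le> (\<Sum>n\<in>A. ?K * ennreal ((1 + norm (x + shift n)) powr (- (M * s))))" .
        qed
        also have "\<dots> = (\<Sum>n\<in>A. ?K * (\<integral>\<^sup>+x. ennreal ((1 + norm (x + shift n)) powr (- (M * s))) \<partial>lborel))"
          by (simp add: nn_integral_sum nn_integral_cmult)
        also have "\<dots> = (\<Sum>n\<in>A. ?K * ennreal I)"
        proof (intro sum.cong refl arg_cong2[where f="(*)"])
          fix n
          have "(\<integral>\<^sup>+x. ennreal ((1 + norm (x + shift n)) powr (- (M * s))) \<partial>lborel)
              = (\<integral>\<^sup>+x. ennreal ((1 + norm (x::'a)) powr (- (M * s))) \<partial>lborel)"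
            by (subst nn_integral_lborel_affine[where c=1 and t="- shift n"]) auto
          also have "\<dots> = ennreal I" unfolding I_def by (rule nn_integral_bracket_finite[OF M])
          finally show "(\<integral>\<^sup>+x. ennreal ((1 + norm (x + shift n)) powr (- (M * s))) \<partial>lborel) = ennreal I" .
        qed
        also have "\<dots> = ennreal (K * card A)"
          using I by (simp add: K_def ennreal_mult ennreal_of_nat_eq_real_of_nat mult_ac)
        finally show "(\<integral>\<^sup>+x. ennreal (((3 * (\<Sum>n\<in>A. h x n)) powr (1 / s)) powr r) \<partial>lborel) \<le> ennreal (K * card A)" .
      qed
      also have "\<dots> \<le> ennreal ((K powr (1 / r) + 1) * card A powr enn2real (1 / p))"
        using K finite by (intro ennreal_leI) (simp add: powr_mult distrib_right)
      finally show ?thesis .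
    qed
    moreover have "K powr (1 / r) + 1 > 0" by (intro add_nonneg_pos) auto
    ultimately show ?thesis using that by blast
  qed
qed

text \<open>Of the value \<open>norm (\<psi> x0)\<close>, one third is lost to continuity over the
  cube and one third to the error in \<open>LP_piece_packet_lower\<close>, which is small from
  \<open>n0\<close> on. The diameter below 1 keeps the translates of the cube by different shifts
  disjoint, and \<open>\<nu> \<le> int (freq n0)\<close> places the packets' scales inside the inner
  sum of the norm at \<open>p = \<infinity>\<close>.\<close>

lemma LP_piece_packet_lower_cube:
  "\<exists>c \<nu> k n0. c > 0 \<and> \<nu> \<le> int (freq n0) \<and>
    (\<forall>n\<ge>n0. \<forall>y x. x - y \<in> dyadic_cube \<nu> k \<longrightarrow> c \<le> norm (own_piece n y x)) \<and>
    (\<forall>x\<in>dyadic_cube \<nu> k. \<forall>x'\<in>dyadic_cube \<nu> k. dist x x' < 1)"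
proof -
  obtain x0 where x0: "\<psi> x0 \<noteq> 0" using psi_nonzero by blast
  define c where "c = norm (\<psi> x0) / 3"
  have c: "c > 0" using x0 by (simp add: c_def)
  have "isCont \<psi> x0"
    using smooth_continuous_on[OF schwartz_smooth[OF schwartz_psi], of UNIV] by (simp add: continuous_on_eq_continuous_at)
  then obtain d where d: "d > 0" "\<And>x. dist x x0 < d \<Longrightarrow> dist (\<psi> x) (\<psi> x0) < c"
    using c by (metis continuous_at_eps_delta)
  have "min d (1/2) > 0" using d(1) by simp
  from dyadic_cube_in_ball[OF this, of x0]
  obtain \<nu> k where cube: "x0 \<in> dyadic_cube \<nu> k" "dyadic_cube \<nu> k \<subseteq> ball x0 (min d (1/2))"
    by metis
  obtain K where K: "K \<ge> 0" "\<And>n y x. norm (\<psi> (x - y)) - K * (1/2) ^ freq n \<le> norm (own_piece n y x)"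
    using LP_piece_packet_lower by blast
  obtain n1 :: nat where n1: "K / c < 2 ^ n1" using real_arch_pow[of 2] by auto
  define n0 where "n0 = max n1 (nat \<nu>)"
  have "K * (1/2) ^ freq n \<le> c" if "n0 \<le> n" for n
  proof -
    have "n1 \<le> freq n" using that by (simp add: n0_def freq_def)
    then have "(2::real) ^ n1 \<le> 2 ^ freq n" by (intro power_increasing) auto
    then have "K / c \<le> 2 ^ freq n" using n1 by linarith
    then show ?thesis using c by (simp add: power_one_over field_simps)
  qed
  moreover have "2 * c \<le> norm (\<psi> x)" if "x \<in> dyadic_cube \<nu> k" for x
  proof -
    have "dist x x0 < d" using cube that by (auto simp: dist_commute)
    then have "norm (\<psi> x0 - \<psi> x) < c" using d(2)[of x] by (metis dist_commute dist_norm)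
    then show ?thesis using norm_triangle_ineq2[of "\<psi> x0" "\<psi> x"] by (simp add: c_def)
  qed
  ultimately have "c \<le> norm (own_piece n y x)"
    if "n0 \<le> n" "x - y \<in> dyadic_cube \<nu> k" for n y x
    using K(2)[of x y n] that by fastforce
  moreover have "dist x x' < 1" if "x \<in> dyadic_cube \<nu> k" "x' \<in> dyadic_cube \<nu> k" for x x'
  proof -
    have "dist x0 x < 1/2" "dist x0 x' < 1/2" using cube that by auto
    then show ?thesis by (rule dist_triangle_half_r)
  qed
  moreover have "\<nu> \<le> int (freq n0)" by (simp add: n0_def freq_def)
  ultimately show ?thesis using c by blast
qed

text \<open>Monotonicity of \<open>a\<close> replaces the individual factors by the common lower
  bound \<open>a N\<close>.\<close>

lemma multiplier_piece_lower:
  assumes lower: "\<And>n y x. n0 \<le> n \<Longrightarrow> x - y \<in> D \<Longrightarrow> c \<le> norm (own_piece n y x)"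
    and A: "finite A" "n \<in> A" "A \<subseteq> {n0..N}" and c: "c > 0" and x: "x - shift n - y n \<in> D"
  shows "a N * c \<le> norm (LP_piece \<psi> (int (freq n)) (multiplier symbol (packets A y)) x)"
proof -
  have n: "n0 \<le> n" "n \<le> N" using A by auto
  have "a N * c \<le> a n * norm (own_piece n (y n) (x - shift n))"
    using a_antimono[OF n(2)] a_nonneg c lower[OF n(1) x] by (intro mult_mono) auto
  then show ?thesis using a_nonneg by (simp add: LP_piece_multiplier_at_freq[OF A(1,2)] norm_mult)
qed

lemma dist_shift: "m \<noteq> n \<Longrightarrow> 1 \<le> dist (shift m) (shift n)"
proof -
  have "1 \<le> dist (shift m) (shift n)" if "m < n" for m n
  proof -
    have "(2::real) ^ Suc m \<le> 2 ^ n" using that by (intro power_increasing) auto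
    moreover have "(1::real) \<le> 2 ^ m" by simp
    moreover have abs: "1 \<le> a \<Longrightarrow> 2 * a \<le> b \<Longrightarrow> 1 \<le> \<bar>a - b\<bar>" for a b :: real by (auto simp: abs_if)
    ultimately have "1 \<le> \<bar>2 ^ m - 2 ^ n :: real\<bar>" using abs[of "2 ^ m" "2 ^ n"] by simp
    then show ?thesis by (simp add: shift_def dist_norm norm_e flip: scaleR_diff_left)
  qed
  then show "m \<noteq> n \<Longrightarrow> 1 \<le> dist (shift m) (shift n)" by (metis dist_commute linorder_neqE_nat)
qed

text \<open>The image is large on disjoint translates of one cube, of total measure
  \<open>card A * \<mu>\<close>. At each of these points a single scale already gives the
  bound.\<close>

lemma TL_norm_multiplier_unshifted_ge:
  assumes p: "p = ennreal r" "r > 0" and q: "0 < q"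
  obtains c n0 where "c > 0" "\<And>A N. finite A \<Longrightarrow> A \<noteq> {} \<Longrightarrow> A \<subseteq> {n0..N} \<Longrightarrow>
    ennreal (c * a N * card A powr enn2real (1 / p)) \<le> TL_norm \<psi> p q (multiplier symbol (stacked A))"
proof -
  obtain c \<nu> k n0 where c: "c > 0" "\<nu> \<le> int (freq n0)"
    and lower_all: "\<forall>n\<ge>n0. \<forall>y x. x - y \<in> dyadic_cube \<nu> k \<longrightarrow> c \<le> norm (own_piece n y x)"
    and small: "\<forall>x\<in>dyadic_cube \<nu> k. \<forall>x'\<in>dyadic_cube \<nu> k. dist x x' < 1"
    using LP_piece_packet_lower_cube by (elim exE conjE) (rule that)
  have lower: "c \<le> norm (own_piece n y x)" if "n0 \<le> n" "x - y \<in> dyadic_cube \<nu> k" for n y x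
    using lower_all that by simp
  define \<mu> where "\<mu> = measure lborel (dyadic_cube \<nu> k :: 'a set)"
  have em: "emeasure lborel (dyadic_cube \<nu> k :: 'a set) = ennreal \<mu>"
    unfolding \<mu>_def using emeasure_dyadic_cube(2)[of \<nu> k] by (intro emeasure_eq_ennreal_measure) auto
  have \<mu>: "\<mu> > 0"
    unfolding \<mu>_def measure_def using emeasure_dyadic_cube[of \<nu> k] by (simp add: enn2real_positive_iff)
  have ip: "enn2real (1 / p) = 1 / r"
    using p by (metis divide_ennreal ennreal_1 enn2real_ennreal less_imp_le zero_le_divide_1_iff zero_le_one)
  have "ennreal (c * \<mu> powr (1 / r) * a N * card A powr enn2real (1 / p)) \<le> TL_norm \<psi> p q (multiplier symbol (stacked A))"
    if A: "finite A" "A \<noteq> {}" "A \<subseteq> {n0..N}" for A N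
  proof -
    define E where "E n = (\<lambda>x. x - shift n) -` dyadic_cube \<nu> k \<inter> space lborel" for n
    have [measurable]: "(dyadic_cube \<nu> k :: 'a set) \<in> sets borel" by (rule sets_dyadic_cube)
    have E: "E n \<in> sets lborel" for n unfolding E_def by measurable
    have "emeasure lborel (E n) = emeasure (distr lborel borel (\<lambda>x. x - shift n)) (dyadic_cube \<nu> k)" for n
      unfolding E_def by (subst emeasure_distr) auto
    moreover have "distr lborel borel (\<lambda>x. x - shift n) = lborel" for n
    proof -
      have "(\<lambda>x. x - shift n) = (+) (- shift n)" by (simp add: fun_eq_iff)
      then show ?thesis by (simp only: lborel_distr_plus)
    qed
    ultimately have emE: "emeasure lborel (E n) = ennreal \<mu>" for n using em by simp
    have "disjoint_family_on E A"
    proof (unfold disjoint_family_on_def, intro ballI impI)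
      fix m n :: nat assume "m \<noteq> n"
      then have far: "1 \<le> dist (shift m) (shift n)" by (rule dist_shift)
      show "E m \<inter> E n = {}"
      proof (rule ccontr)
        assume "E m \<inter> E n \<noteq> {}"
        then obtain x where "x - shift m \<in> dyadic_cube \<nu> k" "x - shift n \<in> dyadic_cube \<nu> k" by (auto simp: E_def)
        then have "dist (x - shift m) (x - shift n) < 1" using small by simp
        then show False using far by (simp add: dist_norm norm_minus_commute)
      qed
    qed
    then have "emeasure lborel (\<Union>n\<in>A. E n) = (\<Sum>n\<in>A. ennreal \<mu>)"
      using A(1) E by (subst sum_emeasure[symmetric]) (auto simp: emE)
    also have "\<dots> = ennreal (card A * \<mu>)" using \<mu> by (simp add: ennreal_mult ennreal_of_nat_eq_real_of_nat)
    finally have em_U: "emeasure lborel (\<Union>n\<in>A. E n) = ennreal (card A * \<mu>)" .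
    have "ennreal (a N * c * (card A * \<mu>) powr (1 / r)) \<le> Lnorm (ennreal r) lborel
        (\<lambda>x. lnorm q (\<lambda>j. piece j (multiplier symbol (stacked A)) x))"
    proof (rule Lnorm_ge_of_measure[OF p(2)])
      show "0 \<le> a N * c" using a_nonneg c by simp
      show "0 \<le> card A * \<mu>" using \<mu> by simp
      show "(\<Union>n\<in>A. E n) \<in> sets lborel" using A(1) E by auto
      show "ennreal (card A * \<mu>) \<le> emeasure lborel (\<Union>n\<in>A. E n)" using em_U by simp
      fix x assume "x \<in> (\<Union>n\<in>A. E n)"
      then obtain n where n: "n \<in> A" "x - shift n - 0 \<in> dyadic_cube \<nu> k" by (auto simp: E_def)
      have "ennreal (real (card {int (freq n)}) powr enn2real (1 / q) * (a N * c))
          \<le> lnorm q (\<lambda>j. piece j (multiplier symbol (stacked A)) x)"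
      proof (rule lnorm_ge_card[OF q])
        show "ennreal (a N * c) \<le> piece j (multiplier symbol (stacked A)) x"
          if "j \<in> {int (freq n)}" for j
          using that multiplier_piece_lower[where D="dyadic_cube \<nu> k" and x=x and y="\<lambda>_. 0", OF lower A(1) n(1) A(3) c(1)] n(2)
          by (auto intro: ennreal_leI)
      qed (use a_nonneg c in auto)
      then show "ennreal (a N * c) \<le> lnorm q (\<lambda>j. piece j (multiplier symbol (stacked A)) x)"
        by simp
    qed
    moreover have "a N * c * (card A * \<mu>) powr (1 / r) = c * \<mu> powr (1 / r) * a N * card A powr enn2real (1 / p)"
      using \<mu> by (simp add: powr_mult ip)
    ultimately show ?thesis using p by (simp add: TL_norm_def)
  qed
  then show ?thesis using that[of "c * \<mu> powr (1 / r)" n0] c \<mu> by simp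
qed

text \<open>After the translation all packets sit at the origin, so on one fixed cube
  \<open>card A\<close> scales are large simultaneously. That cube suffices for finite
  \<open>p\<close>, and for infinite \<open>p\<close> it is a competitor in the supremum.\<close>

lemma TL_norm_multiplier_shifted_ge:
  assumes q: "q = ennreal s" "s > 0" and p: "0 < p"
  obtains c n0 where "c > 0" "\<And>A N. finite A \<Longrightarrow> A \<noteq> {} \<Longrightarrow> A \<subseteq> {n0..N} \<Longrightarrow>
    ennreal (c * a N * card A powr enn2real (1 / q)) \<le> TL_norm \<psi> p q (multiplier symbol (spread A))"
proof -
  obtain c \<nu> k n0 where c: "c > 0" "\<nu> \<le> int (freq n0)"
    and lower_all: "\<forall>n\<ge>n0. \<forall>y x. x - y \<in> dyadic_cube \<nu> k \<longrightarrow> c \<le> norm (own_piece n y x)"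
    and small: "\<forall>x\<in>dyadic_cube \<nu> k. \<forall>x'\<in>dyadic_cube \<nu> k. dist x x' < 1"
    using LP_piece_packet_lower_cube by (elim exE conjE) (rule that)
  have lower: "c \<le> norm (own_piece n y x)" if "n0 \<le> n" "x - y \<in> dyadic_cube \<nu> k" for n y x
    using lower_all that by simp
  let ?P = "dyadic_cube \<nu> k :: 'a set"
  define \<mu> where "\<mu> = measure lborel ?P"
  have em: "emeasure lborel ?P = ennreal \<mu>"
    unfolding \<mu>_def using emeasure_dyadic_cube(2)[of \<nu> k] by (intro emeasure_eq_ennreal_measure) auto
  have \<mu>: "\<mu> > 0"
    unfolding \<mu>_def measure_def using emeasure_dyadic_cube[of \<nu> k] by (simp add: enn2real_positive_iff)
  have q0: "0 < q" using q by simp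
  have iq: "enn2real (1 / q) = 1 / s"
    using q by (metis divide_ennreal ennreal_1 enn2real_ennreal less_imp_le zero_le_divide_1_iff zero_le_one)
  have large_piece: "ennreal (a N * c) \<le> piece j (multiplier symbol (spread A)) x"
    if A: "finite A" "A \<subseteq> {n0..N}" and x: "x \<in> ?P" and j: "j \<in> (\<lambda>n. int (freq n)) ` A" for A N x j
    using j multiplier_piece_lower[where D="?P" and x=x and y="\<lambda>n. - shift n", OF lower A(1) _ A(2) c(1)] x
    by (auto intro: ennreal_leI)
  have card: "card ((\<lambda>n. int (freq n)) ` A) = card A" for A
    by (intro card_image inj_onI) (simp add: freq_def)
  show ?thesis
    using p
  proof (cases rule: exponent_cases)
    case infinite
    have "ennreal (c * a N * card A powr enn2real (1 / q)) \<le> TL_norm \<psi> p q (multiplier symbol (spread A))"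
      if A: "finite A" "A \<noteq> {}" "A \<subseteq> {n0..N}" for A N
    proof -
      let ?f = "\<lambda>x j. epow (piece j (multiplier symbol (spread A)) x) s"
      have v: "0 \<le> a N * c" using a_nonneg c by simp
      have "ennreal (card A * (a N * c) powr s) \<le> (\<Sum>\<^sub>\<infinity>j\<in>{\<nu>..}. ?f x j)" if x: "x \<in> ?P" for x
      proof -
        have "ennreal (card A * (a N * c) powr s) = (\<Sum>j\<in>(\<lambda>n. int (freq n)) ` A. epow (ennreal (a N * c)) s)"
          using v by (simp add: card epow_ennreal ennreal_mult ennreal_of_nat_eq_real_of_nat)
        also have "\<dots> \<le> (\<Sum>j\<in>(\<lambda>n. int (freq n)) ` A. ?f x j)"
          using q by (intro sum_mono epow_mono large_piece[OF A(1,3) x]) auto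
        also have "\<dots> \<le> (\<Sum>\<^sub>\<infinity>j\<in>{\<nu>..}. ?f x j)"
        proof (rule sum_le_infsum_ennreal)
          \<comment> \<open>The average over this cube counts only scales from \<open>\<nu>\<close>
            on; none of the packets in \<open>A\<close> is lost.\<close>
          show "(\<lambda>n. int (freq n)) ` A \<subseteq> {\<nu>..}"
            using A(3) c(2) by (auto simp: freq_def subset_iff)
        qed (use A in auto)
        finally show ?thesis .
      qed
      then have "(\<integral>\<^sup>+ x \<in> ?P. ennreal (card A * (a N * c) powr s) \<partial>lborel) \<le> (\<integral>\<^sup>+ x \<in> ?P. (\<Sum>\<^sub>\<infinity>j\<in>{\<nu>..}. ?f x j) \<partial>lborel)"
        by (intro nn_integral_mono) (auto simp: indicator_def)
      then have "ennreal (card A * (a N * c) powr s) * ennreal \<mu> \<le> (\<integral>\<^sup>+ x \<in> ?P. (\<Sum>\<^sub>\<infinity>j\<in>{\<nu>..}. ?f x j) \<partial>lborel)"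
        using sets_dyadic_cube[of \<nu> k] by (simp add: nn_integral_cmult_indicator em)
      then have "ennreal (card A * (a N * c) powr s) * ennreal \<mu> / ennreal \<mu>
          \<le> (\<integral>\<^sup>+ x \<in> ?P. (\<Sum>\<^sub>\<infinity>j\<in>{\<nu>..}. ?f x j) \<partial>lborel) / ennreal \<mu>"
        by (rule divide_right_mono_ennreal)
      moreover have "ennreal (card A * (a N * c) powr s) * ennreal \<mu> / ennreal \<mu> = ennreal (card A * (a N * c) powr s)"
        using \<mu> by (intro ennreal_mult_divide_eq) auto
      ultimately have "epow (ennreal (card A * (a N * c) powr s)) (1 / s)
          \<le> epow ((\<integral>\<^sup>+ x \<in> ?P. (\<Sum>\<^sub>\<infinity>j\<in>{\<nu>..}. ?f x j) \<partial>lborel) / emeasure lborel ?P) (1 / s)"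
        using q em by (intro epow_mono) auto
      also have "\<dots> \<le> TL_norm \<psi> p q (multiplier symbol (spread A))"
        using infinite q by (auto simp: TL_norm_def intro!: SUP_upper2[of "(\<nu>, k)"])
      also have "epow (ennreal (card A * (a N * c) powr s)) (1 / s) = ennreal (c * a N * card A powr enn2real (1 / q))"
        using v q(2) a_nonneg[of N] c(1) by (simp add: epow_ennreal powr_mult powr_powr iq mult_ac)
      finally show ?thesis .
    qed
    then show ?thesis using that c by blast
  next
    case (finite r)
    have "ennreal (c * \<mu> powr (1 / r) * a N * card A powr enn2real (1 / q)) \<le> TL_norm \<psi> p q (multiplier symbol (spread A))"
      if A: "finite A" "A \<noteq> {}" "A \<subseteq> {n0..N}" for A N
    proof -
      have "ennreal ((card A powr enn2real (1 / q) * (a N * c)) * \<mu> powr (1 / r)) \<le> Lnorm (ennreal r) lborel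
          (\<lambda>x. lnorm q (\<lambda>j. piece j (multiplier symbol (spread A)) x))"
      proof (rule Lnorm_ge_of_measure[OF finite(1)])
        show "?P \<in> sets lborel" using sets_dyadic_cube by simp
        fix x assume x: "x \<in> ?P"
        show "ennreal (card A powr enn2real (1 / q) * (a N * c))
            \<le> lnorm q (\<lambda>j. piece j (multiplier symbol (spread A)) x)"
          using lnorm_ge_card[OF q0, of "(\<lambda>n. int (freq n)) ` A" "a N * c"] large_piece[OF A(1,3) x] A a_nonneg c
          by (simp add: card)
      qed (use a_nonneg c \<mu> em in auto)
      then show ?thesis using finite by (simp add: TL_norm_def less_top[symmetric] mult_ac)
    qed
    then show ?thesis using that[of "c * \<mu> powr (1 / r)" n0] c \<mu> by simp
  qed
qed

text \<open>The test function has \<open>N\<close> consecutive packets starting at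
  \<open>n0\<close>. Since \<open>n0\<close> is dictated by the lower bound, the growth is assumed
  for every offset.\<close>

lemma not_TL_bounded_of_growth:
  assumes growth: "\<And>B n0. \<exists>N\<ge>1. B < a (n0 + N) * real N powr (\<alpha> - \<beta>)"
    and upper: "C > 0" "\<And>A. finite A \<Longrightarrow> A \<noteq> {} \<Longrightarrow> TL_norm \<psi> p q (packets A y) \<le> ennreal (C * card A powr \<beta>)"
    and lower: "c > 0" "\<And>A N. finite A \<Longrightarrow> A \<noteq> {} \<Longrightarrow> A \<subseteq> {n0..N} \<Longrightarrow>
      ennreal (c * a N * card A powr \<alpha>) \<le> TL_norm \<psi> p q (multiplier symbol (packets A y))"
  shows "\<not> TL_bounded \<psi> p q (multiplier symbol)"
proof
  assume "TL_bounded \<psi> p q (multiplier symbol)"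
  then obtain K where K: "\<And>f. f \<in> schwartz_infty \<Longrightarrow> TL_norm \<psi> p q (multiplier symbol f) \<le> ennreal K * TL_norm \<psi> p q f"
    unfolding TL_bounded_def by blast
  \<comment> \<open>The constant in \<open>TL_bounded\<close> may be negative, in which case
    \<open>ennreal\<close> truncates it to 0; hence \<open>max K 0\<close>.\<close>
  obtain N where N: "N \<ge> 1" "max K 0 * C / c < a (n0 + N) * real N powr (\<alpha> - \<beta>)" using growth by blast
  define A where "A = {n0..<n0 + N}"
  have A: "finite A" "A \<noteq> {}" "A \<subseteq> {n0..n0 + N}" "card A = N" using N by (auto simp: A_def)
  have "ennreal (c * a (n0 + N) * real N powr \<alpha>) \<le> TL_norm \<psi> p q (multiplier symbol (packets A y))"
    using lower(2)[OF A(1-3)] A(4) by simp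
  also have "\<dots> \<le> ennreal K * TL_norm \<psi> p q (packets A y)" by (rule K[OF packets_schwartz_infty])
  also have "\<dots> \<le> ennreal (max K 0) * ennreal (C * real N powr \<beta>)"
    using upper(2)[OF A(1,2)] A(4) by (intro mult_mono) (auto intro: ennreal_leI)
  also have "\<dots> = ennreal (max K 0 * (C * real N powr \<beta>))" using upper(1) by (simp add: ennreal_mult)
  finally have "c * a (n0 + N) * real N powr \<alpha> \<le> max K 0 * (C * real N powr \<beta>)"
    using upper(1) by (subst (asm) ennreal_le_iff) auto
  moreover have "max K 0 * (C * real N powr \<beta>) < c * a (n0 + N) * real N powr \<alpha>"
    using N lower(1) by (simp add: powr_diff field_simps)
  ultimately show False by linarith
qed

lemma not_TL_bounded:
  assumes p: "0 < p" and q: "0 < q" and pq: "p \<noteq> q"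
    and growth: "\<And>B n0. \<exists>N\<ge>1. B < a (n0 + N) * real N powr \<bar>enn2real (1 / p) - enn2real (1 / q)\<bar>"
  shows "\<not> TL_bounded \<psi> p q (multiplier symbol)"
proof (cases "p < q")
  case True
  have "enn2real (1 / q) \<le> enn2real (1 / p)"
    by (rule inverse_exponent_mono[OF p True])
  then have abs: "\<bar>enn2real (1 / p) - enn2real (1 / q)\<bar> = enn2real (1 / p) - enn2real (1 / q)" by simp
  obtain r where r: "p = ennreal r" "r > 0"
    using p True by (cases p) (auto simp: top_unique)
  obtain C where C: "C > 0" "\<And>A. finite A \<Longrightarrow> A \<noteq> {} \<Longrightarrow>
      TL_norm \<psi> p q (stacked A) \<le> ennreal (C * card A powr enn2real (1 / q))"
    by (rule TL_norm_unshifted_le[OF r q]) blast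
  obtain c n0 where c: "c > 0" "\<And>A N. finite A \<Longrightarrow> A \<noteq> {} \<Longrightarrow> A \<subseteq> {n0..N} \<Longrightarrow>
      ennreal (c * a N * card A powr enn2real (1 / p)) \<le> TL_norm \<psi> p q (multiplier symbol (stacked A))"
    by (rule TL_norm_multiplier_unshifted_ge[OF r q]) blast
  show ?thesis by (rule not_TL_bounded_of_growth[OF growth[unfolded abs] C c])
next
  case False
  then have qp: "q < p" using pq by simp
  have "enn2real (1 / p) \<le> enn2real (1 / q)"
    by (rule inverse_exponent_mono[OF q qp])
  then have abs: "\<bar>enn2real (1 / p) - enn2real (1 / q)\<bar> = enn2real (1 / q) - enn2real (1 / p)" by simp
  obtain s where s: "q = ennreal s" "s > 0"
    using q qp by (cases q) (auto simp: top_unique)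
  obtain C where C: "C > 0" "\<And>A. finite A \<Longrightarrow> A \<noteq> {} \<Longrightarrow>
      TL_norm \<psi> p q (spread A) \<le> ennreal (C * card A powr enn2real (1 / p))"
    by (rule TL_norm_shifted_le[OF s qp]) blast
  obtain c n0 where c: "c > 0" "\<And>A N. finite A \<Longrightarrow> A \<noteq> {} \<Longrightarrow> A \<subseteq> {n0..N} \<Longrightarrow>
      ennreal (c * a N * card A powr enn2real (1 / q)) \<le> TL_norm \<psi> p q (multiplier symbol (spread A))"
    by (rule TL_norm_multiplier_shifted_ge[OF s p]) blast
  show ?thesis by (rule not_TL_bounded_of_growth[OF growth[unfolded abs] C c])
qed

end

section \<open>The weights\<close>

text \<open>The offset 4 exceeds \<open>exp 1\<close>, beyond which \<open>x / ln x\<close> is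
  strictly increasing, and the quotient is at least 1 there.\<close>

definition weight :: "real \<Rightarrow> nat \<Rightarrow> real" where
  "weight \<sigma> k = ((real k + 4) / ln (real k + 4)) powr \<sigma>"

lemma ln_gt_1: "x \<ge> 4 \<Longrightarrow> 1 < ln (x::real)"
proof -
  assume x: "x \<ge> 4"
  have "exp 1 < x" using exp_le x by linarith
  then show ?thesis using x ln_less_cancel_iff[of "exp 1" x] by simp
qed

lemma div_ln_strict_mono:
  fixes x y :: real
  assumes "4 \<le> x" "x < y"
  shows "x / ln x < y / ln y"
proof (rule DERIV_pos_imp_increasing[OF assms(2)])
  fix z assume z: "x \<le> z"
  then have "z \<ge> 4" using assms by simp
  then have l: "1 < ln z" by (rule ln_gt_1)
  have "((\<lambda>x. x / ln x) has_real_derivative (ln z - 1) / (ln z)\<^sup>2) (at z)"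
    using \<open>z \<ge> 4\<close> l by (auto intro!: derivative_eq_intros simp: power2_eq_square)
  moreover have "(ln z - 1) / (ln z)\<^sup>2 > 0" using l by (intro divide_pos_pos) auto
  ultimately show "\<exists>d. ((\<lambda>x. x / ln x) has_real_derivative d) (at z) \<and> d > 0" by blast
qed

lemma div_ln_ge_1: "4 \<le> (x::real) \<Longrightarrow> 1 \<le> x / ln x"
  using ln_gt_1[of x] ln_le_minus_one[of x] by (simp add: le_divide_eq)

lemma strict_mono_weight: "\<sigma> > 0 \<Longrightarrow> strict_mono (weight \<sigma>)"
  unfolding strict_mono_def weight_def
proof (intro allI impI)
  fix k l :: nat assume \<sigma>: "\<sigma> > 0" and "k < l"
  then have "(real k + 4) / ln (real k + 4) < (real l + 4) / ln (real l + 4)"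
    by (intro div_ln_strict_mono) auto
  then show "((real k + 4) / ln (real k + 4)) powr \<sigma> < ((real l + 4) / ln (real l + 4)) powr \<sigma>"
    using div_ln_ge_1[of "real k + 4"] \<sigma> by (intro powr_less_mono2) auto
qed

lemma weight_ge_1: "\<sigma> > 0 \<Longrightarrow> 1 \<le> weight \<sigma> k"
  unfolding weight_def using div_ln_ge_1[of "real k + 4"] by (intro ge_one_powr_ge_zero) auto

text \<open>The logarithm costs only an arbitrarily small power, by
  \<open>ln x \<le> x powr \<delta> / \<delta>\<close>, so comparison with a convergent power series
  over the naturals applies.\<close>

lemma summable_weight:
  assumes \<sigma>: "\<sigma> > 0" and s: "s > 1 / \<sigma>"
  shows "summable (\<lambda>k. weight \<sigma> k powr (- s))"
proof -
  define \<tau> where "\<tau> = \<sigma> * s"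
  have \<tau>: "\<tau> > 1" using assms by (simp add: \<tau>_def field_simps)
  have eq: "weight \<sigma> k powr (- s) = ((real k + 4) / ln (real k + 4)) powr (- \<tau>)" for k
    by (simp add: weight_def powr_powr \<tau>_def)
  \<comment> \<open>Chosen so that the exponent after the loss is \<open>- (1 + \<tau>) / 2\<close>,
    halfway between \<open>- \<tau>\<close> and the critical value \<open>- 1\<close>.\<close>
  define \<delta> where "\<delta> = (\<tau> - 1) / (2 * \<tau>)"
  have \<delta>: "\<delta> > 0" "\<delta> * \<tau> - \<tau> = - ((1 + \<tau>) / 2)" using \<tau> by (simp_all add: \<delta>_def field_simps)
  have bound: "weight \<sigma> k powr (- s) \<le> (1 / \<delta>) powr \<tau> * real (k + 4) powr (- ((1 + \<tau>) / 2))" for k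
  proof -
    let ?x = "real k + 4"
    have x: "?x \<ge> 4" "ln ?x > 1" using ln_gt_1[of ?x] by auto
    have "ln ?x \<le> ?x powr \<delta> * (1 / \<delta>)" using ln_powr_bound[of ?x \<delta>] \<delta>(1) by simp
    then have "ln ?x powr \<tau> \<le> (?x powr \<delta> * (1 / \<delta>)) powr \<tau>" using x(2) \<tau> by (intro powr_mono2) auto
    also have "\<dots> = ?x powr (\<delta> * \<tau>) * (1 / \<delta>) powr \<tau>" using \<delta>(1) by (simp only: powr_mult powr_powr)
    finally have "?x powr (- \<tau>) * ln ?x powr \<tau> \<le> ?x powr (- \<tau>) * (?x powr (\<delta> * \<tau>) * (1 / \<delta>) powr \<tau>)"
      by (intro mult_left_mono) auto
    also have "\<dots> = (1 / \<delta>) powr \<tau> * ?x powr (- ((1 + \<tau>) / 2))"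
      unfolding \<delta>(2)[symmetric] diff_conv_add_uminus powr_add by (simp only: mult_ac)
    also have "?x powr (- \<tau>) * ln ?x powr \<tau> = (?x / ln ?x) powr (- \<tau>)"
      using x by (simp add: powr_divide powr_minus_divide)
    finally show ?thesis unfolding eq by (simp only: of_nat_add of_nat_numeral)
  qed
  have "summable (\<lambda>k. real k powr (- ((1 + \<tau>) / 2)))" using \<tau> by (simp add: summable_real_powr_iff)
  then have "summable (\<lambda>k. (1 / \<delta>) powr \<tau> * real (k + 4) powr (- ((1 + \<tau>) / 2)))"
    by (intro summable_mult summable_ignore_initial_segment)
  then show ?thesis by (rule summable_comparison_test'[where N=0]) (use bound in auto)
qed

lemma weight_le_exponential: "\<exists>W. \<forall>k. weight \<sigma> k \<le> W * 2 ^ k"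
proof -
  have "(\<lambda>k. weight \<sigma> k / 2 ^ k) \<longlonglongrightarrow> 0"
    unfolding weight_def by real_asymp
  then have "Bseq (\<lambda>k. weight \<sigma> k / 2 ^ k)" by (intro convergent_imp_Bseq convergentI)
  then obtain W where "\<And>k. norm (weight \<sigma> k / 2 ^ k) \<le> W" unfolding Bseq_def by blast
  then have "weight \<sigma> k / 2 ^ k \<le> W" for k by (metis abs_le_D1 real_norm_def)
  then show ?thesis by (auto simp: field_simps)
qed

text \<open>For fixed \<open>n0\<close> the quantity is asymptotic to
  \<open>(ln N / 11) powr \<sigma>\<close>; this is where the logarithm in the weight pays off. The
  18 in the proof is 14 plus the offset 4 of \<open>weight\<close>.\<close>

lemma weight_growth:
  assumes \<sigma>: "\<sigma> > 0"
  shows "\<exists>N\<ge>1. B < 1 / weight \<sigma> (11 * (n0 + N) + 14) * real N powr \<sigma>"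
proof -
  have "filterlim (\<lambda>N. 1 / ((11 * (real n0 + real N) + 18) / ln (11 * (real n0 + real N) + 18)) powr \<sigma> * real N powr \<sigma>) at_top sequentially"
    using \<sigma> by real_asymp
  then have "\<forall>\<^sub>F N in sequentially. B < 1 / weight \<sigma> (11 * (n0 + N) + 14) * real N powr \<sigma>"
    unfolding filterlim_at_top_dense weight_def by (simp add: algebra_simps)
  then have "\<forall>\<^sub>F N in sequentially. 1 \<le> N \<and> B < 1 / weight \<sigma> (11 * (n0 + N) + 14) * real N powr \<sigma>"
    using eventually_ge_at_top[of 1] by eventually_elim simp
  then show ?thesis by (rule eventually_happens'[OF sequentially_bot])
qed

theorem theorem4p2:
  fixes p q u t :: ennreal
    and \<phi> :: "real ^ 'd \<Rightarrow> real"
    and \<psi> :: "real ^ 'd \<Rightarrow> complex"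
  assumes "is_cutoff \<phi>" and "is_littlewood_paley \<psi>"
    and "0 < p" and "0 < q" and "p \<noteq> q"
    and "0 < u" and "u \<le> min 1 (min p q)" and "0 < t"
  shows "\<exists>(w :: nat \<Rightarrow> real) (m :: real ^ 'd \<Rightarrow> complex).
           strict_mono w \<and> (\<forall>k. 1 \<le> w k) \<and> m \<in> L_infty \<and>
           (\<forall>s > 1 / \<bar>enn2real (1 / p) - enn2real (1 / q)\<bar>. summable (\<lambda>k. w k powr (- s))) \<and>
           herz_mult \<phi> u t w m < \<infinity> \<and>
           \<not> TL_bounded \<psi> p q (multiplier m)"
proof -
  define \<sigma> where "\<sigma> = \<bar>enn2real (1 / p) - enn2real (1 / q)\<bar>"
  have \<sigma>: "\<sigma> > 0"
    using assms(3)
  proof (cases rule: exponent_cases)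
    case p: infinite
    from assms(4) show ?thesis by (cases rule: exponent_cases) (use p assms(5) in \<open>auto simp: \<sigma>_def\<close>)
  next
    case p: (finite r)
    from assms(4) show ?thesis
      by (cases rule: exponent_cases) (use p assms(5) in \<open>auto simp: \<sigma>_def\<close>)
  qed
  \<comment> \<open>The bound of \<open>u\<close> by 1 makes it finite, as the Herz estimate is
    stated for real exponents.\<close>
  have "u \<noteq> \<infinity>" using assms(7) by (auto simp: top_unique)
  then obtain r where u: "u = ennreal r" "r > 0"
    using assms(6) by (cases u) auto
  define w where "w = weight \<sigma>"
  have w: "strict_mono w" "\<And>k. 1 \<le> w k" unfolding w_def by (rule strict_mono_weight[OF \<sigma>], rule weight_ge_1[OF \<sigma>])
  have w_pos: "0 < w k" for k using w(2)[of k] by linarith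
  obtain W where W: "\<And>k. w k \<le> W * 2 ^ k" unfolding w_def using weight_le_exponential by blast
  \<comment> \<open>Guarantees \<open>a n * w l0 \<le> 1\<close> for every dilate that meets piece
    \<open>n\<close>, since its distance exponent \<open>l0\<close> is at most
    \<open>11 * n + 14\<close> and \<open>w\<close> is increasing.\<close>
  define a where "a n = 1 / w (11 * n + 14)" for n
  obtain e :: "real ^ 'd" where e: "e \<in> Basis" using nonempty_Basis by blast
  interpret lp_multiplier \<psi> e \<phi> a
  proof
    show "norm e = 1" using e by simp
    show "0 \<le> a n" "a n \<le> 1" for n using w(2)[of "11 * n + 14"] by (auto simp: a_def)
    show "a n \<le> a m" if "m \<le> n" for m n
    proof -
      have "w (11 * m + 14) \<le> w (11 * n + 14)"
        using that by (intro monoD[OF strict_mono_mono[OF w(1)]]) simp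
      then show ?thesis using w_pos by (simp add: a_def divide_left_mono)
    qed
  qed (use assms in auto)
  have "herz_mult \<phi> u t w symbol < \<infinity>"
    unfolding u using w_pos less_imp_le
    by (intro herz_mult_symbol_finite[OF assms(8) u(2) _ _ W] strict_mono_mono w) (auto simp: a_def)
  moreover have "\<exists>N\<ge>1. B < a (n0 + N) * real N powr \<bar>enn2real (1 / p) - enn2real (1 / q)\<bar>" for B n0
    using weight_growth[OF \<sigma>, of B n0] by (simp only: a_def w_def \<sigma>_def)
  then have "\<not> TL_bounded \<psi> p q (multiplier symbol)" by (rule not_TL_bounded[OF assms(3-5)])
  moreover have "\<forall>s > 1 / \<bar>enn2real (1 / p) - enn2real (1 / q)\<bar>. summable (\<lambda>k. w k powr (- s))"
    using summable_weight[OF \<sigma>] by (simp add: w_def \<sigma>_def)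
  ultimately show ?thesis using w symbol_L_infty by blast
qed

end
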